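(* Let $(J^s)_{s\in(1/2,1)}$ satisfy Hypothesis (H1) below, let $\varepsilon\in(0,1]$, $s\in(1/2,1)$, and let $F^s_\varepsilon$ be the (unique probability) equilibrium of $\partial_tu=\varepsilon^{-2s}(J^s_\varepsilon*u-u)+\mathrm{div}(xu)$. Then: (i)(a) $F^s_\varepsilon\in H^m(\mathbb{R}^d)$ for all $0<m<\frac{1}{\varepsilon^{2s}}-\frac d2$; (i)(b) $F^s_\varepsilon\notin H^m(\mathbb{R}^d)$ for all $m>\frac{1}{\varepsilon^{2s}}-\frac d2$; (ii)(a) $F^s_\varepsilon\in C^{\lfloor m\rfloor,m-\lfloor m\rfloor}(\mathbb{R}^d)$ for all $0<m<\frac1{\varepsilon^{2s}}-d$; (ii)(b) $F^s_\varepsilon\notin C^{\lfloor m\rfloor,m-\lfloor m\rfloor}(\mathbb{R}^d)$ for all $m>\frac{1}{\varepsilon^{2s}}$.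
   Context: $J^s_\varepsilon(x)=\varepsilon^{-d}J^s(x/\varepsilon)$; $\hat f(\xi)=\int e^{-ix\cdot\xi}f$; $C^{j,\alpha}$ denotes functions with $j$ derivatives, the $j$-th being $\alpha$-Hölder. An equilibrium is a probability density $F\in L^1$ solving $\varepsilon^{-2s}(J^s_\varepsilon*F-F)+\mathrm{div}(xF)=0$ weakly. Hypothesis (H1): $(J^s)_{s\in(1/2,1)}$ is a family of probability densities on $\mathbb{R}^d$ with $J^s\in L^1\cap L^p$ for some $p\in(1,\infty]$, such that (i) $\int\min\{1,|y|^2\}J^s<\infty$; (ii) there exist $\delta,C_0>0$ independent of $s$ with $\hat J^s(\xi)=1-|\xi|^{2s}+R_s(\xi)$, $|R_s(\xi)|\le C_0|\xi|^{2s+\delta}$ for $|\xi|\le1$; (iii) there exist $C,R>0$, $\Psi$ with $\int(1+|x|^2)|\Psi|<\infty$ and $\int x\Psi=0$, independent of $s$, with $J^s(x)\le C(1-s)|x|^{-d-2s}+\Psi(x)$ for $|x|\ge R$. *)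

theory Defs
  imports "HOL-Analysis.Analysis"
begin

definition fourier :: "('a::euclidean_space \<Rightarrow> real) \<Rightarrow> 'a \<Rightarrow> complex" where
  "fourier f \<xi> = (LINT x|lborel. cis (- (x \<bullet> \<xi>)) * complex_of_real (f x))"

definition prob_density :: "('a::euclidean_space \<Rightarrow> real) \<Rightarrow> bool" where
  "prob_density f \<longleftrightarrow> integrable lborel f \<and> (AE x in lborel. 0 \<le> f x)
      \<and> (LINT x|lborel. f x) = 1"

definition H1 :: "(real \<Rightarrow> 'a::euclidean_space \<Rightarrow> real) \<Rightarrow> bool" where
  "H1 J \<longleftrightarrow>
    (\<forall>s\<in>{1/2<..<1}.
       prob_density (J s)
     \<and> ((\<exists>p::real. p > 1 \<and> integrable lborel (\<lambda>x. \<bar>J s x\<bar> powr p))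
         \<or> (\<exists>M. AE x in lborel. \<bar>J s x\<bar> \<le> M))
     \<and> integrable lborel (\<lambda>y. min 1 (norm y ^ 2) * J s y))
   \<and> (\<exists>\<delta> C0. \<delta> > 0 \<and> C0 > 0 \<and>
       (\<forall>s\<in>{1/2<..<1}. \<forall>\<xi>::'a. norm \<xi> \<le> 1 \<longrightarrow>
          norm (fourier (J s) \<xi> - complex_of_real (1 - norm \<xi> powr (2 * s)))
            \<le> C0 * norm \<xi> powr (2 * s + \<delta>)))
   \<and> (\<exists>C R (\<Psi>::'a \<Rightarrow> real). C > 0 \<and> R > 0 \<and>
       \<Psi> \<in> borel_measurable lborel \<and>
       integrable lborel (\<lambda>x. (1 + norm x ^ 2) * \<bar>\<Psi> x\<bar>) \<and>
       (LINT x|lborel. \<Psi> x *\<^sub>R x) = 0 \<and>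
       (\<forall>s\<in>{1/2<..<1}. \<forall>x. norm x \<ge> R \<longrightarrow>
          J s x \<le> C * (1 - s) * norm x powr (- real DIM('a) - 2 * s) + \<Psi> x))"

definition rescale :: "real \<Rightarrow> ('a::euclidean_space \<Rightarrow> real) \<Rightarrow> 'a \<Rightarrow> real" where
  "rescale \<epsilon> K x = \<epsilon> powr (- real DIM('a)) * K (x /\<^sub>R \<epsilon>)"

definition conv :: "('a::euclidean_space \<Rightarrow> real) \<Rightarrow> ('a \<Rightarrow> real) \<Rightarrow> 'a \<Rightarrow> real" where
  "conv K f x = (LINT y|lborel. K (x - y) * f y)"

definition partial :: "'a::euclidean_space \<Rightarrow> ('a \<Rightarrow> real) \<Rightarrow> 'a \<Rightarrow> real" where
  "partial b f = (\<lambda>x. frechet_derivative f (at x) b)"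

fun dpart :: "'a::euclidean_space list \<Rightarrow> ('a \<Rightarrow> real) \<Rightarrow> 'a \<Rightarrow> real" where
  "dpart [] f = f"
| "dpart (b # bs) f = partial b (dpart bs f)"

definition Ck_bdd :: "nat \<Rightarrow> ('a::euclidean_space \<Rightarrow> real) \<Rightarrow> bool" where
  "Ck_bdd k f \<longleftrightarrow>
     (\<forall>bs. set bs \<subseteq> Basis \<and> length bs \<le> k \<longrightarrow>
        continuous_on UNIV (dpart bs f) \<and> bounded (range (dpart bs f)) \<and>
        (length bs < k \<longrightarrow> (\<forall>x. dpart bs f differentiable at x)))"

definition holder_space :: "nat \<Rightarrow> real \<Rightarrow> ('a::euclidean_space \<Rightarrow> real) \<Rightarrow> bool" where
  "holder_space k \<alpha> f \<longleftrightarrow> Ck_bdd k f \<and>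
     (\<forall>bs. set bs \<subseteq> Basis \<and> length bs = k \<longrightarrow>
        (\<exists>M. \<forall>x y. \<bar>dpart bs f x - dpart bs f y\<bar> \<le> M * dist x y powr \<alpha>))"

definition in_holder :: "nat \<Rightarrow> real \<Rightarrow> ('a::euclidean_space \<Rightarrow> real) \<Rightarrow> bool" where
  "in_holder k \<alpha> f \<longleftrightarrow> (\<exists>g. holder_space k \<alpha> g \<and> (AE x in lborel. f x = g x))"

definition sobolev_H :: "real \<Rightarrow> ('a::euclidean_space \<Rightarrow> real) \<Rightarrow> bool" where
  "sobolev_H m f \<longleftrightarrow>
     integrable lborel (\<lambda>\<xi>. (1 + norm \<xi> ^ 2) powr m * (cmod (fourier f \<xi>))^2)"

definition test_fun :: "('a::euclidean_space \<Rightarrow> real) \<Rightarrow> bool" where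
  "test_fun \<phi> \<longleftrightarrow> (\<forall>k. Ck_bdd k \<phi>) \<and> bounded {x. \<phi> x \<noteq> 0}"

text \<open>Equilibrium: probability density F solving
  eps^{-2s}(J_eps * F - F) + div(x F) = 0 weakly, i.e. for all test functions phi,
  eps^{-2s} int (J_eps*F - F) phi - int F (x . grad phi) = 0.\<close>
definition equilibrium :: "(real \<Rightarrow> 'a::euclidean_space \<Rightarrow> real) \<Rightarrow> real \<Rightarrow> real \<Rightarrow> ('a \<Rightarrow> real) \<Rightarrow> bool" where
  "equilibrium J s \<epsilon> F \<longleftrightarrow> prob_density F \<and>
     (\<forall>\<phi>. test_fun \<phi> \<longrightarrow>
        \<epsilon> powr (- 2 * s) * (LINT x|lborel. (conv (rescale \<epsilon> (J s)) F x - F x) * \<phi> x)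
        - (LINT x|lborel. F x * frechet_derivative \<phi> (at x) x) = 0)"

end

theory Submission
  imports Defs "HOL-Probability.Characteristic_Functions"
begin

text \<open>Write \<open>N = \<epsilon> powr (- 2 * s)\<close>. In Fourier variables the equilibrium equation is the ordinary
  differential equation \<open>t (d/dt) F^(t \<xi>) = N (J^(\<epsilon> t \<xi>) - 1) F^(t \<xi>)\<close> along rays, whose solution
  with \<open>F^(0) = 1\<close> is \<open>F^(\<xi>) = exp (- N \<integral> (1 - J^(\<epsilon> t \<xi>)) / t dt)\<close> over \<open>0 < t < 1\<close>.
  Since \<open>2 s > 1\<close>, the tail bound on \<open>J\<close> gives it a finite first moment; hence the exponent converges
  and is Lipschitz in \<open>\<xi>\<close>. Since \<open>J^\<close> vanishes at infinity (Riemann--Lebesgue), \<open>F^(\<xi>)\<close> lies between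
  powers of \<open>norm \<xi>\<close> with exponents arbitrarily close to \<open>- N\<close>, which decides the Sobolev
  claims and, by Fourier inversion, the positive Hoelder claim. For the negative Hoelder claim, a
  Gaussian window averages \<open>F^\<close> over a small fixed scale, on which the Lipschitz exponent leaves
  \<open>F^\<close> almost constant; Hoelder regularity of order \<open>m\<close> would therefore force
  the decay \<open>norm \<xi> powr (- m)\<close> of \<open>F^\<close> itself, which is too fast if \<open>m > N\<close>.\<close>

section \<open>Translations in L1 and the Riemann--Lebesgue lemma\<close>

text \<open>Beyond a fixed radius the integrand of the exponent is close to \<open>1 / t\<close>,
  which is the source of the logarithm and hence of the power law. Riemann--Lebesgue gives no speed,
  so the error is a small multiple of the same logarithm, that is, a small change of the power. The
  Sobolev threshold is where \<open>norm \<xi> powr (2 * m - 2 * N)\<close> stops being integrable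
  at infinity, whence half the dimension. The two Hoelder claims leave a gap as wide as the
  dimension: the positive one makes \<open>norm \<xi> powr m\<close> times the transform absolutely
  integrable, the negative one contradicts a pointwise lower bound. Two obstacles shape the rest.
  Test functions have compact support and no moment of \<open>F\<close> is known, so characters have
  to be truncated, and the truncation removed without ever forming the transform of
  \<open>x * F\<close>. And the error of the Gaussian average has to be small relative to the
  transform, which itself tends to 0; the exponential form is what turns a Lipschitz exponent into a
  relative error.\<close>

lemma lborel_integrable_affine:
  fixes f :: "'a::euclidean_space \<Rightarrow> 'b::{banach, second_countable_topology}"
  assumes f: "integrable lborel f" and c: "c \<noteq> 0"
  shows "integrable lborel (\<lambda>x. f (t + c *\<^sub>R x))"
proof -
  have [measurable]: "f \<in> borel_measurable borel"
    using borel_measurable_integrable[OF f] by simp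
  have "integrable (density (distr lborel borel (\<lambda>x. t + c *\<^sub>R x)) (\<lambda>_. ennreal (\<bar>c\<bar> ^ DIM('a)))) f"
    using f by (subst (asm) lborel_affine[OF c, of t]) (simp add: ennreal_power)
  then have "integrable lborel (\<lambda>x. \<bar>c\<bar> ^ DIM('a) *\<^sub>R f (t + c *\<^sub>R x))"
    by (simp add: integrable_density integrable_distr_eq)
  from integrable_scaleR_right[OF this, of "1 / \<bar>c\<bar> ^ DIM('a)"] show ?thesis
    using c by simp
qed

text \<open>No integrability is assumed: by the inverse substitution both integrands fail to be
  integrable together, and both integrals then have the default value 0.\<close>

lemma lborel_integral_affine:
  fixes f :: "'a::euclidean_space \<Rightarrow> 'b::{banach, second_countable_topology}"
  assumes c: "c \<noteq> 0"
  shows "(\<integral>x. f x \<partial>lborel) = \<bar>c\<bar> ^ DIM('a) *\<^sub>R (\<integral>x. f (t + c *\<^sub>R x) \<partial>lborel)"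
proof (cases "integrable lborel f")
  case True
  then have [measurable]: "f \<in> borel_measurable borel"
    using borel_measurable_integrable by force
  have eq: "lborel = density (distr lborel borel (\<lambda>x::'a. t + c *\<^sub>R x)) (\<lambda>_. ennreal (\<bar>c\<bar> ^ DIM('a)))"
    using lborel_affine[OF c, of t] by (simp add: ennreal_power)
  show ?thesis
    by (subst eq) (use c in \<open>simp add: integral_density integral_distr\<close>)
next
  case False
  have "\<not> integrable lborel (\<lambda>x. f (t + c *\<^sub>R x))"
  proof
    assume "integrable lborel (\<lambda>x. f (t + c *\<^sub>R x))"
    from lborel_integrable_affine[OF this, of "1/c" "- (1/c) *\<^sub>R t"] c False show False
      by (simp add: scaleR_diff_right)
  qed
  with False show ?thesis
    by (simp add: not_integrable_integral_eq)
qed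

lemma lborel_integrable_translate:
  fixes f :: "'a::euclidean_space \<Rightarrow> 'b::{banach, second_countable_topology}"
  shows "integrable lborel f \<Longrightarrow> integrable lborel (\<lambda>x. f (t + x))"
  using lborel_integrable_affine[of f 1 t] by simp

lemma lborel_integral_translate:
  fixes f :: "'a::euclidean_space \<Rightarrow> 'b::{banach, second_countable_topology}"
  shows "(\<integral>x. f (t + x) \<partial>lborel) = (\<integral>x. f x \<partial>lborel)"
  using lborel_integral_affine[of 1 f t] by simp

lemma
  fixes f :: "'a::euclidean_space \<Rightarrow> real \<Rightarrow> 'b::{real_normed_field,banach,second_countable_topology}"
  assumes f: "\<And>i. i \<in> Basis \<Longrightarrow> integrable lborel (f i)"
  shows lborel_integrable_prod: "integrable lborel (\<lambda>x. \<Prod>i\<in>Basis. f i (x \<bullet> i))"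
    and lborel_integral_prod:
      "(\<integral>x. (\<Prod>i\<in>Basis. f i (x \<bullet> i)) \<partial>lborel) = (\<Prod>i\<in>Basis. \<integral>t. f i t \<partial>lborel)"
proof -
  interpret product_sigma_finite "\<lambda>i::'a. lborel :: real measure" ..
  have m [measurable]: "i \<in> Basis \<Longrightarrow> f i \<in> borel_measurable borel" for i
    using borel_measurable_integrable[OF f] by simp
  have meas: "(\<lambda>x::'a. \<Prod>i\<in>Basis. f i (x \<bullet> i)) \<in> borel_measurable borel"
    by measurable
  have T: "(\<lambda>g. \<Sum>b\<in>Basis. g b *\<^sub>R b) \<in> (\<Pi>\<^sub>M b\<in>Basis. lborel) \<rightarrow>\<^sub>M (borel :: 'a measure)"
    by measurable
  have eq: "(\<Prod>i\<in>Basis. f i ((\<Sum>b\<in>Basis. g b *\<^sub>R b) \<bullet> i)) = (\<Prod>i\<in>Basis. f i (g i))" for g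
    by (intro prod.cong) auto
  show "integrable lborel (\<lambda>x. \<Prod>i\<in>Basis. f i (x \<bullet> i))"
    unfolding lborel_eq[where 'a='a]
    by (subst integrable_distr_eq[OF T meas], unfold eq) (intro product_integrable_prod f finite_Basis)
  show "(\<integral>x. (\<Prod>i\<in>Basis. f i (x \<bullet> i)) \<partial>lborel) = (\<Prod>i\<in>Basis. \<integral>t. f i t \<partial>lborel)"
    by (subst lborel_eq[where 'a='a], subst integral_distr[OF T meas], unfold eq)
      (intro product_integral_prod f finite_Basis)
qed

text \<open>A point of an open set stays in it under small shifts, so the part of \<open>U\<close>
  that is shifted out of \<open>U\<close> vanishes by dominated convergence. The opposite part has
  no such pointwise control at the boundary, but translation invariance gives it the same measure,
  whence the factor 2 in \<open>eq\<close>.\<close>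

lemma translation_continuous_open:
  fixes U :: "'a::euclidean_space set"
  assumes U: "open U" "emeasure lborel U < \<infinity>" and h: "h \<longlonglongrightarrow> 0"
  shows "(\<lambda>n. \<integral>x. \<bar>indicator U (h n + x) - indicator U x\<bar> \<partial>lborel) \<longlonglongrightarrow> (0::real)"
proof -
  have [measurable]: "U \<in> sets borel" using U by auto
  have I: "integrable lborel (indicator U :: 'a \<Rightarrow> real)"
    using U by (simp add: integrable_indicator_iff)
  have I2: "integrable lborel (\<lambda>x. indicator U (h n + x) :: real)" for n
    using lborel_integrable_translate[OF I] by simp
  have I3: "integrable lborel (\<lambda>x. indicator U x * (1 - indicator U (h n + x)) :: real)" for n
    by (rule Bochner_Integration.integrable_bound[OF I]) (auto simp: indicator_def)
  have eq: "(\<integral>x. \<bar>indicator U (h n + x) - indicator U x\<bar> \<partial>lborel)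
      = (2::real) * (\<integral>x. indicator U x * (1 - indicator U (h n + x)) \<partial>lborel)" for n
  proof -
    have "(\<integral>x. \<bar>indicator U (h n + x) - indicator U x\<bar> \<partial>lborel)
       = (\<integral>x. (indicator U (h n + x) - indicator U x :: real) + 2 * (indicator U x * (1 - indicator U (h n + x))) \<partial>lborel)"
      by (intro Bochner_Integration.integral_cong) (auto simp: indicator_def)
    also have "\<dots> = 2 * (\<integral>x. indicator U x * (1 - indicator U (h n + x)) \<partial>lborel)"
      using I I2[of n] I3[of n] lborel_integral_translate[of "indicator U :: 'a \<Rightarrow> real" "h n"]
      by simp
    finally show ?thesis .
  qed
  have "(\<lambda>n. \<integral>x. indicator U x * (1 - indicator U (h n + x)) \<partial>lborel) \<longlonglongrightarrow> (\<integral>x. (0::real) \<partial>(lborel :: 'a measure))"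
  proof (rule integral_dominated_convergence[where w="indicator U"])
    show "AE x in lborel. (\<lambda>n. indicator U x * (1 - indicator U (h n + x)) :: real) \<longlonglongrightarrow> 0"
    proof (rule AE_I2)
      fix x :: 'a
      show "(\<lambda>n. indicator U x * (1 - indicator U (h n + x)) :: real) \<longlonglongrightarrow> 0"
      proof (cases "x \<in> U")
        case True
        have "(\<lambda>n. h n + x) \<longlonglongrightarrow> x" using tendsto_add[OF h tendsto_const[of x]] by simp
        then have "eventually (\<lambda>n. h n + x \<in> U) sequentially"
          using topological_tendstoD[OF _ U(1) True] by blast
        then have "eventually (\<lambda>n. indicator U x * (1 - indicator U (h n + x)) = (0::real)) sequentially"
          by eventually_elim simp
        then show ?thesis by (rule tendsto_eventually)
      qed simp
    qed
  qed (use I in \<open>auto simp: indicator_def\<close>)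
  then show ?thesis
    unfolding eq using tendsto_mult_right_zero by fastforce
qed

text \<open>Induction over integrable functions: indicators are compared with an open superset from
  outer regularity, sums use the triangle inequality, and a limit inherits the property because its
  distance to an approximant is the same before and after the shift.\<close>

lemma translation_continuous_L1:
  fixes f :: "'a::euclidean_space \<Rightarrow> real"
  assumes f: "integrable lborel f" and h: "h \<longlonglongrightarrow> 0"
  shows "(\<lambda>n. \<integral>x. \<bar>f (h n + x) - f x\<bar> \<partial>lborel) \<longlonglongrightarrow> 0"
  using f
proof (induct rule: integrable_induct)
  case (base A c)
  have *: "(\<lambda>n. \<integral>x. \<bar>indicator A (h n + x) - indicator A x\<bar> \<partial>lborel) \<longlonglongrightarrow> (0::real)"
  proof (rule LIMSEQ_I)
    fix r :: real assume "r > 0"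
    have [measurable]: "A \<in> sets borel" using base by simp
    \<comment> \<open>The excess \<open>U - A\<close> enters twice, shifted and unshifted, so
      \<open>r/4\<close> here leaves \<open>r/2\<close> for the open set.\<close>
    obtain U where U: "open U" "A \<subseteq> U" "emeasure lborel (U - A) < ennreal (r/4)"
      using outer_regular_lborel[of A "r/4"] \<open>r > 0\<close> by auto
    have [measurable]: "U \<in> sets borel" using U by auto
    have "emeasure lborel U \<le> emeasure lborel (U - A) + emeasure lborel A"
      by (rule order_trans[OF emeasure_mono emeasure_subadditive]) auto
    also have "\<dots> < \<infinity>" using U(3) base(2) by (auto simp: ennreal_add_less_top dest: less_trans[OF _ ennreal_less_top])
    finally have Uf: "emeasure lborel U < \<infinity>" .
    have Uf': "emeasure lborel (U - A) < \<infinity>" using less_trans[OF U(3) ennreal_less_top] by simp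
    have I: "integrable lborel (indicator A :: 'a \<Rightarrow> real)" "integrable lborel (indicator U :: 'a \<Rightarrow> real)"
      "integrable lborel (indicator (U - A) :: 'a \<Rightarrow> real)"
      using Uf Uf' base by (simp_all add: integrable_indicator_iff)
    have le: "(\<integral>x. indicator (U - A) x \<partial>lborel) < r/4"
      using U(3) I(3) \<open>r > 0\<close> by (subst (asm) emeasure_eq_ennreal_measure) (auto simp: ennreal_less_iff less_top[symmetric] integrable_indicator_iff simp del: ennreal_divide_numeral)
    obtain N where N: "\<And>n. n \<ge> N \<Longrightarrow> norm ((\<integral>x. \<bar>indicator U (h n + x) - indicator U x\<bar> \<partial>lborel) :: real) < r/2"
      using LIMSEQ_D[OF translation_continuous_open[OF U(1) Uf h], of "r/2"] \<open>r > 0\<close> by auto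
    show "\<exists>N. \<forall>n\<ge>N. norm ((\<integral>x. \<bar>indicator A (h n + x) - indicator A x\<bar> \<partial>lborel) - (0::real)) < r"
    proof (intro exI allI impI)
      fix n assume "n \<ge> N"
      have J: "integrable lborel (\<lambda>x. \<bar>indicator U (h n + x) - indicator U x\<bar> :: real)"
         "integrable lborel (\<lambda>x. indicator (U-A) (h n + x) :: real)"
         "integrable lborel (\<lambda>x. \<bar>indicator A (h n + x) - indicator A x\<bar> :: real)"
        using I lborel_integrable_translate[OF I(1)] lborel_integrable_translate[OF I(2)] lborel_integrable_translate[OF I(3)] by auto
      have "(\<integral>x. \<bar>indicator A (h n + x) - indicator A x\<bar> \<partial>lborel) \<le>
         (\<integral>x. (\<bar>indicator U (h n + x) - indicator U x\<bar> + indicator (U - A) (h n + x) + indicator (U - A) x :: real) \<partial>lborel)"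
        using U(2) by (intro integral_mono J I Bochner_Integration.integrable_add) (auto simp: indicator_def)
      also have "\<dots> = (\<integral>x. \<bar>indicator U (h n + x) - indicator U x\<bar> \<partial>lborel) + 2 * (\<integral>x. indicator (U - A) x \<partial>lborel)"
        using J I lborel_integral_translate[of "indicator (U - A) :: 'a \<Rightarrow> real" "h n"] by simp
      also have "\<dots> < r" using le N[OF \<open>n \<ge> N\<close>] by auto
      finally show "norm ((\<integral>x. \<bar>indicator A (h n + x) - indicator A x\<bar> \<partial>lborel) - (0::real)) < r"
        by (simp add: abs_of_nonneg integral_nonneg_AE)
    qed
  qed
  have "\<bar>indicator A x *\<^sub>R c - indicator A y *\<^sub>R c\<bar> = \<bar>c\<bar> * \<bar>indicator A x - indicator A y\<bar>" for x y
    by (simp add: abs_mult[symmetric] algebra_simps)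
  then show ?case
    using tendsto_mult_right_zero[OF *, of "\<bar>c\<bar>"] by simp
next
  case (add f g)
  have J: "integrable lborel (\<lambda>x. \<bar>f (h n + x) - f x\<bar>)" "integrable lborel (\<lambda>x. \<bar>g (h n + x) - g x\<bar>)" for n
    using add lborel_integrable_translate[of f] lborel_integrable_translate[of g] by auto
  show ?case
  proof (rule Lim_null_comparison[OF _ tendsto_add_zero[OF add(2) add(4)]], intro always_eventually allI)
    fix n
    have "(\<integral>x. \<bar>f (h n + x) + g (h n + x) - (f x + g x)\<bar> \<partial>lborel) \<le> (\<integral>x. \<bar>f (h n + x) - f x\<bar> + \<bar>g (h n + x) - g x\<bar> \<partial>lborel)"
      by (rule integral_mono_AE') (use J in auto)
    then show "norm (\<integral>x. \<bar>f (h n + x) + g (h n + x) - (f x + g x)\<bar> \<partial>lborel) \<le> (\<integral>x. \<bar>f (h n + x) - f x\<bar> \<partial>lborel) + (\<integral>x. \<bar>g (h n + x) - g x\<bar> \<partial>lborel)"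
      using J by (simp add: abs_of_nonneg integral_nonneg_AE)
  qed
next
  case (lim f s)
  have d: "(\<lambda>i. \<integral>x. \<bar>s i x - f x\<bar> \<partial>lborel) \<longlonglongrightarrow> (\<integral>x. (0::real) \<partial>(lborel :: 'a measure))"
  \<comment> \<open>The approximants are bounded by \<open>2 * norm (f x)\<close>; the limit itself
    adds the third copy.\<close>
  proof (rule integral_dominated_convergence[where w="\<lambda>x. 3 * norm (f x)"])
    show "AE x in lborel. (\<lambda>i. \<bar>s i x - f x\<bar>) \<longlonglongrightarrow> 0"
      using lim(3) by (intro AE_I2 tendsto_rabs_zero) (auto intro: LIM_zero)
    show "AE x in lborel. norm \<bar>s i x - f x\<bar> \<le> 3 * norm (f x)" for i
    proof (rule AE_I2)
      fix x show "norm \<bar>s i x - f x\<bar> \<le> 3 * norm (f x)" using lim(4)[of x i] by simp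
    qed
  qed (use lim in \<open>auto intro: borel_measurable_integrable\<close>)
  show ?case
  proof (rule LIMSEQ_I)
    fix r :: real assume "r > 0"
    obtain i where i: "(\<integral>x. \<bar>s i x - f x\<bar> \<partial>lborel) < r/4"
      using LIMSEQ_D[OF d, of "r/4"] \<open>r > 0\<close> by (force simp: abs_of_nonneg)
    obtain N where N: "\<And>n. n \<ge> N \<Longrightarrow> norm ((\<integral>x. \<bar>s i (h n + x) - s i x\<bar> \<partial>lborel) :: real) < r/2"
      using LIMSEQ_D[OF lim(2)[of i], of "r/2"] \<open>r > 0\<close> by auto
    show "\<exists>N. \<forall>n\<ge>N. norm ((\<integral>x. \<bar>f (h n + x) - f x\<bar> \<partial>lborel) - (0::real)) < r"
    proof (intro exI allI impI)
      fix n assume "n \<ge> N"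
      have D: "integrable lborel (\<lambda>x. \<bar>s i x - f x\<bar>)" using lim by auto
      have J: "integrable lborel (\<lambda>x. \<bar>s i (h n + x) - s i x\<bar>)"
        using lim(1)[of i] lborel_integrable_translate[of "s i"] by auto
      have "(\<integral>x. \<bar>f (h n + x) - f x\<bar> \<partial>lborel) \<le>
         (\<integral>x. \<bar>s i (h n + x) - s i x\<bar> + \<bar>s i (h n + x) - f (h n + x)\<bar> + \<bar>s i x - f x\<bar> \<partial>lborel)"
        by (rule integral_mono_AE')
          (use J D lborel_integrable_translate[OF D, of "h n"] in auto)
      also have "\<dots> = (\<integral>x. \<bar>s i (h n + x) - s i x\<bar> \<partial>lborel) + 2 * (\<integral>x. \<bar>s i x - f x\<bar> \<partial>lborel)"
        using J D lborel_integrable_translate[OF D, of "h n"] lborel_integral_translate[of "\<lambda>x. \<bar>s i x - f x\<bar>" "h n"] by simp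
      also have "\<dots> < r" using i N[OF \<open>n \<ge> N\<close>] by auto
      finally show "norm ((\<integral>x. \<bar>f (h n + x) - f x\<bar> \<partial>lborel) - (0::real)) < r"
        by (simp add: abs_of_nonneg integral_nonneg_AE)
    qed
  qed
qed

section \<open>Vanishing of Fourier transforms at infinity\<close>

lemma cis_measurable [measurable]: "cis \<in> borel_measurable borel"
  by (intro borel_measurable_continuous_onI continuous_intros)

lemma integrable_cis_mult:
  fixes f :: "'a::euclidean_space \<Rightarrow> real"
  assumes "integrable lborel f" and [measurable]: "p \<in> borel_measurable borel"
  shows "integrable lborel (\<lambda>x. cis (p x) * of_real (f x))"
  by (rule Bochner_Integration.integrable_bound[OF assms(1)])
     (use assms borel_measurable_integrable[OF assms(1)] in \<open>auto simp: norm_mult\<close>)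

text \<open>Shifting by \<open>h\<close> multiplies the character by
  \<open>cis (- pi) = - 1\<close>. Adding the shifted and the unshifted integral therefore produces
  twice the transform on one side and a difference of \<open>f\<close> on the other.\<close>

lemma fourier_add_half_period:
  fixes f :: "'a::euclidean_space \<Rightarrow> real"
  assumes f: "integrable lborel f" and h: "h \<bullet> \<xi> = pi"
  shows "2 * norm (fourier f \<xi>) \<le> (\<integral>x. \<bar>f (h + x) - f x\<bar> \<partial>lborel)"
proof -
  have I: "integrable lborel (\<lambda>x. cis (- (x \<bullet> \<xi>)) * of_real (f x))"
     "integrable lborel (\<lambda>x. cis (- (x \<bullet> \<xi>)) * of_real (f (h + x)))"
    using f lborel_integrable_translate[OF f] by (auto intro!: integrable_cis_mult)
  have "fourier f \<xi> = (\<integral>x. cis (- ((h + x) \<bullet> \<xi>)) * of_real (f (h + x)) \<partial>lborel)"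
    unfolding fourier_def by (rule lborel_integral_translate[symmetric])
  also have "\<dots> = (\<integral>x. - (cis (- (x \<bullet> \<xi>)) * of_real (f (h + x))) \<partial>lborel)"
  proof (rule Bochner_Integration.integral_cong[OF refl])
    fix x
    have "cis (- ((h + x) \<bullet> \<xi>)) = cis (- pi) * cis (- (x \<bullet> \<xi>))"
      by (simp only: cis_mult inner_add_left h minus_add_distrib)
    then show "cis (- ((h + x) \<bullet> \<xi>)) * of_real (f (h + x)) = - (cis (- (x \<bullet> \<xi>)) * of_real (f (h + x)))"
      by (simp add: complex_eq_iff)
  qed
  also have "\<dots> = - (\<integral>x. cis (- (x \<bullet> \<xi>)) * of_real (f (h + x)) \<partial>lborel)"
    by simp
  finally have "2 * fourier f \<xi> = (\<integral>x. cis (- (x \<bullet> \<xi>)) * of_real (f x - f (h + x)) \<partial>lborel)"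
    using I unfolding mult_2 by (subst (1) fourier_def) (simp add: algebra_simps)
  then have "norm (2 * fourier f \<xi>) \<le> (\<integral>x. norm (cis (- (x \<bullet> \<xi>)) * of_real (f x - f (h + x))) \<partial>lborel)"
    by simp
  also have "\<dots> = (\<integral>x. \<bar>f (h + x) - f x\<bar> \<partial>lborel)"
    by (simp add: norm_mult abs_minus_commute del: of_real_diff)
  finally show ?thesis by (simp add: norm_mult)
qed

text \<open>The vector \<open>(pi / norm \<xi> ^ 2) *\<^sub>R \<xi>\<close> is a half period for
  \<open>\<xi>\<close> and has length \<open>pi / norm \<xi>\<close>, so it tends to 0 as
  \<open>\<xi>\<close> grows and continuity of translations applies. Arguing by contradiction
  supplies the sequence which that continuity statement requires.\<close>

theorem riemann_lebesgue:
  fixes f :: "'a::euclidean_space \<Rightarrow> real"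
  assumes f: "integrable lborel f" and "\<eta> > 0"
  obtains R where "R > 0" "\<And>\<xi>. norm \<xi> \<ge> R \<Longrightarrow> norm (fourier f \<xi>) \<le> \<eta>"
proof -
  have "\<exists>R>0. \<forall>\<xi>. norm \<xi> \<ge> R \<longrightarrow> norm (fourier f \<xi>) \<le> \<eta>"
  proof (rule ccontr)
    assume *: "\<not> ?thesis"
    have "\<exists>\<xi>. norm \<xi> \<ge> real (Suc n) \<and> norm (fourier f \<xi>) > \<eta>" for n
      using * by (metis not_le of_nat_0_less_iff zero_less_Suc)
    then obtain \<xi> where \<xi>: "\<And>n. norm (\<xi> n) \<ge> real (Suc n)" "\<And>n. norm (fourier f (\<xi> n)) > \<eta>"
      by metis
    define h where "h n = (pi / norm (\<xi> n) ^ 2) *\<^sub>R \<xi> n" for n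
    have pos: "norm (\<xi> n) > 0" for n using \<xi>(1)[of n] by linarith
    have hn: "h n \<bullet> \<xi> n = pi" for n
      using pos[of n] by (simp add: h_def power2_norm_eq_inner[symmetric])
    have "norm (h n) \<le> pi * inverse (real (Suc n))" for n
      using \<xi>(1)[of n] pos[of n] by (simp add: h_def power2_eq_square divide_inverse le_imp_inverse_le)
    then have "h \<longlonglongrightarrow> 0"
      by (intro Lim_null_comparison[OF _ tendsto_mult_right_zero[OF LIMSEQ_inverse_real_of_nat, of pi]] always_eventually allI)
    from translation_continuous_L1[OF f this] obtain n where
      "(\<integral>x. \<bar>f (h n + x) - f x\<bar> \<partial>lborel) < \<eta>"
      using \<open>\<eta> > 0\<close> by (metis (no_types, lifting) LIMSEQ_D diff_zero order_refl real_norm_def abs_ge_self order_le_less_trans)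
    with fourier_add_half_period[OF f hn[of n]] \<xi>(2)[of n] \<open>\<eta> > 0\<close> show False by linarith
  qed
  with that show ?thesis by blast
qed

section \<open>Radial integrals and Gaussians\<close>

text \<open>From \<open>1 + t \<le> exp t\<close> the exponent is at most
  \<open>m * t - c * t\<^sup>2\<close>, and completing the square gives its maximum.\<close>

lemma one_plus_power_gaussian_le:
  fixes t c :: real
  assumes "0 \<le> t" "0 < c"
  shows "(1 + t) ^ m * exp (- c * t\<^sup>2) \<le> exp ((real m)\<^sup>2 / (4 * c))"
proof -
  have "(1 + t) ^ m \<le> exp (real m * t)"
    using exp_ge_add_one_self[of t] assms by (metis exp_of_nat_mult power_mono add_nonneg_nonneg zero_le_one)
  then have "(1 + t) ^ m * exp (- c * t\<^sup>2) \<le> exp (real m * t) * exp (- c * t\<^sup>2)"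
    by (intro mult_right_mono) auto
  also have "\<dots> = exp (real m * t - c * t\<^sup>2)"
    by (simp add: exp_diff exp_minus divide_inverse)
  also have "real m * t - c * t\<^sup>2 \<le> (real m)\<^sup>2 / (4 * c)"
  proof -
    have "0 \<le> (2 * c * t - real m)\<^sup>2" by simp
    then have "(real m * t - c * t\<^sup>2) * (4 * c) \<le> (real m)\<^sup>2"
      by (simp add: power2_eq_square algebra_simps)
    then show ?thesis using assms by (simp only: pos_le_divide_eq mult_pos_pos zero_less_numeral)
  qed
  finally show ?thesis by simp
qed

lemma integrable_one_plus_abs_powr:
  fixes p :: real
  assumes "p > 1"
  shows "integrable lborel (\<lambda>t::real. (1 + \<bar>t\<bar>) powr (- p))"
proof -
  have half: "integrable lborel (\<lambda>t::real. indicator {0..} t *\<^sub>R (1 + \<bar>t\<bar>) powr (- p))"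
  proof (rule integrableI_bounded)
    have "(\<integral>\<^sup>+t. ennreal (norm (indicator {0..} t *\<^sub>R (1 + \<bar>t\<bar>) powr (- p))) \<partial>lborel)
       = (\<integral>\<^sup>+t. ennreal ((1 + t) powr (- p)) * indicator {0..} t \<partial>lborel)"
      by (intro nn_integral_cong) (auto simp: indicator_def)
    also have "\<dots> = ennreal (0 - (1 + 0) powr (1 - p) / (1 - p))"
    proof (rule nn_integral_FTC_atLeast)
      show "((\<lambda>t. (1 + t) powr (1 - p) / (1 - p)) \<longlongrightarrow> 0) at_top"
      proof -
        have "((\<lambda>t::real. (1 + t) powr (1 - p)) \<longlongrightarrow> 0) at_top"
          using assms by (intro tendsto_neg_powr filterlim_tendsto_add_at_top[OF tendsto_const] filterlim_ident) auto
        then show ?thesis by (auto intro: tendsto_divide_zero)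
      qed
      show "DERIV (\<lambda>t. (1 + t) powr (1 - p) / (1 - p)) t :> (1 + t) powr (- p)" if "0 \<le> t" for t
      proof -
        have "DERIV (\<lambda>t. (1 + t) powr (1 - p) / (1 - p)) t :> ((1 - p) * (1 + t) powr (1 - p - 1)) / (1 - p)"
          using that assms by (auto intro!: derivative_eq_intros)
        then show ?thesis using assms by simp
      qed
    qed auto
    also have "\<dots> < \<infinity>" by simp
    finally show "(\<integral>\<^sup>+t. ennreal (norm (indicator {0..} t *\<^sub>R (1 + \<bar>t\<bar>) powr (- p))) \<partial>lborel) < \<infinity>" .
  qed measurable
  have half': "integrable lborel (\<lambda>t::real. indicator {0..} (-t) *\<^sub>R (1 + \<bar>-t\<bar>) powr (- p))"
    using lborel_integrable_real_affine[OF half, of "-1" 0] by simp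
  show ?thesis
    by (rule Bochner_Integration.integrable_bound[OF Bochner_Integration.integrable_add[OF half half']])
      (auto simp: indicator_def)
qed

text \<open>Each coordinate is bounded by the norm, so the function is dominated by a product of
  one-dimensional functions with exponent \<open>q / DIM('a)\<close>, which exceeds 1. This replaces
  polar coordinates.\<close>

lemma integrable_one_plus_norm_powr:
  assumes "q > real DIM('a::euclidean_space)"
  shows "integrable lborel (\<lambda>x::'a. (1 + norm x) powr (- q))"
proof -
  define p where "p = q / real DIM('a)"
  have p: "p > 1" "p * real DIM('a) = q" using assms by (auto simp: p_def)
  have "integrable lborel (\<lambda>x::'a. \<Prod>i\<in>Basis. (1 + \<bar>x \<bullet> i\<bar>) powr (- p))"
    by (rule lborel_integrable_prod[where f="\<lambda>_ t. (1 + \<bar>t\<bar>) powr (- p)"]) (rule integrable_one_plus_abs_powr[OF p(1)])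
  then show ?thesis
  proof (rule Bochner_Integration.integrable_bound)
    show "AE x::'a in lborel. norm ((1 + norm x) powr (- q)) \<le> norm (\<Prod>i\<in>Basis. (1 + \<bar>x \<bullet> i\<bar>) powr (- p))"
    proof (rule AE_I2)
      fix x :: 'a
      have "(1 + norm x) powr (- q) = (\<Prod>i\<in>(Basis::'a set). (1 + norm x) powr (- p))"
        using powr_powr[of "1 + norm x" "- p" "real DIM('a)"] p(2)
        by (simp add: powr_realpow' add_nonneg_eq_0_iff)
      also have "\<dots> \<le> (\<Prod>i\<in>Basis. (1 + \<bar>x \<bullet> i\<bar>) powr (- p))"
        using p by (intro prod_mono conjI powr_mono2') (auto simp: Basis_le_norm)
      finally show "norm ((1 + norm x) powr (- q)) \<le> norm (\<Prod>i\<in>Basis. (1 + \<bar>x \<bullet> i\<bar>) powr (- p))"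
        by (simp add: prod_nonneg)
    qed
  qed measurable
qed

text \<open>Rescaling turns the mass near a sphere of radius \<open>\<Lambda>\<close> into that near the unit sphere.\<close>

lemma not_integrable_powr_tail:
  fixes f :: "'a::euclidean_space \<Rightarrow> real"
  assumes f: "integrable lborel f" and nn: "\<And>x. 0 \<le> f x" and "c > 0" and q: "q < real DIM('a)"
    and le: "\<And>x. norm x \<ge> R \<Longrightarrow> c * norm x powr (- q) \<le> f x"
  shows False
proof -
  obtain b :: 'a where b: "b \<in> Basis" using nonempty_Basis by blast
  define A where "A = ball b (1/2)"
  \<comment> \<open>Norms on \<open>A\<close> range over [1/2, 3/2]; taking the minimum at both ends
    covers either sign of \<open>q\<close>.\<close>
  define k :: real where "k = min ((1/2) powr (- q)) ((3/2) powr (- q))"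
  have "k > 0" by (simp add: k_def)
  have nA: "1/2 \<le> norm x" "norm x \<le> 3/2" if "x \<in> A" for x
    using that b norm_triangle_ineq2[of b x] norm_triangle_ineq2[of x b]
    by (auto simp: A_def dist_norm norm_minus_commute)
  have kA: "k \<le> norm x powr (- q)" if "x \<in> A" for x
  proof (cases "q \<ge> 0")
    case True
    then have "(3/2) powr (- q) \<le> norm x powr (- q)" using nA[OF that] by (intro powr_mono2') auto
    then show ?thesis by (simp add: k_def)
  next
    case False
    then have "(1/2) powr (- q) \<le> norm x powr (- q)" using nA[OF that] by (intro powr_mono2) auto
    then show ?thesis by (simp add: k_def)
  qed
  have A: "A \<in> sets lborel" "emeasure lborel A < \<infinity>" using emeasure_lborel_ball_finite[of b "1/2"] by (auto simp: A_def)
  have IA: "integrable lborel (indicator A :: 'a \<Rightarrow> real)" using A by (simp add: integrable_indicator_iff)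
  define v where "v = c * k * measure lborel A"
  have "v > 0" using \<open>c > 0\<close> \<open>k > 0\<close> by (simp add: v_def A_def content_ball_pos)
  have key: "\<Lambda> powr (real DIM('a) - q) * v \<le> integral\<^sup>L lborel f" if \<Lambda>: "\<Lambda> \<ge> 1" "\<Lambda> \<ge> 2 * R" for \<Lambda>
  proof -
    have "(\<integral>x. c * k * \<Lambda> powr (- q) * indicator A x \<partial>lborel) \<le> (\<integral>x. f (0 + \<Lambda> *\<^sub>R x) \<partial>lborel)"
    proof (rule integral_mono)
      show "integrable lborel (\<lambda>x. f (0 + \<Lambda> *\<^sub>R x))" using \<Lambda> f by (intro lborel_integrable_affine) auto
      fix x :: 'a
      show "c * k * \<Lambda> powr (- q) * indicator A x \<le> f (0 + \<Lambda> *\<^sub>R x)"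
      proof (cases "x \<in> A")
        case True
        have "\<Lambda> * (1/2) \<le> \<Lambda> * norm x" using \<Lambda> nA[OF True] by (intro mult_left_mono) auto
        then have "R \<le> norm (\<Lambda> *\<^sub>R x)" using \<Lambda> by (simp only: norm_scaleR)
        have "c * k * \<Lambda> powr (- q) \<le> c * norm x powr (- q) * \<Lambda> powr (- q)"
          using kA[OF True] \<open>c > 0\<close> by (intro mult_right_mono mult_left_mono) auto
        also have "\<dots> = c * norm (\<Lambda> *\<^sub>R x) powr (- q)"
          using \<Lambda> by (simp add: powr_mult)
        also have "\<dots> \<le> f (\<Lambda> *\<^sub>R x)" by (rule le) fact
        finally show ?thesis using True by simp
      qed (use nn in auto)
    qed (use IA in auto)
    then have "\<Lambda> ^ DIM('a) * (c * k * \<Lambda> powr (- q) * measure lborel A) \<le> \<bar>\<Lambda>\<bar> ^ DIM('a) *\<^sub>R (\<integral>x. f (0 + \<Lambda> *\<^sub>R x) \<partial>lborel)"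
      using \<Lambda> by (simp add: mult_left_mono)
    also have "\<dots> = integral\<^sup>L lborel f"
      using \<Lambda> by (intro lborel_integral_affine[symmetric]) auto
    finally show ?thesis using \<Lambda> by (simp add: v_def powr_diff powr_realpow powr_minus divide_inverse algebra_simps)
  qed
  define d where "d = real DIM('a) - q"
  have "d > 0" using q by (simp add: d_def)
  define I where "I = integral\<^sup>L lborel f"
  have "I \<ge> 0" using nn by (simp add: I_def)
  \<comment> \<open>Large enough that \<open>\<Lambda> powr d * v\<close> is at least
    \<open>I + 1\<close>, which \<open>key\<close> forbids.\<close>
  define \<Lambda> where "\<Lambda> = max (max 1 (2 * R)) (((I + 1) / v) powr (1 / d))"
  have "((I + 1) / v) \<le> \<Lambda> powr d"
  proof -
    have "(I + 1) / v = (((I + 1) / v) powr (1 / d)) powr d"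
      using \<open>I \<ge> 0\<close> \<open>v > 0\<close> \<open>d > 0\<close> by (simp add: powr_powr)
    also have "\<dots> \<le> \<Lambda> powr d"
      using \<open>d > 0\<close> by (intro powr_mono2) (auto simp: \<Lambda>_def)
    finally show ?thesis .
  qed
  moreover have "\<Lambda> powr d * v \<le> I" using key[of \<Lambda>] by (simp add: \<Lambda>_def d_def I_def)
  ultimately show False using \<open>v > 0\<close> by (simp add: field_simps)
qed

lemma integrable_norm_power_gaussian:
  assumes "c > 0"
  shows "integrable lborel (\<lambda>x::'a::euclidean_space. norm x ^ n * exp (- c * (norm x)\<^sup>2))"
proof -
  \<comment> \<open>One power above the dimension is reserved for integrability; the Gaussian
    absorbs \<open>n\<close> and these extra powers together.\<close>
  let ?d = "DIM('a) + 1"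
  let ?C = "exp ((real (n + ?d))\<^sup>2 / (4 * c))"
  have "integrable lborel (\<lambda>x::'a. ?C * (1 + norm x) powr (- real ?d))"
    by (intro integrable_mult_right integrable_one_plus_norm_powr) auto
  then show ?thesis
  proof (rule Bochner_Integration.integrable_bound)
    show "AE x::'a in lborel. norm (norm x ^ n * exp (- c * (norm x)\<^sup>2)) \<le> norm (?C * (1 + norm x) powr (- real ?d))"
    proof (rule AE_I2)
      fix x :: 'a
      have pos: "1 + norm x > 0" by (simp add: add_pos_nonneg)
      have "norm x ^ n * exp (- c * (norm x)\<^sup>2) \<le> (1 + norm x) ^ n * exp (- c * (norm x)\<^sup>2)"
        by (intro mult_right_mono power_mono) auto
      also have "\<dots> = ((1 + norm x) ^ (n + ?d) * exp (- c * (norm x)\<^sup>2)) / (1 + norm x) ^ ?d"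
        using pos by (simp add: power_add)
      also have "\<dots> \<le> ?C / (1 + norm x) ^ ?d"
        using assms pos by (intro divide_right_mono one_plus_power_gaussian_le) auto
      also have "\<dots> = ?C * (1 + norm x) powr (- real ?d)"
        using pos by (simp only: powr_minus powr_realpow divide_inverse)
      finally show "norm (norm x ^ n * exp (- c * (norm x)\<^sup>2)) \<le> norm (?C * (1 + norm x) powr (- real ?d))"
        by simp
    qed
  qed measurable
qed

section \<open>The standard Gaussian and its Fourier transform\<close>

definition gauss :: "'a::euclidean_space \<Rightarrow> real" where
  "gauss x = exp (- (norm x)\<^sup>2 / 2) / sqrt (2 * pi) ^ DIM('a)"

lemma sum_Basis_half_squares:
  "(\<Sum>i\<in>Basis. - (x \<bullet> i)\<^sup>2 / 2) = - (norm x)\<^sup>2 / 2" for x :: "'a::euclidean_space"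
proof -
  have "(norm x)\<^sup>2 = (\<Sum>i\<in>Basis. (x \<bullet> i)\<^sup>2)"
    unfolding norm_eq_sqrt_inner by (subst (1) euclidean_inner) (simp add: sum_nonneg power2_eq_square)
  then show ?thesis by (simp add: sum_negf sum_divide_distrib)
qed

lemma gauss_eq_prod: "gauss (x::'a::euclidean_space) = (\<Prod>i\<in>Basis. std_normal_density (x \<bullet> i))"
proof -
  have "exp (- (norm x)\<^sup>2 / 2) = (\<Prod>i\<in>Basis. exp (- (x \<bullet> i)\<^sup>2 / 2))"
    by (simp only: sum_Basis_half_squares[symmetric] exp_sum finite_Basis)
  then show ?thesis
    by (simp add: gauss_def std_normal_density_def prod_dividef)
qed

lemma gauss_nonneg [simp]: "0 \<le> gauss x" by (simp add: gauss_def)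

lemma gauss_measurable [measurable]: "gauss \<in> borel_measurable borel"
  unfolding gauss_def by measurable

lemma gauss_integrable [simp]: "integrable lborel gauss"
  unfolding gauss_eq_prod by (intro lborel_integrable_prod) auto

lemma gauss_integral [simp]: "(\<integral>x. gauss x \<partial>lborel) = 1"
  unfolding gauss_eq_prod by (subst lborel_integral_prod) auto

text \<open>Character and density both factor over the coordinates, which leaves the characteristic
  function of the one-dimensional normal law.\<close>

lemma integral_cis_gauss:
  "(\<integral>z. cis (z \<bullet> x) * of_real (gauss z) \<partial>lborel) = complex_of_real (exp (- (norm x)\<^sup>2 / 2))"
  for x :: "'a::euclidean_space"
proof -
  have *: "(\<integral>t. cis (t * u) * of_real (std_normal_density t) \<partial>lborel) = complex_of_real (exp (- u\<^sup>2 / 2))" for u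
  proof -
    have "complex_of_real (exp (- u\<^sup>2 / 2)) = char std_normal_distribution u"
      by (simp add: char_std_normal_distribution)
    also have "\<dots> = (\<integral>t. std_normal_density t *\<^sub>R cis (t * u) \<partial>lborel)"
      unfolding char_def by (subst integral_density) (auto simp: cis_conv_exp mult_ac)
    finally show ?thesis by (simp add: scaleR_conv_of_real mult.commute)
  qed
  have I: "integrable lborel (\<lambda>t. cis (t * u) * of_real (std_normal_density t))" for u
    by (rule integrable_cis_mult) auto
  have "(\<integral>z. cis (z \<bullet> x) * of_real (gauss z) \<partial>lborel)
      = (\<integral>z. (\<Prod>i\<in>Basis. cis ((z \<bullet> i) * (x \<bullet> i)) * of_real (std_normal_density (z \<bullet> i))) \<partial>lborel)"
  proof (rule Bochner_Integration.integral_cong[OF refl])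
    fix z :: 'a
    have "cis (z \<bullet> x) = (\<Prod>i\<in>Basis. cis ((z \<bullet> i) * (x \<bullet> i)))"
      by (subst euclidean_inner) (simp add: cis_conv_exp exp_sum[symmetric] sum_distrib_left)
    then show "cis (z \<bullet> x) * of_real (gauss z) = (\<Prod>i\<in>Basis. cis ((z \<bullet> i) * (x \<bullet> i)) * of_real (std_normal_density (z \<bullet> i)))"
      by (simp add: gauss_eq_prod prod.distrib)
  qed
  also have "\<dots> = (\<Prod>i\<in>Basis. complex_of_real (exp (- (x \<bullet> i)\<^sup>2 / 2)))"
    by (subst lborel_integral_prod) (use I * in auto)
  also have "\<dots> = complex_of_real (exp (\<Sum>i\<in>Basis. - (x \<bullet> i)\<^sup>2 / 2))"
    by (simp add: exp_sum)
  finally show ?thesis by (simp only: sum_Basis_half_squares)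
qed

lemma integrable_pair_bounded_kernel:
  fixes f :: "'a::euclidean_space \<Rightarrow> real" and g :: "'b::euclidean_space \<Rightarrow> real" and k :: "'a \<Rightarrow> 'b \<Rightarrow> complex"
  assumes f: "integrable lborel f" and g: "integrable lborel g"
    and [measurable]: "case_prod k \<in> borel_measurable (borel \<Otimes>\<^sub>M borel)" and k: "\<And>x y. norm (k x y) \<le> 1"
  shows "integrable (lborel \<Otimes>\<^sub>M lborel) (\<lambda>(x, y). k x y * of_real (f x * g y))"
proof -
  have [measurable]: "f \<in> borel_measurable borel" "g \<in> borel_measurable borel"
    using f g borel_measurable_integrable by auto
  have "integrable (lborel \<Otimes>\<^sub>M lborel) (\<lambda>(x, y). f x * g y)"
  proof (rule lborel_pair.Fubini_integrable)
    show "(\<lambda>(x, y). f x * g y) \<in> borel_measurable (lborel \<Otimes>\<^sub>M lborel)" by measurable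
    show "integrable lborel (\<lambda>x. \<integral>y. norm (case (x, y) of (x, y) \<Rightarrow> f x * g y) \<partial>lborel)"
      using f g by (simp add: abs_mult)
    show "AE x in lborel. integrable lborel (\<lambda>y. case (x, y) of (x, y) \<Rightarrow> f x * g y)"
      using g by simp
  qed
  then show ?thesis
  proof (rule Bochner_Integration.integrable_bound)
    show "(\<lambda>(x, y). k x y * of_real (f x * g y)) \<in> borel_measurable (lborel \<Otimes>\<^sub>M lborel)"
      by measurable
    show "AE p in lborel \<Otimes>\<^sub>M lborel. norm (case p of (x, y) \<Rightarrow> k x y * of_real (f x * g y)) \<le> norm (case p of (x, y) \<Rightarrow> f x * g y)"
      using k by (intro AE_I2) (auto simp: norm_mult mult_left_le_one_le mult_left_le abs_mult split: prod.split)
  qed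
qed

text \<open>A kernel of modulus at most 1 keeps the product of two integrable functions integrable.
  With characters as kernels this justifies the interchanges in \<open>fourier_mult_gaussian\<close>
  and \<open>integral_fourier_gaussian\<close>.\<close>

lemma Fubini_bounded_kernel:
  fixes f :: "'a::euclidean_space \<Rightarrow> real" and g :: "'b::euclidean_space \<Rightarrow> real" and k :: "'a \<Rightarrow> 'b \<Rightarrow> complex"
  assumes f: "integrable lborel f" and g: "integrable lborel g"
    and k: "case_prod k \<in> borel_measurable (borel \<Otimes>\<^sub>M borel)" "\<And>x y. norm (k x y) \<le> 1"
  shows "(\<integral>x. complex_of_real (f x) * (\<integral>y. k x y * of_real (g y) \<partial>lborel) \<partial>lborel)
       = (\<integral>y. complex_of_real (g y) * (\<integral>x. k x y * of_real (f x) \<partial>lborel) \<partial>lborel)"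
proof -
  have "(\<integral>y. (\<integral>x. k x y * of_real (f x * g y) \<partial>lborel) \<partial>lborel) = (\<integral>x. (\<integral>y. k x y * of_real (f x * g y) \<partial>lborel) \<partial>lborel)"
    by (rule lborel_pair.Fubini_integral[OF integrable_pair_bounded_kernel[OF assms]])
  moreover have "(\<integral>y. k x y * of_real (f x * g y) \<partial>lborel) = complex_of_real (f x) * (\<integral>y. k x y * of_real (g y) \<partial>lborel)" for x
    by (subst integral_mult_right_zero[symmetric]) (simp add: mult_ac)
  moreover have "(\<integral>x. k x y * of_real (f x * g y) \<partial>lborel) = complex_of_real (g y) * (\<integral>x. k x y * of_real (f x) \<partial>lborel)" for y
    by (subst integral_mult_right_zero[symmetric]) (simp add: mult_ac)
  ultimately show ?thesis by simp
qed

text \<open>The Gaussian is a constant multiple of its own transform, so a Gaussian window in space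
  is an average in frequency. The variable \<open>z\<close> is normalised: the weight is a fixed
  probability density and the width \<open>\<rho>\<close> appears only in the shift.\<close>

lemma fourier_mult_gaussian:
  fixes f :: "'a::euclidean_space \<Rightarrow> real"
  assumes f: "integrable lborel f"
  shows "(\<integral>x. cis (- (x \<bullet> \<zeta>)) * of_real (f x * exp (- \<rho>\<^sup>2 * (norm x)\<^sup>2 / 2)) \<partial>lborel)
    = (\<integral>z. complex_of_real (gauss z) * fourier f (\<zeta> - \<rho> *\<^sub>R z) \<partial>lborel)"
proof -
  let ?k = "\<lambda>x z. cis (- (x \<bullet> (\<zeta> - \<rho> *\<^sub>R z)))"
  have "(\<integral>x. complex_of_real (f x) * (\<integral>z. ?k x z * of_real (gauss z) \<partial>lborel) \<partial>lborel)
     = (\<integral>z. complex_of_real (gauss z) * (\<integral>x. ?k x z * of_real (f x) \<partial>lborel) \<partial>lborel)"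
    by (rule Fubini_bounded_kernel[OF f gauss_integrable]) auto
  moreover have "(\<integral>z. ?k x z * of_real (gauss z) \<partial>lborel) = cis (- (x \<bullet> \<zeta>)) * of_real (exp (- \<rho>\<^sup>2 * (norm x)\<^sup>2 / 2))" for x
  proof -
    have "?k x z * of_real (gauss z) = cis (- (x \<bullet> \<zeta>)) * (cis (z \<bullet> (\<rho> *\<^sub>R x)) * of_real (gauss z))" for z
      by (simp only: mult.assoc[symmetric] cis_mult) (simp add: inner_diff_right inner_commute)
    then have "(\<integral>z. ?k x z * of_real (gauss z) \<partial>lborel) = cis (- (x \<bullet> \<zeta>)) * (\<integral>z. (cis (z \<bullet> (\<rho> *\<^sub>R x)) * of_real (gauss z)) \<partial>lborel)"
      by (simp only: integral_mult_right_zero)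
    then show ?thesis by (simp only: integral_cis_gauss) (simp add: power_mult_distrib)
  qed
  ultimately show ?thesis by (simp add: fourier_def mult_ac)
qed

section \<open>Fourier inversion\<close>

lemma integrable_mult_cis:
  fixes A :: "'a::euclidean_space \<Rightarrow> complex"
  assumes "integrable lborel A" and [measurable]: "p \<in> borel_measurable borel"
  shows "integrable lborel (\<lambda>x. A x * cis (p x))"
  by (rule Bochner_Integration.integrable_bound[OF assms(1)])
     (use borel_measurable_integrable[OF assms(1)] in \<open>auto simp: norm_mult\<close>)

lemma isCont_cis_integral:
  fixes A :: "'a::euclidean_space \<Rightarrow> complex"
  assumes A: "integrable lborel A"
  shows "isCont (\<lambda>x. \<integral>\<xi>. A \<xi> * cis (x \<bullet> \<xi>) \<partial>lborel) x"
proof (subst continuous_at_sequentially, intro allI impI)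
  fix X assume X: "X \<longlonglongrightarrow> x"
  have [measurable]: "A \<in> borel_measurable borel" using borel_measurable_integrable[OF A] by simp
  have "(\<lambda>n. \<integral>\<xi>. A \<xi> * cis (X n \<bullet> \<xi>) \<partial>lborel) \<longlonglongrightarrow> (\<integral>\<xi>. A \<xi> * cis (x \<bullet> \<xi>) \<partial>lborel)"
  proof (rule integral_dominated_convergence[where w="\<lambda>\<xi>. norm (A \<xi>)"])
    show "AE \<xi> in lborel. (\<lambda>n. A \<xi> * cis (X n \<bullet> \<xi>)) \<longlonglongrightarrow> A \<xi> * cis (x \<bullet> \<xi>)"
      by (intro AE_I2 tendsto_intros X)
  qed (use A in \<open>auto simp: norm_mult\<close>)
  then show "((\<lambda>x. \<integral>\<xi>. A \<xi> * cis (x \<bullet> \<xi>) \<partial>lborel) \<circ> X) \<longlonglongrightarrow> (\<integral>\<xi>. A \<xi> * cis (x \<bullet> \<xi>) \<partial>lborel)"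
    by (simp add: o_def)
qed

lemma isCont_fourier:
  fixes f :: "'a::euclidean_space \<Rightarrow> real"
  assumes f: "integrable lborel f"
  shows "isCont (fourier f) \<xi>"
proof -
  have eq: "fourier f = (\<lambda>\<xi>. \<integral>x. complex_of_real (f x) * cis (\<xi> \<bullet> x) \<partial>lborel) \<circ> uminus"
    by (simp add: fun_eq_iff fourier_def inner_commute mult.commute)
  show ?thesis unfolding eq
    by (intro continuous_at_compose isCont_minus continuous_ident isCont_cis_integral) (use f in auto)
qed

lemma continuous_on_fourier:
  fixes f :: "'a::euclidean_space \<Rightarrow> real"
  shows "integrable lborel f \<Longrightarrow> continuous_on S (fourier f)"
  by (intro continuous_at_imp_continuous_on ballI isCont_fourier)

lemma fourier_measurable [measurable]:
  fixes f :: "'a::euclidean_space \<Rightarrow> real"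
  shows "integrable lborel f \<Longrightarrow> fourier f \<in> borel_measurable borel"
  by (intro borel_measurable_continuous_onI continuous_on_fourier)

lemma norm_fourier_le:
  fixes f :: "'a::euclidean_space \<Rightarrow> real"
  shows "norm (fourier f \<xi>) \<le> (\<integral>x. \<bar>f x\<bar> \<partial>lborel)"
  unfolding fourier_def by (rule order_trans[OF integral_norm_bound]) (simp add: norm_mult)

text \<open>Regularised inversion: damping the transform by a Gaussian amounts to averaging
  \<open>f\<close> over the scale \<open>\<delta>\<close>. The powers of \<open>\<delta>\<close>
  from the kernel and from the substitution cancel, and the two factors \<open>sqrt (2 * pi)\<close>
  per dimension combine to \<open>2 * pi\<close>.\<close>

lemma integral_fourier_gaussian:
  fixes f :: "'a::euclidean_space \<Rightarrow> real"
  assumes f: "integrable lborel f" and \<delta>: "\<delta> > 0"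
  shows "(\<integral>\<xi>. (fourier f \<xi> * of_real (exp (- (\<delta>\<^sup>2 / 2) * (norm \<xi>)\<^sup>2))) * cis (x \<bullet> \<xi>) \<partial>lborel)
       = complex_of_real ((2 * pi) ^ DIM('a) * (\<integral>z. f (x + \<delta> *\<^sub>R z) * gauss z \<partial>lborel))"
proof -
  let ?g = "\<lambda>\<xi>::'a. exp (- (\<delta>\<^sup>2 / 2) * (norm \<xi>)\<^sup>2)"
  let ?D = "DIM('a)"
  have g: "integrable lborel ?g"
    using integrable_norm_power_gaussian[of "\<delta>\<^sup>2 / 2" 0, where 'a='a] \<delta> by simp
  have kernel: "(\<integral>\<xi>. cis ((x - y) \<bullet> \<xi>) * of_real (?g \<xi>) \<partial>lborel)
      = complex_of_real ((sqrt (2 * pi) / \<delta>) ^ ?D * exp (- (norm ((1 / \<delta>) *\<^sub>R (x - y)))\<^sup>2 / 2))" for y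
  proof -
    have "(\<integral>\<xi>. cis ((x - y) \<bullet> \<xi>) * of_real (?g \<xi>) \<partial>lborel)
       = \<bar>1 / \<delta>\<bar> ^ ?D *\<^sub>R (\<integral>\<eta>. cis ((x - y) \<bullet> (0 + (1 / \<delta>) *\<^sub>R \<eta>)) * of_real (?g (0 + (1 / \<delta>) *\<^sub>R \<eta>)) \<partial>lborel)"
      by (rule lborel_integral_affine) (use \<delta> in auto)
    also have "(\<lambda>\<eta>. cis ((x - y) \<bullet> (0 + (1 / \<delta>) *\<^sub>R \<eta>)) * of_real (?g (0 + (1 / \<delta>) *\<^sub>R \<eta>)))
       = (\<lambda>\<eta>. complex_of_real (sqrt (2 * pi) ^ ?D) * (cis (\<eta> \<bullet> ((1 / \<delta>) *\<^sub>R (x - y))) * of_real (gauss \<eta>)))"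
      using \<delta> by (intro ext) (simp add: gauss_def inner_commute power_mult_distrib power_divide)
    finally show ?thesis
      using \<delta> by (simp only: integral_mult_right_zero integral_cis_gauss) (simp add: scaleR_conv_of_real power_divide)
  qed
  have "(\<integral>y. complex_of_real (f y) * (\<integral>\<xi>. cis ((x - y) \<bullet> \<xi>) * of_real (?g \<xi>) \<partial>lborel) \<partial>lborel)
     = (\<integral>\<xi>. complex_of_real (?g \<xi>) * (\<integral>y. cis ((x - y) \<bullet> \<xi>) * of_real (f y) \<partial>lborel) \<partial>lborel)"
    by (rule Fubini_bounded_kernel[OF f g]) auto
  also have "\<dots> = (\<integral>\<xi>. (fourier f \<xi> * of_real (?g \<xi>)) * cis (x \<bullet> \<xi>) \<partial>lborel)"
  proof (rule Bochner_Integration.integral_cong[OF refl])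
    fix \<xi> :: 'a
    have "cis ((x - y) \<bullet> \<xi>) * of_real (f y) = cis (x \<bullet> \<xi>) * (cis (- (y \<bullet> \<xi>)) * of_real (f y))" for y
      by (simp add: mult.assoc[symmetric] cis_mult inner_diff_left)
    then have "(\<integral>y. cis ((x - y) \<bullet> \<xi>) * of_real (f y) \<partial>lborel) = cis (x \<bullet> \<xi>) * fourier f \<xi>"
      unfolding fourier_def by (simp only: integral_mult_right_zero)
    then show "complex_of_real (?g \<xi>) * (\<integral>y. cis ((x - y) \<bullet> \<xi>) * of_real (f y) \<partial>lborel)
       = fourier f \<xi> * of_real (?g \<xi>) * cis (x \<bullet> \<xi>)" by (simp add: mult_ac)
  qed
  finally have "(\<integral>\<xi>. (fourier f \<xi> * of_real (?g \<xi>)) * cis (x \<bullet> \<xi>) \<partial>lborel)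
     = complex_of_real (\<integral>y. f y * ((sqrt (2 * pi) / \<delta>) ^ ?D * exp (- (norm ((1 / \<delta>) *\<^sub>R (x - y)))\<^sup>2 / 2)) \<partial>lborel)"
    unfolding kernel by (simp only: of_real_mult[symmetric] integral_complex_of_real)
  also have "(\<integral>y. f y * ((sqrt (2 * pi) / \<delta>) ^ ?D * exp (- (norm ((1 / \<delta>) *\<^sub>R (x - y)))\<^sup>2 / 2)) \<partial>lborel)
    = \<bar>\<delta>\<bar> ^ ?D *\<^sub>R (\<integral>z. f (x + \<delta> *\<^sub>R z) * ((sqrt (2 * pi) / \<delta>) ^ ?D * exp (- (norm ((1 / \<delta>) *\<^sub>R (x - (x + \<delta> *\<^sub>R z))))\<^sup>2 / 2)) \<partial>lborel)"
    by (rule lborel_integral_affine) (use \<delta> in auto)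
  also have "(\<lambda>z. f (x + \<delta> *\<^sub>R z) * ((sqrt (2 * pi) / \<delta>) ^ ?D * exp (- (norm ((1 / \<delta>) *\<^sub>R (x - (x + \<delta> *\<^sub>R z))))\<^sup>2 / 2)))
    = (\<lambda>z. ((sqrt (2 * pi) / \<delta>) ^ ?D * sqrt (2 * pi) ^ ?D) * (f (x + \<delta> *\<^sub>R z) * gauss z))"
    using \<delta> by (intro ext) (simp add: gauss_def)
  also have "\<bar>\<delta>\<bar> ^ ?D *\<^sub>R (\<integral>z. ((sqrt (2 * pi) / \<delta>) ^ ?D * sqrt (2 * pi) ^ ?D) * (f (x + \<delta> *\<^sub>R z) * gauss z) \<partial>lborel)
     = (2 * pi) ^ ?D * (\<integral>z. f (x + \<delta> *\<^sub>R z) * gauss z \<partial>lborel)"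
  proof -
    have "\<bar>\<delta>\<bar> ^ ?D * ((sqrt (2 * pi) / \<delta>) ^ ?D * sqrt (2 * pi) ^ ?D) = (\<bar>\<delta>\<bar> * ((sqrt (2 * pi) / \<delta>) * sqrt (2 * pi))) ^ ?D"
      by (simp only: power_mult_distrib)
    also have "\<bar>\<delta>\<bar> * ((sqrt (2 * pi) / \<delta>) * sqrt (2 * pi)) = 2 * pi"
      using \<delta> by simp
    finally have c: "\<bar>\<delta>\<bar> ^ ?D * ((sqrt (2 * pi) / \<delta>) ^ ?D * sqrt (2 * pi) ^ ?D) = (2 * pi) ^ ?D" .
    show ?thesis
      unfolding integral_mult_right_zero real_scaleR_def
      by (simp only: mult.assoc[symmetric] c[unfolded mult.assoc[symmetric]])
  qed
  finally show ?thesis .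
qed

text \<open>By Fubini the L1 norm of the averaged difference is at most the Gaussian average of
  \<open>\<omega> n z\<close>, the L1 distance of \<open>f\<close> from its shift by
  \<open>\<delta> n *\<^sub>R z\<close>. That distance is at most twice the L1 norm of
  \<open>f\<close> and tends to 0 for each \<open>z\<close>. The first claim holds only almost
  everywhere because splitting the integral needs an integrable section, which Fubini provides for
  almost every \<open>x\<close>.\<close>

lemma gaussian_mean_L1:
  fixes f :: "'a::euclidean_space \<Rightarrow> real"
  assumes f: "integrable lborel f" and \<delta>: "\<delta> \<longlonglongrightarrow> 0"
  shows "AE x in lborel. \<forall>n. (\<integral>z. (f (\<delta> n *\<^sub>R z + x) - f x) * gauss z \<partial>lborel) = (\<integral>z. f (x + \<delta> n *\<^sub>R z) * gauss z \<partial>lborel) - f x"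
    and "\<And>n. integrable lborel (\<lambda>x. (\<integral>z. (f (\<delta> n *\<^sub>R z + x) - f x) * gauss z \<partial>lborel))"
    and "(\<lambda>n. \<integral>x. norm (\<integral>z. (f (\<delta> n *\<^sub>R z + x) - f x) * gauss z \<partial>lborel) \<partial>lborel) \<longlonglongrightarrow> 0"
proof -
  let ?u = "\<lambda>n x. (\<integral>z. (f (\<delta> n *\<^sub>R z + x) - f x) * gauss z \<partial>lborel)"
  have [measurable]: "f \<in> borel_measurable borel" using borel_measurable_integrable[OF f] by simp
  define I where "I = (\<integral>x. \<bar>f x\<bar> \<partial>lborel)"
  define \<omega> where "\<omega> n z = (\<integral>x. \<bar>f (\<delta> n *\<^sub>R z + x) - f x\<bar> \<partial>lborel)" for n z
  have [measurable]: "\<omega> n \<in> borel_measurable borel" for n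
    unfolding \<omega>_def by measurable
  have J: "integrable lborel (\<lambda>x. f (y + x))" for y by (rule lborel_integrable_translate[OF f])
  have \<omega>0: "0 \<le> \<omega> n z" for n z by (simp add: \<omega>_def)
  have \<omega>le: "\<omega> n z \<le> 2 * I" for n z
  proof -
    have "\<omega> n z \<le> (\<integral>x. \<bar>f (\<delta> n *\<^sub>R z + x)\<bar> + \<bar>f x\<bar> \<partial>lborel)"
      unfolding \<omega>_def by (rule integral_mono_AE') (use f J in auto)
    also have "\<dots> = 2 * I"
      using f J lborel_integral_translate[of "\<lambda>x. \<bar>f x\<bar>"] by (simp add: I_def)
    finally show ?thesis .
  qed
  have "0 \<le> I" by (simp add: I_def)
  then have W: "integrable lborel (\<lambda>z. gauss z * \<omega> n z)" for n
    by (intro Bochner_Integration.integrable_bound[where f="\<lambda>z. gauss z * (2 * I)" and g="\<lambda>z. gauss z * \<omega> n z"])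
       (use \<omega>0 \<omega>le in \<open>auto intro!: mult_left_mono AE_I2 simp: abs_mult\<close>)
  have nT: "(\<integral>x. norm ((f (\<delta> n *\<^sub>R z + x) - f x) * gauss z) \<partial>lborel) = gauss z * \<omega> n z" for n z
    by (simp add: \<omega>_def abs_mult mult.commute)
  have T: "integrable (lborel \<Otimes>\<^sub>M lborel) (\<lambda>(z, x). (f (\<delta> n *\<^sub>R z + x) - f x) * gauss z)" for n
  proof (rule lborel_pair.Fubini_integrable)
    show "(\<lambda>(z, x). (f (\<delta> n *\<^sub>R z + x) - f x) * gauss z) \<in> borel_measurable (lborel \<Otimes>\<^sub>M lborel)"
      by measurable
    show "integrable lborel (\<lambda>z. \<integral>x. norm (case (z, x) of (z, x) \<Rightarrow> (f (\<delta> n *\<^sub>R z + x) - f x) * gauss z) \<partial>lborel)"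
      using W[of n] by (simp only: prod.case nT)
    show "AE z in lborel. integrable lborel (\<lambda>x. case (z, x) of (z, x) \<Rightarrow> (f (\<delta> n *\<^sub>R z + x) - f x) * gauss z)"
      using f J by simp
  qed
  show "integrable lborel (?u n)" for n
    by (rule lborel_pair.integrable_snd[OF T])
  show "AE x in lborel. \<forall>n. ?u n x = (\<integral>z. f (x + \<delta> n *\<^sub>R z) * gauss z \<partial>lborel) - f x"
  proof (subst AE_all_countable, intro allI)
    fix n
    from lborel_pair.AE_integrable_snd[OF T[of n]]
    show "AE x in lborel. ?u n x = (\<integral>z. f (x + \<delta> n *\<^sub>R z) * gauss z \<partial>lborel) - f x"
    proof eventually_elim
      case (elim x)
      have "integrable lborel (\<lambda>z. (f (\<delta> n *\<^sub>R z + x) - f x) * gauss z + f x * gauss z)"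
        using elim by (intro Bochner_Integration.integrable_add) auto
      then have "integrable lborel (\<lambda>z. f (x + \<delta> n *\<^sub>R z) * gauss z)"
        by (simp add: algebra_simps)
      then show ?case by (simp add: left_diff_distrib add.commute)
    qed
  qed
  have le: "(\<integral>x. norm (?u n x) \<partial>lborel) \<le> (\<integral>z. gauss z * \<omega> n z \<partial>lborel)" for n
  proof -
    have Ta: "integrable (lborel \<Otimes>\<^sub>M lborel) (\<lambda>(z, x). norm ((f (\<delta> n *\<^sub>R z + x) - f x) * gauss z))"
      using integrable_norm[OF T[of n]] by (simp only: split_beta')
    have "(\<integral>x. norm (?u n x) \<partial>lborel) \<le> (\<integral>x. \<integral>z. norm ((f (\<delta> n *\<^sub>R z + x) - f x) * gauss z) \<partial>lborel \<partial>lborel)"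
      by (rule integral_mono_AE') (use lborel_pair.integrable_snd[OF Ta] in \<open>auto intro!: AE_I2 integral_abs_bound simp del: abs_mult\<close>)
    also have "\<dots> = (\<integral>z. gauss z * \<omega> n z \<partial>lborel)"
      by (subst lborel_pair.Fubini_integral[OF Ta]) (simp only: nT)
    finally show ?thesis .
  qed
  have "(\<lambda>n. \<integral>z. gauss z * \<omega> n z \<partial>lborel) \<longlonglongrightarrow> (\<integral>z. (0::real) \<partial>(lborel :: 'a measure))"
  proof (rule integral_dominated_convergence[where w="\<lambda>z. gauss z * (2 * I)"])
    show "AE z in lborel. (\<lambda>n. gauss z * \<omega> n z) \<longlonglongrightarrow> 0"
    proof (rule AE_I2)
      fix z :: 'a
      have "(\<lambda>n. \<delta> n *\<^sub>R z) \<longlonglongrightarrow> 0" using tendsto_scaleR[OF \<delta> tendsto_const[of z]] by simp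
      from translation_continuous_L1[OF f this] show "(\<lambda>n. gauss z * \<omega> n z) \<longlonglongrightarrow> 0"
        unfolding \<omega>_def by (rule tendsto_mult_right_zero)
    qed
    show "AE z in lborel. norm (gauss z * \<omega> n z) \<le> gauss z * (2 * I)" for n
      using \<omega>0 \<omega>le by (intro AE_I2) (auto simp: abs_mult intro!: mult_left_mono)
  qed auto
  then have "(\<lambda>n. \<integral>z. gauss z * \<omega> n z \<partial>lborel) \<longlonglongrightarrow> 0" by simp
  then show "(\<lambda>n. \<integral>x. norm (?u n x) \<partial>lborel) \<longlonglongrightarrow> 0"
    by (rule Lim_null_comparison[rotated]) (intro always_eventually allI, use le in \<open>simp add: abs_of_nonneg\<close>)
qed

text \<open>The Gaussian means have two limits: the inversion integral at every point, by dominated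
  convergence since the transform is integrable, and \<open>f\<close> in L1. The limits must agree
  almost everywhere.\<close>

theorem fourier_inversion:
  fixes f :: "'a::euclidean_space \<Rightarrow> real"
  assumes f: "integrable lborel f" and ff: "integrable lborel (fourier f)"
  shows "AE x in lborel. f x = Re (\<integral>\<xi>. fourier f \<xi> * cis (x \<bullet> \<xi>) \<partial>lborel) / (2 * pi) ^ DIM('a)"
proof -
  let ?C = "(2 * pi) ^ DIM('a)"
  define \<delta> :: "nat \<Rightarrow> real" where "\<delta> n = inverse (real (Suc n))" for n
  have \<delta>0: "\<delta> n > 0" for n by (simp add: \<delta>_def)
  have \<delta>: "\<delta> \<longlonglongrightarrow> 0" unfolding \<delta>_def by (rule LIMSEQ_inverse_real_of_nat)
  note [measurable] = fourier_measurable[OF f]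
  define M where "M n x = (\<integral>z. f (x + \<delta> n *\<^sub>R z) * gauss z \<partial>lborel)" for n x
  have Mlim: "(\<lambda>n. M n x) \<longlonglongrightarrow> Re (\<integral>\<xi>. fourier f \<xi> * cis (x \<bullet> \<xi>) \<partial>lborel) / ?C" for x
  proof -
    have "(\<lambda>n. \<integral>\<xi>. (fourier f \<xi> * of_real (exp (- ((\<delta> n)\<^sup>2 / 2) * (norm \<xi>)\<^sup>2))) * cis (x \<bullet> \<xi>) \<partial>lborel)
       \<longlonglongrightarrow> (\<integral>\<xi>. fourier f \<xi> * cis (x \<bullet> \<xi>) \<partial>lborel)"
    proof (rule integral_dominated_convergence[where w="\<lambda>\<xi>. norm (fourier f \<xi>)"])
      show "AE \<xi> in lborel. (\<lambda>n. (fourier f \<xi> * of_real (exp (- ((\<delta> n)\<^sup>2 / 2) * (norm \<xi>)\<^sup>2))) * cis (x \<bullet> \<xi>)) \<longlonglongrightarrow> fourier f \<xi> * cis (x \<bullet> \<xi>)"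
      proof (rule AE_I2)
        fix \<xi> :: 'a
        have "(\<lambda>n. (fourier f \<xi> * of_real (exp (- ((\<delta> n)\<^sup>2 / 2) * (norm \<xi>)\<^sup>2))) * cis (x \<bullet> \<xi>))
            \<longlonglongrightarrow> (fourier f \<xi> * of_real (exp (- (0\<^sup>2 / 2) * (norm \<xi>)\<^sup>2))) * cis (x \<bullet> \<xi>)"
          by (intro tendsto_intros \<delta>) auto
        then show "(\<lambda>n. (fourier f \<xi> * of_real (exp (- ((\<delta> n)\<^sup>2 / 2) * (norm \<xi>)\<^sup>2))) * cis (x \<bullet> \<xi>)) \<longlonglongrightarrow> fourier f \<xi> * cis (x \<bullet> \<xi>)"
          by simp
      qed
      show "AE \<xi> in lborel. norm ((fourier f \<xi> * of_real (exp (- ((\<delta> n)\<^sup>2 / 2) * (norm \<xi>)\<^sup>2))) * cis (x \<bullet> \<xi>)) \<le> norm (fourier f \<xi>)" for n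
        by (intro AE_I2) (auto simp: norm_mult intro!: mult_right_le_one_le)
    qed (use ff in auto)
    then have "(\<lambda>n. complex_of_real (?C * M n x)) \<longlonglongrightarrow> (\<integral>\<xi>. fourier f \<xi> * cis (x \<bullet> \<xi>) \<partial>lborel)"
      by (simp only: integral_fourier_gaussian[OF f \<delta>0] M_def)
    from tendsto_divide[OF tendsto_Re[OF this] tendsto_const[of ?C]] show ?thesis by simp
  qed
  note * = gaussian_mean_L1[OF f \<delta>]
  \<comment> \<open>L1 convergence is pointwise only along a subsequence; this suffices because
    \<open>Mlim\<close> concerns the whole sequence.\<close>
  from tendsto_L1_AE_subseq[OF *(2,3)] obtain r where "strict_mono r"
    and r: "AE x in lborel. (\<lambda>n. \<integral>z. (f (\<delta> (r n) *\<^sub>R z + x) - f x) * gauss z \<partial>lborel) \<longlonglongrightarrow> 0" by auto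
  from r *(1) show ?thesis
  proof eventually_elim
    case (elim x)
    have "(\<lambda>n. M (r n) x - f x) \<longlonglongrightarrow> Re (\<integral>\<xi>. fourier f \<xi> * cis (x \<bullet> \<xi>) \<partial>lborel) / ?C - f x"
      using LIMSEQ_subseq_LIMSEQ[OF Mlim \<open>strict_mono r\<close>, of x] by (intro tendsto_intros) (simp add: o_def)
    moreover have "(\<lambda>n. M (r n) x - f x) \<longlonglongrightarrow> 0"
      using elim by (simp add: M_def)
    ultimately show ?case using LIMSEQ_unique by fastforce
  qed
qed

text \<open>Two sizes of one Taylor remainder: divided by the increment, the linear bound supplies a
  dominating function and the quadratic bound supplies pointwise convergence.\<close>

lemma norm_cis_minus_linear:
  "norm (cis t - 1 - \<i> * of_real t) \<le> 2 * \<bar>t\<bar>"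
  "norm (cis t - 1 - \<i> * of_real t) \<le> t\<^sup>2 / 2"
  using iexp_approx2[of t 1] iexp_approx1[of t 1]
  by (simp_all add: cis_conv_exp algebra_simps power2_eq_square)

text \<open>Only a first moment of \<open>A\<close> is assumed, so the quadratic remainder cannot be
  integrated. It serves pointwise in \<open>\<xi>\<close>, and dominated convergence along sequences
  replaces a direct estimate.\<close>

lemma has_derivative_cis_integral:
  fixes A :: "'a::euclidean_space \<Rightarrow> complex"
  assumes A: "integrable lborel A" and A1: "integrable lborel (\<lambda>\<xi>. norm \<xi> * norm (A \<xi>))"
  shows "((\<lambda>x. \<integral>\<xi>. A \<xi> * cis (x \<bullet> \<xi>) \<partial>lborel) has_derivative
     (\<lambda>h. \<integral>\<xi>. (\<i> * of_real (h \<bullet> \<xi>) * A \<xi>) * cis (x \<bullet> \<xi>) \<partial>lborel)) (at x)"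
    (is "(?G has_derivative ?D) (at x)")
proof -
  have [measurable]: "A \<in> borel_measurable borel" using borel_measurable_integrable[OF A] by simp
  have Bd: "norm ((\<i> * of_real (h \<bullet> \<xi>) * A \<xi>) * cis (x \<bullet> \<xi>)) \<le> norm h * (norm \<xi> * norm (A \<xi>))" for h \<xi>
    using Cauchy_Schwarz_ineq2[of h \<xi>] by (simp add: norm_mult mult_right_mono flip: mult.assoc)
  have DI: "integrable lborel (\<lambda>\<xi>. (\<i> * of_real (h \<bullet> \<xi>) * A \<xi>) * cis (x \<bullet> \<xi>))" for h
  proof (rule Bochner_Integration.integrable_bound[OF integrable_mult_right[OF A1, of "norm h"]])
    show "AE \<xi> in lborel. norm ((\<i> * of_real (h \<bullet> \<xi>) * A \<xi>) * cis (x \<bullet> \<xi>)) \<le> norm (norm h * (norm \<xi> * norm (A \<xi>)))"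
      using Bd by (intro AE_I2) simp
  qed measurable
  have bl: "bounded_linear ?D"
  proof (rule bounded_linear_intro[where K="\<integral>\<xi>. norm \<xi> * norm (A \<xi>) \<partial>lborel"])
    fix h k :: 'a and r :: real
    show "?D (h + k) = ?D h + ?D k"
      by (subst Bochner_Integration.integral_add[OF DI DI, symmetric]) (simp add: inner_add_left algebra_simps)
    show "?D (r *\<^sub>R h) = r *\<^sub>R ?D h"
      by (subst integral_scaleR_right[symmetric]) (simp add: scaleR_conv_of_real mult_ac)
    have "norm (?D h) \<le> (\<integral>\<xi>. norm h * (norm \<xi> * norm (A \<xi>)) \<partial>lborel)"
      by (rule order_trans[OF integral_norm_bound integral_mono_AE']) (use A1 Bd in auto)
    then show "norm (?D h) \<le> norm h * (\<integral>\<xi>. norm \<xi> * norm (A \<xi>) \<partial>lborel)" by simp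
  qed
  have "(\<lambda>h. norm (?G (x + h) - ?G x - ?D h) / norm h) \<midarrow>0\<rightarrow> 0"
    unfolding tendsto_at_iff_sequentially
  proof (intro allI impI)
    fix X assume X: "\<forall>i. X i \<in> UNIV - {0::'a}" "X \<longlonglongrightarrow> 0"
    define r where "r n \<xi> = A \<xi> * cis (x \<bullet> \<xi>) * (cis (X n \<bullet> \<xi>) - 1 - \<i> * of_real (X n \<bullet> \<xi>)) / complex_of_real (norm (X n))" for n \<xi>
    have X0: "norm (X n) > 0" for n using X by auto
    have eq: "?G (x + X n) - ?G x - ?D (X n) = complex_of_real (norm (X n)) * (\<integral>\<xi>. r n \<xi> \<partial>lborel)" for n
    proof -
      have "?G (x + X n) - ?G x - ?D (X n) = (\<integral>\<xi>. A \<xi> * cis ((x + X n) \<bullet> \<xi>) - A \<xi> * cis (x \<bullet> \<xi>) - (\<i> * of_real (X n \<bullet> \<xi>) * A \<xi>) * cis (x \<bullet> \<xi>) \<partial>lborel)"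
        using DI A by (simp add: integrable_mult_cis)
      also have "\<dots> = (\<integral>\<xi>. complex_of_real (norm (X n)) * r n \<xi> \<partial>lborel)"
      proof (rule Bochner_Integration.integral_cong[OF refl])
        fix \<xi> :: 'a
        have "complex_of_real (norm (X n)) * r n \<xi> = A \<xi> * cis (x \<bullet> \<xi>) * (cis (X n \<bullet> \<xi>) - 1 - \<i> * of_real (X n \<bullet> \<xi>))"
          using X0[of n] by (simp add: r_def)
        moreover have "cis ((x + X n) \<bullet> \<xi>) = cis (x \<bullet> \<xi>) * cis (X n \<bullet> \<xi>)"
          by (simp add: inner_add_left cis_mult)
        ultimately show "A \<xi> * cis ((x + X n) \<bullet> \<xi>) - A \<xi> * cis (x \<bullet> \<xi>) - (\<i> * of_real (X n \<bullet> \<xi>) * A \<xi>) * cis (x \<bullet> \<xi>) = complex_of_real (norm (X n)) * r n \<xi>"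
          by (simp add: algebra_simps)
      qed
      finally show ?thesis by simp
    qed
    have "(\<lambda>n. \<integral>\<xi>. r n \<xi> \<partial>lborel) \<longlonglongrightarrow> (\<integral>\<xi>. 0 \<partial>(lborel :: 'a measure))"
    proof (rule integral_dominated_convergence[where w="\<lambda>\<xi>. 2 * (norm \<xi> * norm (A \<xi>))"])
      show "AE \<xi> in lborel. norm (r n \<xi>) \<le> 2 * (norm \<xi> * norm (A \<xi>))" for n
      proof (rule AE_I2)
        fix \<xi> :: 'a
        have "norm (r n \<xi>) \<le> norm (A \<xi>) * (2 * \<bar>X n \<bullet> \<xi>\<bar>) / norm (X n)"
          using norm_cis_minus_linear(1)[of "X n \<bullet> \<xi>"]
          by (simp add: r_def norm_mult norm_divide divide_right_mono mult_left_mono)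
        also have "\<dots> \<le> norm (A \<xi>) * (2 * (norm (X n) * norm \<xi>)) / norm (X n)"
          by (intro divide_right_mono mult_left_mono Cauchy_Schwarz_ineq2) auto
        also have "\<dots> = 2 * (norm \<xi> * norm (A \<xi>))" using X0[of n] by simp
        finally show "norm (r n \<xi>) \<le> 2 * (norm \<xi> * norm (A \<xi>))" .
      qed
      show "AE \<xi> in lborel. (\<lambda>n. r n \<xi>) \<longlonglongrightarrow> 0"
      proof (rule AE_I2)
        fix \<xi> :: 'a
        have le: "norm (r n \<xi>) \<le> norm (A \<xi>) * (norm \<xi>)\<^sup>2 / 2 * norm (X n)" for n
        proof -
          have "norm (r n \<xi>) = norm (A \<xi>) * norm (cis (X n \<bullet> \<xi>) - 1 - \<i> * of_real (X n \<bullet> \<xi>)) / norm (X n)"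
            by (simp add: r_def norm_mult norm_divide)
          also have "\<dots> \<le> norm (A \<xi>) * ((X n \<bullet> \<xi>)\<^sup>2 / 2) / norm (X n)"
            by (intro divide_right_mono mult_left_mono norm_cis_minus_linear(2)) auto
          also have "\<dots> \<le> norm (A \<xi>) * ((norm (X n) * norm \<xi>)\<^sup>2 / 2) / norm (X n)"
            using power_mono[OF Cauchy_Schwarz_ineq2[of "X n" \<xi>], of 2]
            by (intro divide_right_mono mult_left_mono) auto
          also have "\<dots> = norm (A \<xi>) * (norm \<xi>)\<^sup>2 / 2 * norm (X n)"
            using X0[of n] by (simp add: power2_eq_square)
          finally show ?thesis .
        qed
        show "(\<lambda>n. r n \<xi>) \<longlonglongrightarrow> 0"
          by (rule Lim_null_comparison[OF always_eventually[OF allI[OF le]]])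
             (intro tendsto_mult_right_zero tendsto_norm_zero X)
      qed
      show "r n \<in> borel_measurable lborel" for n unfolding r_def by measurable
    qed (use A1 in auto)
    then have "(\<lambda>n. norm (\<integral>\<xi>. r n \<xi> \<partial>lborel)) \<longlonglongrightarrow> 0" by (simp add: tendsto_norm_zero_iff)
    moreover have "norm (?G (x + X n) - ?G x - ?D (X n)) / norm (X n) = norm (\<integral>\<xi>. r n \<xi> \<partial>lborel)" for n
      unfolding eq using X0[of n] by (simp add: norm_mult)
    ultimately show "((\<lambda>h. norm (?G (x + h) - ?G x - ?D h) / norm h) \<circ> X) \<longlonglongrightarrow> 0"
      by (simp add: o_def)
  qed
  with bl show ?thesis by (simp add: has_derivative_at)
qed

text \<open>Fourier multiplier of the iterated partial derivative \<^const>\<open>dpart\<close>.\<close>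

fun deriv_symbol :: "'a::euclidean_space list \<Rightarrow> 'a \<Rightarrow> complex" where
  "deriv_symbol [] \<xi> = 1"
| "deriv_symbol (b # bs) \<xi> = \<i> * of_real (b \<bullet> \<xi>) * deriv_symbol bs \<xi>"

lemma deriv_symbol_measurable [measurable]: "deriv_symbol bs \<in> borel_measurable borel"
proof (induction bs)
  case (Cons b bs)
  note [measurable] = Cons
  have "deriv_symbol (b # bs) = (\<lambda>\<xi>. \<i> * of_real (b \<bullet> \<xi>) * deriv_symbol bs \<xi>)"
    by (simp add: fun_eq_iff)
  then show ?case by simp
next
  case Nil
  have "deriv_symbol [] = (\<lambda>\<xi>::'a. 1)" by (simp add: fun_eq_iff)
  then show ?case by simp
qed

lemma norm_deriv_symbol_le:
  "set bs \<subseteq> Basis \<Longrightarrow> norm (deriv_symbol bs \<xi>) \<le> norm \<xi> ^ length bs"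
proof (induction bs)
  case (Cons b bs)
  then show ?case using Basis_le_norm[of b \<xi>]
    by (auto simp: norm_mult inner_commute intro!: mult_mono)
qed simp

section \<open>From integrable Fourier decay to Hoelder regularity\<close>

lemma norm_cis_diff_le_dist: "norm (cis u - cis v) \<le> \<bar>u - v\<bar>"
proof -
  have "cis u - cis v = cis v * (cis (u - v) - 1)" by (simp add: algebra_simps cis_mult)
  then show ?thesis
    using iexp_approx1[of "u - v" 0] by (simp add: norm_mult cis_conv_exp)
qed

text \<open>Interpolates between the Lipschitz bound, used for close points, and the trivial bound
  2.\<close>

lemma norm_cis_diff_le:
  assumes "0 \<le> \<alpha>" "\<alpha> \<le> 1"
  shows "norm (cis u - cis v) \<le> 2 * \<bar>u - v\<bar> powr \<alpha>"
proof -
  consider "u = v" | "u \<noteq> v" "\<bar>u - v\<bar> \<le> 1" | "\<bar>u - v\<bar> > 1" by fastforce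
  then show ?thesis
  proof cases
    case 2
    have "norm (cis u - cis v) \<le> \<bar>u - v\<bar> powr 1" using norm_cis_diff_le_dist[of u v] 2 by simp
    also have "\<dots> \<le> \<bar>u - v\<bar> powr \<alpha>" using 2 assms by (intro powr_mono') auto
    also have "\<dots> \<le> 2 * \<bar>u - v\<bar> powr \<alpha>" by simp
    finally show ?thesis .
  next
    case 3
    have "norm (cis u - cis v) \<le> 2 * 1"
      using norm_triangle_ineq4[of "cis u" "cis v"] by simp
    also have "\<dots> \<le> 2 * \<bar>u - v\<bar> powr \<alpha>" using 3 assms by (intro mult_left_mono ge_one_powr_ge_zero) auto
    finally show ?thesis .
  qed auto
qed

text \<open>The inversion integral \<open>G []\<close> is the regular representative. Each
  derivative multiplies the integrand by one factor of size at most \<open>norm \<xi>\<close>, so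
  \<open>k\<close> of the available \<open>m\<close> powers pay for derivatives and the remaining
  \<open>\<alpha>\<close> for the Hoelder quotient of the last ones.\<close>

theorem in_holder_if_fourier_decay:
  fixes f :: "'a::euclidean_space \<Rightarrow> real"
  assumes f: "integrable lborel f" and m: "m > 0"
    and I: "integrable lborel (\<lambda>\<xi>. (1 + norm \<xi>) powr m * norm (fourier f \<xi>))"
  shows "in_holder (nat \<lfloor>m\<rfloor>) (m - of_int \<lfloor>m\<rfloor>) f"
proof -
  define k where "k = nat \<lfloor>m\<rfloor>"
  define \<alpha> where "\<alpha> = m - of_int \<lfloor>m\<rfloor>"
  have k\<alpha>: "m = real k + \<alpha>" "0 \<le> \<alpha>" "\<alpha> \<le> 1"
    using m floor_correct[of m] unfolding k_def \<alpha>_def by (simp_all add: of_nat_nat) linarith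
  define C where "C = (2 * pi) ^ DIM('a)"
  have "C > 0" by (simp add: C_def)
  note [measurable] = fourier_measurable[OF f]
  define G where "G bs x = Re (\<integral>\<xi>. (deriv_symbol bs \<xi> * fourier f \<xi>) * cis (x \<bullet> \<xi>) \<partial>lborel) / C" for bs x
  have Ip: "integrable lborel (\<lambda>\<xi>. norm \<xi> powr p * norm (fourier f \<xi>))" if "0 \<le> p" "p \<le> m" for p
  proof (rule Bochner_Integration.integrable_bound[OF I])
    show "AE \<xi> in lborel. norm (norm \<xi> powr p * norm (fourier f \<xi>)) \<le> norm ((1 + norm \<xi>) powr m * norm (fourier f \<xi>))"
    proof (rule AE_I2)
      fix \<xi> :: 'a
      have "norm \<xi> powr p \<le> (1 + norm \<xi>) powr p" using that by (intro powr_mono2) auto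
      also have "\<dots> \<le> (1 + norm \<xi>) powr m" using that by (intro powr_mono) auto
      finally show "norm (norm \<xi> powr p * norm (fourier f \<xi>)) \<le> norm ((1 + norm \<xi>) powr m * norm (fourier f \<xi>))"
        by (simp add: mult_right_mono)
    qed
  qed measurable
  have I0: "integrable lborel (\<lambda>\<xi>. norm (fourier f \<xi>))"
    by (rule Bochner_Integration.integrable_bound[OF I])
      (use m in \<open>auto intro!: AE_I2 ge_one_powr_ge_zero simp: mult_le_cancel_right1\<close>)
  have In: "integrable lborel (\<lambda>\<xi>. norm \<xi> ^ j * norm (fourier f \<xi>))" if "j \<le> k" for j
  \<comment> \<open>\<open>0 powr 0\<close> is 0 whereas \<open>0 ^ 0\<close> is 1, so the passage
    from \<open>powr\<close> to a natural power excludes \<open>j = 0\<close>.\<close>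
  proof (cases "j = 0")
    case False
    then show ?thesis using Ip[of "real j"] that k\<alpha> by (simp add: powr_realpow')
  qed (use I0 in simp)
  have IA: "integrable lborel (\<lambda>\<xi>. deriv_symbol bs \<xi> * fourier f \<xi>)" if "set bs \<subseteq> Basis" "length bs \<le> k" for bs
    by (rule Bochner_Integration.integrable_bound[OF In[OF that(2)]])
      (use norm_deriv_symbol_le[OF that(1)] in \<open>auto simp: norm_mult intro!: AE_I2 mult_right_mono\<close>)
  have IA1: "integrable lborel (\<lambda>\<xi>. norm \<xi> * norm (deriv_symbol bs \<xi> * fourier f \<xi>))" if "set bs \<subseteq> Basis" "Suc (length bs) \<le> k" for bs
    by (rule Bochner_Integration.integrable_bound[OF In[OF that(2)]])
      (use norm_deriv_symbol_le[OF that(1)] in \<open>auto simp: norm_mult mult.assoc intro!: AE_I2 mult_left_mono mult_right_mono\<close>)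
  have der: "(G bs has_derivative (\<lambda>h. Re (\<integral>\<xi>. (\<i> * of_real (h \<bullet> \<xi>) * (deriv_symbol bs \<xi> * fourier f \<xi>)) * cis (x \<bullet> \<xi>) \<partial>lborel) / C)) (at x)"
    if "set bs \<subseteq> Basis" "Suc (length bs) \<le> k" for bs x
    unfolding G_def
    using has_derivative_cis_integral[OF IA IA1, of bs x] that
    by (auto simp: divide_inverse intro!: derivative_intros)
  have dp: "set bs \<subseteq> Basis \<Longrightarrow> length bs \<le> k \<Longrightarrow> dpart bs (G []) = G bs" for bs
  proof (induction bs)
    case (Cons b bs)
    show ?case
    proof
      fix x
      have "dpart (b # bs) (G []) x = frechet_derivative (G bs) (at x) b"
        using Cons by (simp add: partial_def)
      also have "\<dots> = G (b # bs) x"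
        using frechet_derivative_at[OF der[of bs x], symmetric] Cons.prems by (simp add: G_def mult_ac)
      finally show "dpart (b # bs) (G []) x = G (b # bs) x" .
    qed
  qed simp
  have cont: "continuous_on UNIV (G bs)" if "set bs \<subseteq> Basis" "length bs \<le> k" for bs
    unfolding G_def using isCont_cis_integral[OF IA[OF that]]
    by (intro continuous_intros continuous_at_imp_continuous_on ballI) (use \<open>C > 0\<close> in auto)
  have bdd: "bounded (range (G bs))" if "set bs \<subseteq> Basis" "length bs \<le> k" for bs
  proof (rule boundedI)
    fix y assume "y \<in> range (G bs)"
    then obtain x where y: "y = G bs x" by auto
    have "\<bar>Re (\<integral>\<xi>. (deriv_symbol bs \<xi> * fourier f \<xi>) * cis (x \<bullet> \<xi>) \<partial>lborel)\<bar> \<le> (\<integral>\<xi>. norm (deriv_symbol bs \<xi> * fourier f \<xi>) \<partial>lborel)"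
      by (rule order_trans[OF abs_Re_le_cmod order_trans[OF integral_norm_bound]]) (simp add: norm_mult)
    then show "norm y \<le> (\<integral>\<xi>. norm (deriv_symbol bs \<xi> * fourier f \<xi>) \<partial>lborel) / C"
      using \<open>C > 0\<close> by (simp add: y G_def divide_right_mono)
  qed
  have hol: "\<exists>M. \<forall>x y. \<bar>G bs x - G bs y\<bar> \<le> M * dist x y powr \<alpha>" if "set bs \<subseteq> Basis" "length bs = k" for bs
  proof (intro exI allI)
    fix x y :: 'a
    let ?A = "\<lambda>\<xi>. deriv_symbol bs \<xi> * fourier f \<xi>"
    let ?N = "\<integral>\<xi>. norm \<xi> powr m * norm (fourier f \<xi>) \<partial>lborel"
    have Im: "integrable lborel (\<lambda>\<xi>. norm \<xi> powr m * norm (fourier f \<xi>))" using m by (intro Ip) auto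
    have "\<bar>G bs x - G bs y\<bar> = \<bar>Re ((\<integral>\<xi>. ?A \<xi> * cis (x \<bullet> \<xi>) \<partial>lborel) - (\<integral>\<xi>. ?A \<xi> * cis (y \<bullet> \<xi>) \<partial>lborel))\<bar> / C"
      using \<open>C > 0\<close> by (simp add: G_def flip: diff_divide_distrib)
    also have "\<dots> \<le> norm ((\<integral>\<xi>. ?A \<xi> * cis (x \<bullet> \<xi>) \<partial>lborel) - (\<integral>\<xi>. ?A \<xi> * cis (y \<bullet> \<xi>) \<partial>lborel)) / C"
      using \<open>C > 0\<close> by (intro divide_right_mono abs_Re_le_cmod) auto
    also have "(\<integral>\<xi>. ?A \<xi> * cis (x \<bullet> \<xi>) \<partial>lborel) - (\<integral>\<xi>. ?A \<xi> * cis (y \<bullet> \<xi>) \<partial>lborel) = (\<integral>\<xi>. ?A \<xi> * (cis (x \<bullet> \<xi>) - cis (y \<bullet> \<xi>)) \<partial>lborel)"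
      using IA[of bs] that by (simp add: integrable_mult_cis right_diff_distrib)
    also have "norm \<dots> \<le> (\<integral>\<xi>. (2 * dist x y powr \<alpha>) * (norm \<xi> powr m * norm (fourier f \<xi>)) \<partial>lborel)"
    proof (rule order_trans[OF integral_norm_bound integral_mono_AE'])
      show "integrable lborel (\<lambda>\<xi>. (2 * dist x y powr \<alpha>) * (norm \<xi> powr m * norm (fourier f \<xi>)))" using Im by simp
      show "AE \<xi> in lborel. norm (?A \<xi> * (cis (x \<bullet> \<xi>) - cis (y \<bullet> \<xi>))) \<le> (2 * dist x y powr \<alpha>) * (norm \<xi> powr m * norm (fourier f \<xi>))"
      proof (rule AE_I2)
        fix \<xi> :: 'a
        show "norm (?A \<xi> * (cis (x \<bullet> \<xi>) - cis (y \<bullet> \<xi>))) \<le> (2 * dist x y powr \<alpha>) * (norm \<xi> powr m * norm (fourier f \<xi>))"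
        proof (cases "\<xi> = 0")
          case False
          have "norm (cis (x \<bullet> \<xi>) - cis (y \<bullet> \<xi>)) \<le> 2 * \<bar>x \<bullet> \<xi> - y \<bullet> \<xi>\<bar> powr \<alpha>"
            by (rule norm_cis_diff_le) (use k\<alpha> in auto)
          also have "\<dots> \<le> 2 * (dist x y * norm \<xi>) powr \<alpha>"
            using Cauchy_Schwarz_ineq2[of "x - y" \<xi>] k\<alpha>
            by (intro mult_left_mono powr_mono2) (auto simp: dist_norm inner_diff_left)
          finally have "norm (?A \<xi> * (cis (x \<bullet> \<xi>) - cis (y \<bullet> \<xi>))) \<le> (norm \<xi> ^ k * norm (fourier f \<xi>)) * (2 * (dist x y * norm \<xi>) powr \<alpha>)"
            unfolding norm_mult using norm_deriv_symbol_le[OF that(1), of \<xi>] that(2)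
            by (intro mult_mono) auto
          also have "\<dots> = (2 * dist x y powr \<alpha>) * (norm \<xi> powr m * norm (fourier f \<xi>))"
            using False by (simp add: k\<alpha>(1) powr_add powr_mult powr_realpow)
          finally show ?thesis .
        qed simp
      qed
    qed auto
    finally have "\<bar>G bs x - G bs y\<bar> \<le> (2 * dist x y powr \<alpha>) * ?N / C"
      using \<open>C > 0\<close> by (simp add: divide_right_mono)
    then show "\<bar>G bs x - G bs y\<bar> \<le> (2 * ?N / C) * dist x y powr \<alpha>"
      by (simp add: mult_ac)
  qed
  have "holder_space k \<alpha> (G [])"
    unfolding holder_space_def Ck_bdd_def
  proof (intro conjI allI impI)
    fix bs :: "'a list" assume "set bs \<subseteq> Basis \<and> length bs \<le> k"
    then show "continuous_on UNIV (dpart bs (G []))" "bounded (range (dpart bs (G [])))"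
      using cont bdd dp by auto
    fix x assume "length bs < k"
    then show "dpart bs (G []) differentiable at x"
      using der[of bs x] dp \<open>set bs \<subseteq> Basis \<and> length bs \<le> k\<close> by (auto intro: differentiableI)
  next
    fix bs :: "'a list" assume "set bs \<subseteq> Basis \<and> length bs = k"
    then show "\<exists>M. \<forall>x y. \<bar>dpart bs (G []) x - dpart bs (G []) y\<bar> \<le> M * dist x y powr \<alpha>"
      using hol[of bs] dp[of bs] by simp
  qed
  moreover have "AE x in lborel. f x = G [] x"
    using fourier_inversion[OF f integrable_norm_cancel[OF I0]] by (simp add: G_def C_def)
  ultimately show ?thesis unfolding in_holder_def k_def \<alpha>_def by blast
qed

section \<open>Fourier decay of Hoelder functions\<close>

context
  fixes u u' :: "'a::euclidean_space \<Rightarrow> 'b::euclidean_space" and e :: 'a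
  assumes der: "\<And>x t. ((\<lambda>t. u (x + t *\<^sub>R e)) has_vector_derivative u' (x + t *\<^sub>R e)) (at t)"
    and cont: "continuous_on UNIV u'" and u: "integrable lborel u" and u': "integrable lborel u'"
begin

lemma directional_FTC:
  assumes "0 \<le> \<tau>"
  shows "u (x + \<tau> *\<^sub>R e) - u x = (\<integral>s. indicator {0..\<tau>} s *\<^sub>R u' (x + s *\<^sub>R e) \<partial>lborel)"
proof -
  have "(\<integral>s. indicator {0..\<tau>} s *\<^sub>R u' (x + s *\<^sub>R e) \<partial>lborel) = u (x + \<tau> *\<^sub>R e) - u (x + 0 *\<^sub>R e)"
  proof (rule integral_FTC_Icc[OF assms])
    show "((\<lambda>s. u (x + s *\<^sub>R e)) has_vector_derivative u' (x + s *\<^sub>R e)) (at s within {0..\<tau>})" for s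
      using der has_vector_derivative_at_within by blast
    show "continuous_on {0..\<tau>} (\<lambda>s. u' (x + s *\<^sub>R e))"
      by (intro continuous_on_compose2[OF cont] continuous_intros) auto
  qed
  then show ?thesis by simp
qed

lemma integrable_directional:
  "integrable (lborel \<Otimes>\<^sub>M lborel) (\<lambda>(s, x). indicator {0..\<tau>} s *\<^sub>R u' (x + s *\<^sub>R e))"
proof (rule lborel_pair.Fubini_integrable)
  have [measurable]: "u' \<in> borel_measurable borel" by (rule borel_measurable_continuous_onI[OF cont])
  have J: "integrable lborel (\<lambda>x. u' (x + s *\<^sub>R e))" for s
    using lborel_integrable_translate[OF u', of "s *\<^sub>R e"] by (simp add: add.commute)
  have N: "(\<integral>x. norm (u' (x + s *\<^sub>R e)) \<partial>lborel) = (\<integral>x. norm (u' x) \<partial>lborel)" for s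
    using lborel_integral_translate[of "\<lambda>x. norm (u' x)" "s *\<^sub>R e"] by (simp add: add.commute)
  show "(\<lambda>(s, x). indicator {0..\<tau>} s *\<^sub>R u' (x + s *\<^sub>R e)) \<in> borel_measurable (lborel \<Otimes>\<^sub>M lborel)"
    by measurable
  show "integrable lborel (\<lambda>s. \<integral>x. norm (case (s, x) of (s, x) \<Rightarrow> indicator {0..\<tau>} s *\<^sub>R u' (x + s *\<^sub>R e)) \<partial>lborel)"
    by (simp add: N integrable_indicator_iff emeasure_lborel_Icc_eq)
  show "AE s in lborel. integrable lborel (\<lambda>x. case (s, x) of (s, x) \<Rightarrow> indicator {0..\<tau>} s *\<^sub>R u' (x + s *\<^sub>R e))"
    using J by simp
qed

text \<open>The integral of \<open>u (x + e) - u x\<close> vanishes by translation invariance; by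
  the fundamental theorem and Fubini it is also the integral of \<open>u'\<close>. Applied to a
  product, this is integration by parts without boundary terms.\<close>

lemma integral_directional_derivative: "(\<integral>x. u' x \<partial>lborel) = 0"
proof -
  have N: "(\<integral>x. u' (x + s *\<^sub>R e) \<partial>lborel) = (\<integral>x. u' x \<partial>lborel)" for s
    using lborel_integral_translate[of u' "s *\<^sub>R e"] by (simp add: add.commute)
  have "(\<integral>x. u (x + 1 *\<^sub>R e) - u x \<partial>lborel) = (\<integral>x. (\<integral>s. indicator {0..1} s *\<^sub>R u' (x + s *\<^sub>R e) \<partial>lborel) \<partial>lborel)"
    by (simp only: directional_FTC[of 1] zero_le_one)
  also have "\<dots> = (\<integral>s. (\<integral>x. indicator {0..1} s *\<^sub>R u' (x + s *\<^sub>R e) \<partial>lborel) \<partial>lborel)"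
    by (rule lborel_pair.Fubini_integral[OF integrable_directional])
  also have "\<dots> = (\<integral>x. u' x \<partial>lborel)"
    by (simp add: N)
  also have "(\<integral>x. u (x + 1 *\<^sub>R e) - u x \<partial>lborel) = 0"
    using u lborel_integrable_translate[OF u, of e] lborel_integral_translate[of u e] by (simp add: add.commute)
  finally show ?thesis by simp
qed

lemma translation_L1_le:
  assumes "0 \<le> \<tau>"
  shows "(\<integral>x. norm (u (x + \<tau> *\<^sub>R e) - u x) \<partial>lborel) \<le> \<tau> * (\<integral>x. norm (u' x) \<partial>lborel)"
proof -
  have N: "(\<integral>x. norm (u' (x + s *\<^sub>R e)) \<partial>lborel) = (\<integral>x. norm (u' x) \<partial>lborel)" for s
    using lborel_integral_translate[of "\<lambda>x. norm (u' x)" "s *\<^sub>R e"] by (simp add: add.commute)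
  have I: "integrable (lborel \<Otimes>\<^sub>M lborel) (\<lambda>(s, x). norm (indicator {0..\<tau>} s *\<^sub>R u' (x + s *\<^sub>R e)))"
    using integrable_norm[OF integrable_directional[of \<tau>]] by (simp only: split_beta')
  have "(\<integral>x. norm (u (x + \<tau> *\<^sub>R e) - u x) \<partial>lborel) \<le> (\<integral>x. (\<integral>s. norm (indicator {0..\<tau>} s *\<^sub>R u' (x + s *\<^sub>R e)) \<partial>lborel) \<partial>lborel)"
    unfolding directional_FTC[OF assms]
    by (rule integral_mono_AE') (use lborel_pair.integrable_snd[OF I] in \<open>auto intro!: AE_I2 integral_norm_bound simp del: norm_scaleR\<close>)
  also have "\<dots> = (\<integral>s. (\<integral>x. norm (indicator {0..\<tau>} s *\<^sub>R u' (x + s *\<^sub>R e)) \<partial>lborel) \<partial>lborel)"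
    by (rule lborel_pair.Fubini_integral[OF I])
  also have "\<dots> = \<tau> * (\<integral>x. norm (u' x) \<partial>lborel)"
    using assms by (simp add: N)
  finally show ?thesis .
qed

end

section \<open>Gaussian weights and the oscillation of Hoelder functions\<close>

lemma has_vector_derivative_line:
  fixes f :: "'a::euclidean_space \<Rightarrow> 'b::real_normed_vector"
  assumes "(f has_derivative f') (at (x + t *\<^sub>R e))"
  shows "((\<lambda>t. f (x + t *\<^sub>R e)) has_vector_derivative f' e) (at t)"
proof -
  have "((\<lambda>t. x + t *\<^sub>R e) has_vector_derivative e) (at t)"
    by (auto intro!: derivative_eq_intros)
  from vector_derivative_diff_chain_within[OF this, of f f'] show ?thesis
    using has_derivative_at_withinI[OF assms] by (simp add: o_def)
qed

text \<open>The polynomial factor is there for closure: a derivative in direction \<open>e\<close>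
  of a Gaussian window stays in the span of these weights, so integration by parts can be
  iterated.\<close>

definition hermite_weight :: "real \<Rightarrow> 'a::euclidean_space \<Rightarrow> nat \<Rightarrow> 'a \<Rightarrow> real" where
  "hermite_weight c e n x = (x \<bullet> e) ^ n * exp (- c * (norm x)\<^sup>2)"

lemma hermite_weight_integrable:
  assumes "c > 0" "e \<in> Basis"
  shows "integrable lborel (hermite_weight c e n)"
proof (rule Bochner_Integration.integrable_bound[OF integrable_norm_power_gaussian[OF assms(1), of n]])
  show "AE x in lborel. norm (hermite_weight c e n x) \<le> norm (norm x ^ n * exp (- c * (norm x)\<^sup>2))"
    using Basis_le_norm[OF assms(2)]
    by (intro AE_I2) (auto simp: hermite_weight_def abs_mult power_abs intro!: mult_right_mono power_mono)
qed (unfold hermite_weight_def, measurable)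

lemma hermite_weight_continuous: "continuous_on S (hermite_weight c e n)"
  unfolding hermite_weight_def by (intro continuous_intros)

lemma hermite_weight_measurable [measurable]: "hermite_weight c e n \<in> borel_measurable borel"
  by (rule borel_measurable_continuous_onI[OF hermite_weight_continuous])

text \<open>For \<open>n = 0\<close> the truncated index \<open>n - 1\<close> does no harm, since
  its coefficient \<open>real n\<close> is 0.\<close>

lemma hermite_weight_derivative:
  assumes "e \<in> Basis"
  shows "((\<lambda>t. hermite_weight c e n (x + t *\<^sub>R e)) has_vector_derivative
    real n * hermite_weight c e (n - 1) (x + t *\<^sub>R e) - 2 * c * hermite_weight c e (Suc n) (x + t *\<^sub>R e)) (at t)"
proof -
  have eq: "(norm (x + t *\<^sub>R e))\<^sup>2 = (norm x)\<^sup>2 + 2 * t * (x \<bullet> e) + t\<^sup>2" for t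
    unfolding power2_norm_eq_inner
    using assms by (simp add: inner_add_left inner_add_right inner_commute power2_eq_square algebra_simps)
  have eq2: "(x + t *\<^sub>R e) \<bullet> e = x \<bullet> e + t" for t
    using assms by (simp add: inner_add_left)
  show ?thesis
    unfolding hermite_weight_def eq eq2 has_real_derivative_iff_has_vector_derivative[symmetric]
    by (auto intro!: derivative_eq_intros simp: algebra_simps)
qed

text \<open>The derivatives of \<open>g\<close> are bounded but not integrable, so the Fourier decay is extracted
  locally: integration by parts against a Gaussian window times a polynomial, with a half-period
  shift for the last, fractional, order.\<close>

theorem holder_windowed_fourier_decay:
  fixes g :: "'a::euclidean_space \<Rightarrow> real"
  assumes g: "holder_space k \<alpha> g" and \<alpha>: "0 \<le> \<alpha>" "\<alpha> \<le> 1" and c: "c > 0" and e: "e \<in> Basis"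
  obtains C where "\<And>\<Lambda>. \<Lambda> \<ge> 1 \<Longrightarrow>
    norm (\<integral>x. cis (- (x \<bullet> (\<Lambda> *\<^sub>R e))) * of_real (g x * exp (- c * (norm x)\<^sup>2)) \<partial>lborel) \<le> C * \<Lambda> powr (- (real k + \<alpha>))"
proof -
  define G where "G j = dpart (replicate j e) g" for j
  define w where "w = hermite_weight c e"
  have sr: "set (replicate j e) \<subseteq> Basis" for j using e by auto
  have wI: "integrable lborel (w n)" for n unfolding w_def by (rule hermite_weight_integrable[OF c e])
  have [measurable]: "w n \<in> borel_measurable borel" for n by (simp add: w_def)
  have Gc: "continuous_on UNIV (G j)" if "j \<le> k" for j
    using g that sr[of j] by (auto simp: holder_space_def Ck_bdd_def G_def)
  have "\<exists>B. \<forall>x. \<bar>G j x\<bar> \<le> B" if "j \<le> k" for j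
  proof -
    have "bounded (range (G j))" using g that sr[of j] by (auto simp: holder_space_def Ck_bdd_def G_def)
    then show ?thesis by (auto simp: bounded_iff)
  qed
  then obtain B where B: "\<And>j x. j \<le> k \<Longrightarrow> \<bar>G j x\<bar> \<le> B j" by metis
  have Gm: "G j \<in> borel_measurable borel" if "j \<le> k" for j
    by (rule borel_measurable_continuous_onI[OF Gc[OF that]])
  have Gd: "((\<lambda>t. G j (x + t *\<^sub>R e)) has_vector_derivative G (Suc j) (x + t *\<^sub>R e)) (at t)" if "j < k" for j x t
  proof -
    have "G j differentiable (at (x + t *\<^sub>R e))"
      using g that sr[of j] by (auto simp: holder_space_def Ck_bdd_def G_def)
    then have "(G j has_derivative frechet_derivative (G j) (at (x + t *\<^sub>R e))) (at (x + t *\<^sub>R e))"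
      by (simp add: frechet_derivative_works)
    from has_vector_derivative_line[OF this] show ?thesis by (simp add: G_def partial_def)
  qed
  \<comment> \<open>\<open>j\<close> counts the derivatives that have reached \<open>g\<close>, and
    \<open>n\<close> is the degree of the polynomial in the weight.\<close>
  define U where "U \<Lambda> j n x = complex_of_real (G j x * w n x) * cis (- (\<Lambda> * (x \<bullet> e)))" for \<Lambda> j n x
  define I where "I \<Lambda> j n = (\<integral>x. U \<Lambda> j n x \<partial>lborel)" for \<Lambda> j n
  have UI: "integrable lborel (U \<Lambda> j n)" if "j \<le> k" for \<Lambda> j n
  proof -
    note [measurable] = Gm[OF that]
    show ?thesis
      unfolding U_def
    proof (rule Bochner_Integration.integrable_bound[OF integrable_mult_right[OF wI[of n], of "B j"]])
      show "AE x in lborel. norm (complex_of_real (G j x * w n x) * cis (- (\<Lambda> * (x \<bullet> e)))) \<le> norm (B j * w n x)"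
        using B[OF that] by (intro AE_I2) (auto simp: norm_mult abs_mult intro!: mult_right_mono order_trans[OF B[OF that] abs_ge_self])
    qed measurable
  qed
  have Uc: "continuous_on UNIV (U \<Lambda> j n)" if "j \<le> k" for \<Lambda> j n
    unfolding U_def w_def by (intro continuous_intros Gc that hermite_weight_continuous)
  have Ibd: "norm (I \<Lambda> j n) \<le> B j * (\<integral>x. \<bar>w n x\<bar> \<partial>lborel)" if "j \<le> k" for \<Lambda> j n
  proof -
    have "norm (I \<Lambda> j n) \<le> (\<integral>x. B j * \<bar>w n x\<bar> \<partial>lborel)"
      unfolding I_def
      by (rule order_trans[OF integral_norm_bound integral_mono_AE'])
        (use wI B[OF that] in \<open>auto simp: U_def norm_mult abs_mult intro!: AE_I2 mult_right_mono order_trans[OF abs_ge_zero B[OF that]]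
           mult_nonneg_nonneg\<close>)
    then show ?thesis by simp
  qed
  \<comment> \<open>The integral of the full derivative of \<open>U \<Lambda> j n\<close> in
    direction \<open>e\<close> is 0. The derivative of the character gives the factor
    \<open>\<Lambda>\<close> on the left; the derivatives of \<open>g\<close> and of the weight give
    the right-hand side.\<close>
  have parts: "\<i> * of_real \<Lambda> * I \<Lambda> j n = I \<Lambda> (Suc j) n + of_nat n * I \<Lambda> j (n - 1) - complex_of_real (2 * c) * I \<Lambda> j (Suc n)"
    if "j < k" for \<Lambda> j n
  proof -
    define U' where "U' x = U \<Lambda> (Suc j) n x + of_nat n * U \<Lambda> j (n - 1) x - complex_of_real (2 * c) * U \<Lambda> j (Suc n) x - \<i> * of_real \<Lambda> * U \<Lambda> j n x" for x
    have jk: "j \<le> k" "Suc j \<le> k" using that by auto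
    have "(\<integral>x. U' x \<partial>lborel) = 0"
    proof (rule integral_directional_derivative[where u="U \<Lambda> j n" and e=e])
      show "continuous_on UNIV U'" unfolding U'_def by (intro continuous_intros Uc jk)
      show "integrable lborel U'" unfolding U'_def using UI[OF jk(1)] UI[OF jk(2)] by simp
      show "integrable lborel (U \<Lambda> j n)" by (rule UI[OF jk(1)])
      fix x t
      have c1: "((\<lambda>t. cis (- (\<Lambda> * ((x + t *\<^sub>R e) \<bullet> e)))) has_vector_derivative - \<i> * of_real \<Lambda> * cis (- (\<Lambda> * ((x + t *\<^sub>R e) \<bullet> e)))) (at t)"
      proof -
        have "(x + t *\<^sub>R e) \<bullet> e = x \<bullet> e + t" for t using e by (simp add: inner_add_left)
        then show ?thesis
          unfolding cis_conv_exp
          by (auto intro!: derivative_eq_intros has_vector_derivative_real_field simp: algebra_simps)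
      qed
      have g1: "((\<lambda>t. complex_of_real (G j (x + t *\<^sub>R e) * w n (x + t *\<^sub>R e))) has_vector_derivative
          complex_of_real (G j (x + t *\<^sub>R e) * (real n * w (n - 1) (x + t *\<^sub>R e) - 2 * c * w (Suc n) (x + t *\<^sub>R e)) + G (Suc j) (x + t *\<^sub>R e) * w n (x + t *\<^sub>R e))) (at t)"
      proof (rule has_vector_derivative_of_real)
        have "((\<lambda>t. w n (x + t *\<^sub>R e)) has_vector_derivative real n * w (n - 1) (x + t *\<^sub>R e) - 2 * c * w (Suc n) (x + t *\<^sub>R e)) (at t)"
          unfolding w_def by (rule hermite_weight_derivative[OF e])
        from has_vector_derivative_mult[OF Gd[OF that, of x t] this]
        show "((\<lambda>t. G j (x + t *\<^sub>R e) * w n (x + t *\<^sub>R e)) has_real_derivative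
            G j (x + t *\<^sub>R e) * (real n * w (n - 1) (x + t *\<^sub>R e) - 2 * c * w (Suc n) (x + t *\<^sub>R e)) + G (Suc j) (x + t *\<^sub>R e) * w n (x + t *\<^sub>R e)) (at t)"
          unfolding has_real_derivative_iff_has_vector_derivative .
      qed
      show "((\<lambda>t. U \<Lambda> j n (x + t *\<^sub>R e)) has_vector_derivative U' (x + t *\<^sub>R e)) (at t)"
        using has_vector_derivative_mult[OF g1 c1]
        by (simp add: U_def U'_def algebra_simps)
    qed
    moreover have "(\<integral>x. U' x \<partial>lborel) = I \<Lambda> (Suc j) n + of_nat n * I \<Lambda> j (n - 1) - complex_of_real (2 * c) * I \<Lambda> j (Suc n) - \<i> * of_real \<Lambda> * I \<Lambda> j n"
      unfolding U'_def I_def using UI[OF jk(1)] UI[OF jk(2)] by simp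
    ultimately show ?thesis by (simp add: algebra_simps)
  qed
  define bnd where "bnd q j n \<longleftrightarrow> (\<exists>C. \<forall>\<Lambda>\<ge>1. norm (I \<Lambda> j n) \<le> C * \<Lambda> powr (- q))" for q j n
  have step: "bnd (q + 1) j n" if "j < k" and s2: "\<And>n. bnd q j n" and s3: "\<And>n. bnd q (Suc j) n" for q j n
  proof -
    obtain C1 C2 C3 where C: "\<And>\<Lambda>. \<Lambda> \<ge> 1 \<Longrightarrow> norm (I \<Lambda> (Suc j) n) \<le> C1 * \<Lambda> powr (- q)"
      "\<And>\<Lambda>. \<Lambda> \<ge> 1 \<Longrightarrow> norm (I \<Lambda> j (n - 1)) \<le> C2 * \<Lambda> powr (- q)"
      "\<And>\<Lambda>. \<Lambda> \<ge> 1 \<Longrightarrow> norm (I \<Lambda> j (Suc n)) \<le> C3 * \<Lambda> powr (- q)"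
      using s3[of n] s2[of "n - 1"] s2[of "Suc n"] unfolding bnd_def by blast
    have "norm (I \<Lambda> j n) \<le> (C1 + real n * C2 + 2 * c * C3) * \<Lambda> powr (- (q + 1))" if \<Lambda>: "\<Lambda> \<ge> 1" for \<Lambda>
    proof -
      have "\<Lambda> * norm (I \<Lambda> j n) = norm (\<i> * of_real \<Lambda> * I \<Lambda> j n)"
        using \<Lambda> by (simp add: norm_mult)
      also have "\<dots> \<le> norm (I \<Lambda> (Suc j) n) + norm (of_nat n * I \<Lambda> j (n - 1)) + norm (complex_of_real (2 * c) * I \<Lambda> j (Suc n))"
        unfolding parts[OF \<open>j < k\<close>] by (rule order_trans[OF norm_triangle_ineq4 add_right_mono[OF norm_triangle_ineq]])
      also have "\<dots> = norm (I \<Lambda> (Suc j) n) + real n * norm (I \<Lambda> j (n - 1)) + 2 * c * norm (I \<Lambda> j (Suc n))"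
        using c by (simp add: norm_mult)
      also have "\<dots> \<le> C1 * \<Lambda> powr (- q) + real n * (C2 * \<Lambda> powr (- q)) + 2 * c * (C3 * \<Lambda> powr (- q))"
        using C[OF \<Lambda>] c by (intro add_mono mult_left_mono) auto
      also have "\<dots> = \<Lambda> * ((C1 + real n * C2 + 2 * c * C3) * \<Lambda> powr (- (q + 1)))"
      proof -
        have "\<Lambda> powr (- q) = \<Lambda> * \<Lambda> powr (- (q + 1))"
          using \<Lambda> by (simp add: powr_mult_base)
        then show ?thesis by (simp only:) (simp add: algebra_simps)
      qed
      finally show ?thesis using \<Lambda> by simp
    qed
    then show ?thesis unfolding bnd_def by blast
  qed
  \<comment> \<open>\<open>step\<close> consumes the same rate at \<open>j\<close> and at
    \<open>Suc j\<close>, so the starting rate \<open>\<alpha>\<close> is required at every level.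
    Below \<open>k\<close> one integration by parts gives rate 1, which is at least
    \<open>\<alpha>\<close>. At level \<open>k\<close> no further derivative is available and the
    Hoelder bound takes over.\<close>
  have base: "bnd \<alpha> j n" if "j \<le> k" for j n
  proof (cases "j < k")
    case True
    have b0: "bnd 0 i n" if "i \<le> k" for i n
      unfolding bnd_def using Ibd[OF that, of _ n] by (intro exI[of _ "B i * (\<integral>x. \<bar>w n x\<bar> \<partial>lborel)"]) auto
    have "bnd (0 + 1) j n" using True by (intro step b0) auto
    then obtain C where C: "\<And>\<Lambda>. \<Lambda> \<ge> 1 \<Longrightarrow> norm (I \<Lambda> j n) \<le> C * \<Lambda> powr (- 1)"
      unfolding bnd_def by auto
    have "norm (I \<Lambda> j n) \<le> \<bar>C\<bar> * \<Lambda> powr (- \<alpha>)" if "\<Lambda> \<ge> 1" for \<Lambda>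
      using that \<alpha> by (intro order_trans[OF C[OF that]] mult_mono powr_mono) auto
    then show ?thesis unfolding bnd_def by blast
  next
    case False
    then have jk: "j = k" using that by simp
    note [measurable] = Gm[OF order_refl]
    obtain M where M: "\<And>x y. \<bar>G k x - G k y\<bar> \<le> M * dist x y powr \<alpha>"
      using g sr[of k] unfolding holder_space_def G_def by (metis length_replicate)
    define w' where "w' x = real n * w (n - 1) x - 2 * c * w (Suc n) x" for x
    have w'I: "integrable lborel w'" unfolding w'_def using wI by auto
    have tl: "(\<integral>x. norm (w n (x + \<tau> *\<^sub>R e) - w n x) \<partial>lborel) \<le> \<tau> * (\<integral>x. norm (w' x) \<partial>lborel)" if "0 \<le> \<tau>" for \<tau>
    proof (rule translation_L1_le[OF _ _ wI w'I that])
      show "continuous_on UNIV w'" unfolding w'_def w_def by (intro continuous_intros hermite_weight_continuous)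
      show "((\<lambda>t. w n (x + t *\<^sub>R e)) has_vector_derivative w' (x + t *\<^sub>R e)) (at t)" for x t
        unfolding w'_def w_def by (rule hermite_weight_derivative[OF e])
    qed
    define C where "C = \<bar>M\<bar> * pi powr \<alpha> * (\<integral>x. \<bar>w n x\<bar> \<partial>lborel) + B k * (pi * (\<integral>x. norm (w' x) \<partial>lborel))"
    have "B k \<ge> 0" using B[of k 0] by simp
    have "norm (I \<Lambda> k n) \<le> (C / 2) * \<Lambda> powr (- \<alpha>)" if \<Lambda>: "\<Lambda> \<ge> 1" for \<Lambda>
    proof -
      \<comment> \<open>Half a period of the character in direction \<open>e\<close>: the shift
        reverses its sign, and the sum of the two integrands sees only differences of
        \<open>G k * w n\<close> over the distance \<open>\<tau>\<close>.\<close>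
      define \<tau> where "\<tau> = pi / \<Lambda>"
      have \<tau>: "\<tau> \<ge> 0" using \<Lambda> by (simp add: \<tau>_def)
      have UI': "integrable lborel (\<lambda>x. U \<Lambda> k n (x + \<tau> *\<^sub>R e))"
        using lborel_integrable_translate[OF UI[OF order_refl, of \<Lambda> n], of "\<tau> *\<^sub>R e"] by (simp add: add.commute)
      have wI': "integrable lborel (\<lambda>x. w n (x + \<tau> *\<^sub>R e))"
        using lborel_integrable_translate[OF wI[of n], of "\<tau> *\<^sub>R e"] by (simp add: add.commute)
      have "2 * I \<Lambda> k n = (\<integral>x. U \<Lambda> k n x \<partial>lborel) + (\<integral>x. U \<Lambda> k n (x + \<tau> *\<^sub>R e) \<partial>lborel)"
        using lborel_integral_translate[of "U \<Lambda> k n" "\<tau> *\<^sub>R e"] by (simp add: I_def add.commute)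
      also have "\<dots> = (\<integral>x. U \<Lambda> k n x + U \<Lambda> k n (x + \<tau> *\<^sub>R e) \<partial>lborel)"
        using UI[OF order_refl] UI' by simp
      finally have "norm (2 * I \<Lambda> k n) \<le> (\<integral>x. norm (U \<Lambda> k n x + U \<Lambda> k n (x + \<tau> *\<^sub>R e)) \<partial>lborel)"
        by (simp only: integral_norm_bound)
      also have "\<dots> \<le> (\<integral>x. \<bar>M\<bar> * \<tau> powr \<alpha> * \<bar>w n x\<bar> + B k * norm (w n (x + \<tau> *\<^sub>R e) - w n x) \<partial>lborel)"
      proof (rule integral_mono_AE')
        show "integrable lborel (\<lambda>x. \<bar>M\<bar> * \<tau> powr \<alpha> * \<bar>w n x\<bar> + B k * norm (w n (x + \<tau> *\<^sub>R e) - w n x))"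
          using wI wI' by auto
        show "AE x in lborel. norm (U \<Lambda> k n x + U \<Lambda> k n (x + \<tau> *\<^sub>R e)) \<le> \<bar>M\<bar> * \<tau> powr \<alpha> * \<bar>w n x\<bar> + B k * norm (w n (x + \<tau> *\<^sub>R e) - w n x)"
        proof (rule AE_I2)
          fix x :: 'a
          have "cis (- (\<Lambda> * ((x + \<tau> *\<^sub>R e) \<bullet> e))) = cis (- pi) * cis (- (\<Lambda> * (x \<bullet> e)))"
            unfolding cis_mult using e \<Lambda> by (simp add: inner_add_left \<tau>_def algebra_simps)
          also have "cis (- pi) = - 1" by (simp add: complex_eq_iff)
          finally have "U \<Lambda> k n x + U \<Lambda> k n (x + \<tau> *\<^sub>R e) = complex_of_real (G k x * w n x - G k (x + \<tau> *\<^sub>R e) * w n (x + \<tau> *\<^sub>R e)) * cis (- (\<Lambda> * (x \<bullet> e)))"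
            by (simp add: U_def algebra_simps)
          then have "norm (U \<Lambda> k n x + U \<Lambda> k n (x + \<tau> *\<^sub>R e)) = \<bar>G k x * w n x - G k (x + \<tau> *\<^sub>R e) * w n (x + \<tau> *\<^sub>R e)\<bar>"
            by (simp only: norm_mult norm_of_real norm_cis mult_1_right)
          also have "\<dots> = \<bar>(G k x - G k (x + \<tau> *\<^sub>R e)) * w n x - G k (x + \<tau> *\<^sub>R e) * (w n (x + \<tau> *\<^sub>R e) - w n x)\<bar>"
            by (simp add: algebra_simps)
          also have "\<dots> \<le> \<bar>G k x - G k (x + \<tau> *\<^sub>R e)\<bar> * \<bar>w n x\<bar> + \<bar>G k (x + \<tau> *\<^sub>R e)\<bar> * \<bar>w n (x + \<tau> *\<^sub>R e) - w n x\<bar>"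
            unfolding abs_mult[symmetric] by (rule abs_triangle_ineq4)
          also have "\<dots> \<le> \<bar>M\<bar> * \<tau> powr \<alpha> * \<bar>w n x\<bar> + B k * norm (w n (x + \<tau> *\<^sub>R e) - w n x)"
          proof (intro add_mono mult_right_mono)
            have "\<bar>G k x - G k (x + \<tau> *\<^sub>R e)\<bar> \<le> M * \<tau> powr \<alpha>"
              using M[of x "x + \<tau> *\<^sub>R e"] e \<tau> by (simp add: dist_norm)
            also have "\<dots> \<le> \<bar>M\<bar> * \<tau> powr \<alpha>" by (intro mult_right_mono) auto
            finally show "\<bar>G k x - G k (x + \<tau> *\<^sub>R e)\<bar> \<le> \<bar>M\<bar> * \<tau> powr \<alpha>" .
          qed (use B[of k] in \<open>auto intro: mult_right_mono\<close>)
          finally show "norm (U \<Lambda> k n x + U \<Lambda> k n (x + \<tau> *\<^sub>R e)) \<le> \<bar>M\<bar> * \<tau> powr \<alpha> * \<bar>w n x\<bar> + B k * norm (w n (x + \<tau> *\<^sub>R e) - w n x)" .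
        qed
      qed (use \<open>B k \<ge> 0\<close> in auto)
      also have "\<dots> = \<bar>M\<bar> * \<tau> powr \<alpha> * (\<integral>x. \<bar>w n x\<bar> \<partial>lborel) + B k * (\<integral>x. norm (w n (x + \<tau> *\<^sub>R e) - w n x) \<partial>lborel)"
        using wI wI' by simp
      also have "\<dots> \<le> \<bar>M\<bar> * \<tau> powr \<alpha> * (\<integral>x. \<bar>w n x\<bar> \<partial>lborel) + B k * (\<tau> * (\<integral>x. norm (w' x) \<partial>lborel))"
        using \<open>B k \<ge> 0\<close> tl[OF \<tau>] by (intro add_left_mono mult_left_mono) auto
      also have "\<dots> \<le> \<bar>M\<bar> * (pi powr \<alpha> * \<Lambda> powr (- \<alpha>)) * (\<integral>x. \<bar>w n x\<bar> \<partial>lborel) + B k * (pi * \<Lambda> powr (- \<alpha>) * (\<integral>x. norm (w' x) \<partial>lborel))"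
      proof -
        have "\<tau> powr \<alpha> = pi powr \<alpha> * \<Lambda> powr (- \<alpha>)"
          using \<Lambda> by (simp add: \<tau>_def powr_divide powr_minus_divide)
        \<comment> \<open>The smooth weight gains a full power of \<open>\<Lambda>\<close>; only
          \<open>\<alpha>\<close> of it is kept, to match the Hoelder term.\<close>
        moreover have "\<tau> \<le> pi * \<Lambda> powr (- \<alpha>)"
        proof -
          have "\<tau> = pi * \<Lambda> powr (- 1)" using \<Lambda> by (simp add: \<tau>_def powr_minus divide_inverse)
          also have "\<dots> \<le> pi * \<Lambda> powr (- \<alpha>)" using \<Lambda> \<alpha> by (intro mult_left_mono powr_mono) auto
          finally show ?thesis .
        qed
        ultimately show ?thesis using \<open>B k \<ge> 0\<close>
          by (intro add_mono mult_left_mono mult_right_mono) auto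
      qed
      also have "\<dots> = C * \<Lambda> powr (- \<alpha>)" by (simp add: C_def algebra_simps)
      finally show ?thesis by (simp add: norm_mult)
    qed
    then show ?thesis unfolding bnd_def jk by blast
  qed
  \<comment> \<open>\<open>p\<close> counts integrations by parts. Each may raise \<open>j\<close>
    by one, so \<open>p\<close> of them are possible from level \<open>j\<close> if
    \<open>j + p \<le> k\<close>; \<open>j = 0\<close> and \<open>p = k\<close> give the full
    rate.\<close>
  have "\<forall>j n. j + p \<le> k \<longrightarrow> bnd (real p + \<alpha>) j n" for p
  proof (induction p)
    case 0
    then show ?case using base by simp
  next
    case (Suc p)
    show ?case
    proof (intro allI impI)
      fix j n assume j: "j + Suc p \<le> k"
      have "bnd (real p + \<alpha> + 1) j n" by (rule step) (use Suc.IH j in auto)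
      then show "bnd (real (Suc p) + \<alpha>) j n" by (simp add: add_ac)
    qed
  qed
  then have "bnd (real k + \<alpha>) 0 0" by auto
  then obtain C where C: "\<And>\<Lambda>. \<Lambda> \<ge> 1 \<Longrightarrow> norm (I \<Lambda> 0 0) \<le> C * \<Lambda> powr (- (real k + \<alpha>))"
    unfolding bnd_def by blast
  have "I \<Lambda> 0 0 = (\<integral>x. cis (- (x \<bullet> (\<Lambda> *\<^sub>R e))) * of_real (g x * exp (- c * (norm x)\<^sup>2)) \<partial>lborel)" for \<Lambda>
    by (simp add: I_def U_def G_def w_def hermite_weight_def mult.commute)
  with C that show ?thesis by metis
qed

section \<open>Trigonometric test functions with compact support\<close>

text \<open>For \<open>j = 0\<close> this is the classical smooth function that is flat at 0. The
  negative powers of \<open>t\<close> make the family closed under differentiation up to linear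
  combinations, so no higher derivative needs separate treatment.\<close>

definition bump :: "nat \<Rightarrow> real \<Rightarrow> real" where
  "bump j t = (if t > 0 then exp (- 1 / t) / t ^ j else 0)"

text \<open>The \<open>n\<close>-th power of \<open>x / n \<le> exp (x / n)\<close>. With
  \<open>x = 1 / t\<close> it bounds each \<open>bump\<close> uniformly.\<close>

lemma power_times_exp_minus_le:
  fixes x :: real
  assumes "x \<ge> 0"
  shows "x ^ n * exp (- x) \<le> real n ^ n"
proof (cases "n = 0")
  case False
  have "x / real n \<le> exp (x / real n)"
    using exp_ge_add_one_self[of "x / real n"] by linarith
  then have "(x / real n) ^ n \<le> exp (x / real n) ^ n"
    using assms by (intro power_mono) auto
  also have "\<dots> = exp x" using False by (simp add: exp_of_nat_mult[symmetric])
  finally show ?thesis using False by (simp add: power_divide exp_minus field_simps)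
qed (use assms in simp)

lemma bump_nonneg: "0 \<le> bump j t" by (simp add: bump_def)

lemma bump_le: "bump j t \<le> real j ^ j"
proof (cases "t > 0")
  case True
  then show ?thesis using power_times_exp_minus_le[of "1 / t" j]
    by (simp add: bump_def power_divide)
qed (simp add: bump_def)

lemma bump_le_linear: "bump j t \<le> real (Suc j) ^ Suc j * \<bar>t\<bar>"
proof (cases "t > 0")
  case True
  then have "bump j t = bump (Suc j) t * \<bar>t\<bar>" by (simp add: bump_def)
  also have "\<dots> \<le> real (Suc j) ^ Suc j * \<bar>t\<bar>" by (intro mult_right_mono bump_le) auto
  finally show ?thesis .
next
  case False
  then have "bump j t = 0" by (simp add: bump_def)
  then show ?thesis by (metis abs_ge_zero mult_nonneg_nonneg of_nat_0_le_iff zero_le_power)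
qed

text \<open>Away from 0 this is the quotient rule or the derivative of a constant. At 0 the
  difference quotient of \<open>bump j\<close> is \<open>bump (Suc j)\<close>, which is bounded by a
  multiple of the increment.\<close>

lemma bump_deriv: "(bump j has_real_derivative bump (j + 2) t - real j * bump (Suc j) t) (at t)"
proof -
  consider "t > 0" | "t < 0" | "t = 0" by linarith
  then show ?thesis
  proof cases
    case 1
    have "((\<lambda>t. exp (- 1 / t) / t ^ j) has_real_derivative bump (j + 2) t - real j * bump (Suc j) t) (at t)"
    proof (cases j)
      case 0
      then show ?thesis using 1
        by (auto intro!: derivative_eq_intros simp: bump_def power2_eq_square)
    next
      case (Suc i)
      have e: "((\<lambda>t. exp (- 1 / t)) has_real_derivative exp (- 1 / t) / t\<^sup>2) (at t)"
        using 1 by (auto intro!: derivative_eq_intros simp: power2_eq_square)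
      have p: "((\<lambda>t. t ^ j) has_real_derivative real (Suc i) * t ^ i) (at t)"
        using DERIV_pow[of j t] by (simp add: Suc)
      show ?thesis
        by (rule DERIV_cong[OF DERIV_divide[OF e p]]) (use 1 in \<open>simp_all add: Suc bump_def field_simps power2_eq_square\<close>)
    qed
    then show ?thesis
      by (rule has_field_derivative_transform_within_open[of _ _ _ "{0<..}"]) (use 1 in \<open>auto simp: bump_def\<close>)
  next
    case 2
    have "((\<lambda>t. 0) has_real_derivative bump (j + 2) t - real j * bump (Suc j) t) (at t)"
      using 2 by (simp add: bump_def)
    then show ?thesis
      by (rule has_field_derivative_transform_within_open[of _ _ _ "{..<0}"]) (use 2 in \<open>auto simp: bump_def\<close>)
  next
    case 3
    have "(\<lambda>h. (bump j (0 + h) - bump j 0) / h) \<midarrow>0\<rightarrow> 0"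
    proof (rule Lim_null_comparison)
      show "\<forall>\<^sub>F h in at 0. norm ((bump j (0 + h) - bump j 0) / h) \<le> real (Suc (Suc j)) ^ Suc (Suc j) * \<bar>h\<bar>"
      proof (rule always_eventually, rule allI)
        fix h :: real
        have "norm ((bump j (0 + h) - bump j 0) / h) = bump (Suc j) h"
          by (cases "h > 0") (auto simp: bump_def)
        then show "norm ((bump j (0 + h) - bump j 0) / h) \<le> real (Suc (Suc j)) ^ Suc (Suc j) * \<bar>h\<bar>"
          using bump_le_linear[of "Suc j" h] by simp
      qed
      show "((\<lambda>h::real. real (Suc (Suc j)) ^ Suc (Suc j) * \<bar>h\<bar>) \<longlongrightarrow> 0) (at 0)"
        by (intro tendsto_mult_right_zero tendsto_rabs_zero tendsto_ident_at)
    qed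
    then show ?thesis using 3 by (simp add: DERIV_def bump_def)
  qed
qed

lemma bump_continuous: "continuous_on S (bump j)"
  by (rule DERIV_continuous_on[OF has_field_derivative_at_within[OF bump_deriv]])

lemma bump_measurable [measurable]: "bump j \<in> borel_measurable borel"
  by (rule borel_measurable_continuous_onI[OF bump_continuous])

text \<open>Positive exactly inside the ball of radius \<open>r\<close>, for \<open>r > 0\<close>,
  and a polynomial in \<open>x\<close>; composing it with \<open>bump\<close> gives a smooth cutoff
  without the non-smooth norm.\<close>

definition window :: "real \<Rightarrow> 'a::euclidean_space \<Rightarrow> real" where
  "window r x = 1 - (x \<bullet> x) / r\<^sup>2"

lemma window_measurable [measurable]: "window r \<in> borel_measurable borel"
  unfolding window_def by measurable

text \<open>This class is closed under differentiation, so all iterated partial derivatives of its members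
  are bounded without being computed.\<close>

inductive windowed :: "real \<Rightarrow> ('a::euclidean_space \<Rightarrow> real) \<Rightarrow> bool" for r where
  windowed_base: "windowed r (\<lambda>x. bump j (window r x) * cos (x \<bullet> \<xi> + \<theta>))"
| windowed_coord: "windowed r f \<Longrightarrow> windowed r (\<lambda>x. (x \<bullet> b) * f x)"
| windowed_add: "windowed r f \<Longrightarrow> windowed r g \<Longrightarrow> windowed r (\<lambda>x. f x + g x)"
| windowed_cmult: "windowed r f \<Longrightarrow> windowed r (\<lambda>x. c * f x)"

lemma window_derivative:
  "((\<lambda>x. bump j (window r x) * cos (x \<bullet> \<xi> + \<theta>)) has_derivative
     (\<lambda>h. (bump (j + 2) (window r x) - real j * bump (Suc j) (window r x)) * (- 2 * (x \<bullet> h) / r\<^sup>2) * cos (x \<bullet> \<xi> + \<theta>)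
        - bump j (window r x) * ((h \<bullet> \<xi>) * sin (x \<bullet> \<xi> + \<theta>)))) (at x)"
proof -
  have "(window r has_derivative (\<lambda>h. - 2 * (x \<bullet> h) / r\<^sup>2)) (at x)"
    unfolding window_def divide_inverse by (auto intro!: derivative_eq_intros simp: inner_commute)
  from has_derivative_compose[OF this bump_deriv[unfolded has_field_derivative_def]]
  have "((\<lambda>x. bump j (window r x)) has_derivative (\<lambda>h. (bump (j + 2) (window r x) - real j * bump (Suc j) (window r x)) * (- 2 * (x \<bullet> h) / r\<^sup>2))) (at x)"
    by simp
  then show ?thesis
    by (auto intro!: derivative_eq_intros simp: algebra_simps)
qed

lemma windowed_derivative:
  assumes "windowed r f"
  shows "\<exists>f'. (\<forall>x. (f has_derivative f' x) (at x)) \<and> (\<forall>b. windowed r (\<lambda>x. f' x b))"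
  using assms
proof induction
  case (windowed_base j \<xi> \<theta>)
  show ?case
  proof (intro exI conjI allI)
    show "((\<lambda>x. bump j (window r x) * cos (x \<bullet> \<xi> + \<theta>)) has_derivative
     (\<lambda>h. (bump (j + 2) (window r x) - real j * bump (Suc j) (window r x)) * (- 2 * (x \<bullet> h) / r\<^sup>2) * cos (x \<bullet> \<xi> + \<theta>)
        - bump j (window r x) * ((h \<bullet> \<xi>) * sin (x \<bullet> \<xi> + \<theta>)))) (at x)" for x
      by (rule window_derivative)
    fix b :: 'a
    let ?B = "\<lambda>j \<theta> x. bump j (window r x) * cos (x \<bullet> \<xi> + \<theta>)"
    \<comment> \<open>The sine from the derivative is written as a cosine with phase advanced by
      \<open>pi / 2\<close>; this is why the base functions carry a phase.\<close>
    have "windowed r (\<lambda>x. (x \<bullet> b) * ((- 2 / r\<^sup>2) * (?B (j + 2) \<theta> x + (- real j) * ?B (Suc j) \<theta> x)) + (b \<bullet> \<xi>) * ?B j (\<theta> + pi / 2) x)"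
      by (intro windowed.intros)
    also have "(\<lambda>x. (x \<bullet> b) * ((- 2 / r\<^sup>2) * (?B (j + 2) \<theta> x + (- real j) * ?B (Suc j) \<theta> x)) + (b \<bullet> \<xi>) * ?B j (\<theta> + pi / 2) x)
       = (\<lambda>x. (bump (j + 2) (window r x) - real j * bump (Suc j) (window r x)) * (- 2 * (x \<bullet> b) / r\<^sup>2) * cos (x \<bullet> \<xi> + \<theta>)
        - bump j (window r x) * ((b \<bullet> \<xi>) * sin (x \<bullet> \<xi> + \<theta>)))"
    proof
      fix x
      have "cos (x \<bullet> \<xi> + (\<theta> + pi / 2)) = - sin (x \<bullet> \<xi> + \<theta>)"
        by (simp add: cos_add sin_add add.assoc[symmetric])
      then show "(x \<bullet> b) * ((- 2 / r\<^sup>2) * (?B (j + 2) \<theta> x + (- real j) * ?B (Suc j) \<theta> x)) + (b \<bullet> \<xi>) * ?B j (\<theta> + pi / 2) x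
       = (bump (j + 2) (window r x) - real j * bump (Suc j) (window r x)) * (- 2 * (x \<bullet> b) / r\<^sup>2) * cos (x \<bullet> \<xi> + \<theta>)
        - bump j (window r x) * ((b \<bullet> \<xi>) * sin (x \<bullet> \<xi> + \<theta>))"
        by (simp add: algebra_simps diff_divide_distrib)
    qed
    finally show "windowed r (\<lambda>x. (bump (j + 2) (window r x) - real j * bump (Suc j) (window r x)) * (- 2 * (x \<bullet> b) / r\<^sup>2) * cos (x \<bullet> \<xi> + \<theta>)
        - bump j (window r x) * ((b \<bullet> \<xi>) * sin (x \<bullet> \<xi> + \<theta>)))" .
  qed
next
  case (windowed_coord f b)
  then obtain f' where f': "\<And>x. (f has_derivative f' x) (at x)" "\<And>b. windowed r (\<lambda>x. f' x b)" by blast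
  show ?case
  proof (intro exI conjI allI)
    show "((\<lambda>x. (x \<bullet> b) * f x) has_derivative (\<lambda>h. (x \<bullet> b) * f' x h + (h \<bullet> b) * f x)) (at x)" for x
      by (auto intro!: derivative_eq_intros f')
    show "windowed r (\<lambda>x. (x \<bullet> b) * f' x h + (h \<bullet> b) * f x)" for h
      by (intro windowed.intros f' windowed_coord)
  qed
next
  case (windowed_add f g)
  then obtain f' g' where f': "\<And>x. (f has_derivative f' x) (at x)" "\<And>b. windowed r (\<lambda>x. f' x b)"
    and g': "\<And>x. (g has_derivative g' x) (at x)" "\<And>b. windowed r (\<lambda>x. g' x b)" by metis
  show ?case
    using f' g' by (intro exI[of _ "\<lambda>x h. f' x h + g' x h"] conjI allI has_derivative_add windowed.windowed_add)
next
  case (windowed_cmult f c)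
  then obtain f' where f': "\<And>x. (f has_derivative f' x) (at x)" "\<And>b. windowed r (\<lambda>x. f' x b)" by blast
  show ?case
    using f' by (intro exI[of _ "\<lambda>x h. c * f' x h"] conjI allI has_derivative_mult_right windowed.windowed_cmult)
qed

lemma windowed_support:
  assumes "windowed r f" "r > 0"
  shows "f x \<noteq> 0 \<Longrightarrow> norm x \<le> r"
  using assms(1)
proof induction
  case (windowed_base j \<xi> \<theta>)
  then have "window r x > 0" by (auto simp: bump_def split: if_splits)
  then have "(norm x)\<^sup>2 < r\<^sup>2" using assms(2) by (simp add: window_def power2_norm_eq_inner)
  then show ?case using assms(2) by (simp add: power2_less_imp_less less_imp_le)
next
  case (windowed_add f g)
  then show ?case by (cases "f x = 0") auto
qed auto

lemma windowed_dpart: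
  assumes f: "windowed r f"
  shows "windowed r (dpart bs f)"
proof (induction bs)
  case (Cons b bs)
  from windowed_derivative[OF this] obtain f' where f': "\<And>x. (dpart bs f has_derivative f' x) (at x)" "\<And>b. windowed r (\<lambda>x. f' x b)"
    by blast
  have "dpart (b # bs) f = (\<lambda>x. f' x b)"
    using frechet_derivative_at[OF f'(1)] by (simp add: partial_def)
  then show ?case using f'(2) by simp
qed (use f in simp)

lemma test_fun_windowed:
  assumes f: "windowed r f" and r: "r > 0"
  shows "test_fun f"
proof -
  have diff: "g differentiable (at x)" if "windowed r g" for g :: "'a \<Rightarrow> real" and x
    using windowed_derivative[OF that] differentiableI by blast
  have cont: "continuous_on UNIV g" if "windowed r g" for g :: "'a \<Rightarrow> real"
    using diff[OF that] by (simp add: continuous_at_imp_continuous_on differentiable_imp_continuous_within)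
  have bdd: "bounded (range g)" if "windowed r g" for g :: "'a \<Rightarrow> real"
  proof -
    have "compact (g ` cball 0 r)"
      by (intro compact_continuous_image continuous_on_subset[OF cont[OF that]]) auto
    then have "bounded (insert 0 (g ` cball 0 r))" by (simp add: compact_imp_bounded)
    moreover have "range g \<subseteq> insert 0 (g ` cball 0 r)"
      using windowed_support[OF that r] by fastforce
    ultimately show ?thesis by (rule bounded_subset)
  qed
  have "bounded {x. f x \<noteq> 0}"
    by (rule boundedI[of _ r]) (use windowed_support[OF f r] in auto)
  then show ?thesis
    using diff cont bdd windowed_dpart[OF f] by (auto simp: test_fun_def Ck_bdd_def)
qed

text \<open>Test functions in the weak equation are real, so an identity for characters has to be
  assembled from its cosine and sine parts.\<close>

lemma integral_mult_cis:
  fixes h :: "'a::euclidean_space \<Rightarrow> real"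
  assumes h: "integrable lborel h"
  shows "(\<integral>x. complex_of_real (h x) * cis (- (x \<bullet> \<zeta>)) \<partial>lborel)
     = complex_of_real (\<integral>x. h x * cos (x \<bullet> \<zeta>) \<partial>lborel) - \<i> * of_real (\<integral>x. h x * sin (x \<bullet> \<zeta>) \<partial>lborel)"
proof -
  have I: "integrable lborel (\<lambda>x. complex_of_real (h x) * cis (- (x \<bullet> \<zeta>)))"
    using h by (intro integrable_mult_cis) auto
  show ?thesis
    by (rule complex_eqI) (simp_all add: integral_Re[OF I, symmetric] integral_Im[OF I, symmetric])
qed

lemma window_bump_zero:
  fixes x :: "'a::euclidean_space"
  assumes "r > 0" "norm x > r"
  shows "bump j (window r x) = 0"
proof -
  have "r\<^sup>2 < (norm x)\<^sup>2" using assms by (intro power_strict_mono) auto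
  then show ?thesis using assms by (simp add: bump_def window_def power2_norm_eq_inner)
qed

text \<open>Outside the ball both left-hand sides vanish. Inside, \<open>bump 0\<close> is at most
  1, while \<open>(x \<bullet> x) / r\<^sup>2 \<le> 1\<close> and \<open>bump 2\<close> is at most
  \<open>2 ^ 2\<close>, which makes 8. That second bound does not depend on \<open>r\<close>: the
  drift acting on the cutoff stays dominated as \<open>r\<close> grows.\<close>

lemma window_bump_le:
  fixes x :: "'a::euclidean_space"
  assumes r: "r > 0"
  shows "norm x * bump 0 (window r x) \<le> r"
    and "2 * (x \<bullet> x) / r\<^sup>2 * bump 2 (window r x) \<le> 8"
proof -
  show "norm x * bump 0 (window r x) \<le> r"
  proof (cases "norm x > r")
    case False
    have "norm x * bump 0 (window r x) \<le> r * 1"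
      using False r bump_le[of 0] bump_nonneg[of 0] by (intro mult_mono) auto
    then show ?thesis by simp
  next
    case True
    then show ?thesis using window_bump_zero[OF r True, of 0] r by simp
  qed
  show "2 * (x \<bullet> x) / r\<^sup>2 * bump 2 (window r x) \<le> 8"
  proof (cases "norm x > r")
    case False
    have "(x \<bullet> x) / r\<^sup>2 \<le> 1" using False r by (simp add: power2_norm_eq_inner[symmetric] power_mono)
    then have "(x \<bullet> x) / r\<^sup>2 * bump 2 (window r x) \<le> 1 * 4"
      using bump_le[of 2] bump_nonneg[of 2] by (intro mult_mono) auto
    then show ?thesis by simp
  next
    case True
    then show ?thesis using window_bump_zero[OF r True, of 2] by simp
  qed
qed

text \<open>The weak equation tested against \<open>bump 0 (window r x) * cis (- (x \<bullet> \<zeta>))\<close>.\<close>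

lemma equilibrium_tested_cis:
  fixes J :: "real \<Rightarrow> 'a::euclidean_space \<Rightarrow> real" and F :: "'a \<Rightarrow> real"
  assumes eq: "equilibrium J s \<epsilon> F" and r: "r > 0"
    and V: "integrable lborel V" "\<And>x. V x = conv (rescale \<epsilon> (J s)) F x - F x"
  shows "(\<integral>x. (- \<i> * of_real (x \<bullet> \<zeta>)) * of_real (F x * bump 0 (window r x)) * cis (- (x \<bullet> \<zeta>)) \<partial>lborel)
    = complex_of_real (\<epsilon> powr (- 2 * s)) * (\<integral>x. complex_of_real (V x * bump 0 (window r x)) * cis (- (x \<bullet> \<zeta>)) \<partial>lborel)
      + (\<integral>x. complex_of_real (F x * (2 * (x \<bullet> x) / r\<^sup>2 * bump 2 (window r x))) * cis (- (x \<bullet> \<zeta>)) \<partial>lborel)"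
proof -
  have F: "integrable lborel F" using eq by (auto simp: equilibrium_def prob_density_def)
  have [measurable]: "F \<in> borel_measurable borel" "V \<in> borel_measurable borel"
    using borel_measurable_integrable[OF F] borel_measurable_integrable[OF V(1)] by auto
  \<comment> \<open>\<open>h2\<close> is the nonlocal term; the drift produces \<open>h1\<close>
    when the derivative falls on the character and \<open>h3\<close> when it falls on the
    cutoff.\<close>
  define h1 where "h1 x = F x * (bump 0 (window r x) * (x \<bullet> \<zeta>))" for x
  define h2 where "h2 x = V x * bump 0 (window r x)" for x
  define h3 where "h3 x = F x * (2 * (x \<bullet> x) / r\<^sup>2 * bump 2 (window r x))" for x
  have I2: "integrable lborel h2"
  proof (rule Bochner_Integration.integrable_bound[OF V(1)])
    show "AE x in lborel. norm (h2 x) \<le> norm (V x)"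
      using bump_le[of 0] bump_nonneg[of 0] by (intro AE_I2) (simp add: h2_def abs_mult mult_left_le)
  qed (simp add: h2_def[abs_def])
  have I1: "integrable lborel h1"
  proof (rule Bochner_Integration.integrable_bound[OF integrable_mult_right[OF F, of "r * norm \<zeta>"]])
    show "AE x in lborel. norm (h1 x) \<le> norm (r * norm \<zeta> * F x)"
    proof (rule AE_I2)
      fix x :: 'a
      have "bump 0 (window r x) * \<bar>x \<bullet> \<zeta>\<bar> \<le> bump 0 (window r x) * (norm x * norm \<zeta>)"
        by (intro mult_left_mono Cauchy_Schwarz_ineq2 bump_nonneg)
      also have "\<dots> \<le> r * norm \<zeta>"
        using mult_right_mono[OF window_bump_le(1)[OF r, of x], of "norm \<zeta>"] by (simp add: mult_ac)
      finally have "bump 0 (window r x) * \<bar>x \<bullet> \<zeta>\<bar> \<le> r * norm \<zeta>" .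
      then show "norm (h1 x) \<le> norm (r * norm \<zeta> * F x)"
        using r bump_nonneg[of 0] by (simp add: h1_def abs_mult mult.commute[of _ "\<bar>F x\<bar>"] mult_left_mono)
    qed
  qed (simp add: h1_def[abs_def])
  have I3: "integrable lborel h3"
  proof (rule Bochner_Integration.integrable_bound[OF integrable_mult_right[OF F, of 8]])
    show "AE x in lborel. norm (h3 x) \<le> norm (8 * F x)"
    proof (rule AE_I2)
      fix x :: 'a
      have "\<bar>F x\<bar> * (2 * (x \<bullet> x) / r\<^sup>2 * bump 2 (window r x)) \<le> \<bar>F x\<bar> * 8"
        by (intro mult_left_mono window_bump_le(2) r) auto
      then show "norm (h3 x) \<le> norm (8 * F x)"
        using bump_nonneg[of 2] by (simp add: h3_def abs_mult)
    qed
  qed (simp add: h3_def[abs_def])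
  have bd: "integrable lborel (\<lambda>x. h x * p x)" if "integrable lborel h" "p \<in> borel_measurable borel" "\<And>x. \<bar>p x\<bar> \<le> 1" for h p :: "'a \<Rightarrow> real"
    by (rule Bochner_Integration.integrable_bound[OF that(1)])
      (use that borel_measurable_integrable[OF that(1)] in \<open>auto simp: abs_mult intro!: AE_I2 mult_left_le\<close>)
  \<comment> \<open>Keeping a phase treats both parts at once: \<open>\<theta> = 0\<close> gives
    \<open>w0\<close> and \<open>\<theta> = - (pi / 2)\<close> gives \<open>w1\<close>, the two real
    equations behind the complex one.\<close>
  have weak: "\<epsilon> powr (- 2 * s) * (\<integral>x. h2 x * cos (x \<bullet> \<zeta> + \<theta>) \<partial>lborel)
     + (\<integral>x. h3 x * cos (x \<bullet> \<zeta> + \<theta>) \<partial>lborel) + (\<integral>x. h1 x * sin (x \<bullet> \<zeta> + \<theta>) \<partial>lborel) = 0" for \<theta>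
  proof -
    let ?\<phi> = "\<lambda>x. bump 0 (window r x) * cos (x \<bullet> \<zeta> + \<theta>)"
    have "test_fun ?\<phi>" by (rule test_fun_windowed[OF windowed_base r])
    with eq have *: "\<epsilon> powr (- 2 * s) * (\<integral>x. V x * ?\<phi> x \<partial>lborel) - (\<integral>x. F x * frechet_derivative ?\<phi> (at x) x \<partial>lborel) = 0"
      by (simp add: equilibrium_def V(2))
    have "F x * frechet_derivative ?\<phi> (at x) x = - (h3 x * cos (x \<bullet> \<zeta> + \<theta>)) - h1 x * sin (x \<bullet> \<zeta> + \<theta>)" for x
      using frechet_derivative_at[OF window_derivative[of 0 r \<zeta> \<theta> x], symmetric]
      by (simp add: h1_def h3_def algebra_simps numeral_2_eq_2)
    moreover have "(\<lambda>x. V x * ?\<phi> x) = (\<lambda>x. h2 x * cos (x \<bullet> \<zeta> + \<theta>))" by (simp add: h2_def fun_eq_iff)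
    moreover have "(\<integral>x. - (h3 x * cos (x \<bullet> \<zeta> + \<theta>)) - h1 x * sin (x \<bullet> \<zeta> + \<theta>) \<partial>lborel)
       = - (\<integral>x. h3 x * cos (x \<bullet> \<zeta> + \<theta>) \<partial>lborel) - (\<integral>x. h1 x * sin (x \<bullet> \<zeta> + \<theta>) \<partial>lborel)"
      by (subst Bochner_Integration.integral_diff) (auto intro!: bd I1 I3)
    ultimately show ?thesis using * by (simp only:)
  qed
  have c: "cos (y - pi / 2) = sin y" "sin (y - pi / 2) = - cos y" for y :: real
    by (simp_all add: cos_diff sin_diff)
  have w0: "\<epsilon> powr (- 2 * s) * (\<integral>x. h2 x * cos (x \<bullet> \<zeta>) \<partial>lborel)
     + (\<integral>x. h3 x * cos (x \<bullet> \<zeta>) \<partial>lborel) + (\<integral>x. h1 x * sin (x \<bullet> \<zeta>) \<partial>lborel) = 0"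
    using weak[of 0] by simp
  have w1: "\<epsilon> powr (- 2 * s) * (\<integral>x. h2 x * sin (x \<bullet> \<zeta>) \<partial>lborel)
     + (\<integral>x. h3 x * sin (x \<bullet> \<zeta>) \<partial>lborel) - (\<integral>x. h1 x * cos (x \<bullet> \<zeta>) \<partial>lborel) = 0"
    using weak[of "- (pi / 2)"] by (simp add: c)
  have "(\<integral>x. (- \<i> * of_real (x \<bullet> \<zeta>)) * of_real (F x * bump 0 (window r x)) * cis (- (x \<bullet> \<zeta>)) \<partial>lborel)
     = - \<i> * (\<integral>x. complex_of_real (h1 x) * cis (- (x \<bullet> \<zeta>)) \<partial>lborel)"
    by (subst integral_mult_right_zero[symmetric]) (simp add: h1_def mult_ac)
  also have "\<dots> = complex_of_real (\<epsilon> powr (- 2 * s)) * (\<integral>x. complex_of_real (h2 x) * cis (- (x \<bullet> \<zeta>)) \<partial>lborel)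
      + (\<integral>x. complex_of_real (h3 x) * cis (- (x \<bullet> \<zeta>)) \<partial>lborel)"
    unfolding integral_mult_cis[OF I1] integral_mult_cis[OF I2] integral_mult_cis[OF I3]
    using w0 w1 by (intro complex_eqI) (simp_all add: algebra_simps)
  finally show ?thesis unfolding h2_def h3_def .
qed

section \<open>The equilibrium equation on rays\<close>

lemma
  fixes K :: "'a::euclidean_space \<Rightarrow> real"
  assumes K: "integrable lborel K" and \<epsilon>: "\<epsilon> > 0"
  shows rescale_integrable: "integrable lborel (rescale \<epsilon> K)"
    and fourier_rescale: "fourier (rescale \<epsilon> K) \<xi> = fourier K (\<epsilon> *\<^sub>R \<xi>)"
proof -
  have "integrable lborel (\<lambda>x. K (0 + (1 / \<epsilon>) *\<^sub>R x))"
    using K \<epsilon> by (intro lborel_integrable_affine) auto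
  then show "integrable lborel (rescale \<epsilon> K)"
    unfolding rescale_def[abs_def] by (simp add: inverse_eq_divide)
  have "fourier (rescale \<epsilon> K) \<xi> = \<bar>\<epsilon>\<bar> ^ DIM('a) *\<^sub>R (\<integral>x. cis (- ((0 + \<epsilon> *\<^sub>R x) \<bullet> \<xi>)) * of_real (rescale \<epsilon> K (0 + \<epsilon> *\<^sub>R x)) \<partial>lborel)"
    unfolding fourier_def by (rule lborel_integral_affine) (use \<epsilon> in auto)
  also have "\<dots> = (\<integral>x. \<bar>\<epsilon>\<bar> ^ DIM('a) *\<^sub>R (cis (- ((0 + \<epsilon> *\<^sub>R x) \<bullet> \<xi>)) * of_real (rescale \<epsilon> K (0 + \<epsilon> *\<^sub>R x))) \<partial>lborel)"
    by (rule integral_scaleR_right[symmetric])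
  also have "\<dots> = fourier K (\<epsilon> *\<^sub>R \<xi>)"
    unfolding fourier_def using \<epsilon>
    by (intro Bochner_Integration.integral_cong)
      (simp_all add: rescale_def powr_minus powr_realpow scaleR_conv_of_real)
  finally show "fourier (rescale \<epsilon> K) \<xi> = fourier K (\<epsilon> *\<^sub>R \<xi>)" .
qed

lemma
  fixes K f :: "'a::euclidean_space \<Rightarrow> real"
  assumes K: "integrable lborel K" and f: "integrable lborel f"
  shows conv_integrable: "integrable lborel (conv K f)"
    and fourier_conv: "fourier (conv K f) \<xi> = fourier K \<xi> * fourier f \<xi>"
proof -
  have [measurable]: "K \<in> borel_measurable borel" "f \<in> borel_measurable borel"
    using borel_measurable_integrable[OF K] borel_measurable_integrable[OF f] by auto
  have J: "integrable lborel (\<lambda>x. K (x - y))" for y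
    using lborel_integrable_translate[OF K, of "- y"] by simp
  have I: "integrable (lborel \<Otimes>\<^sub>M lborel) (\<lambda>(y, x). K (x - y) * f y)"
  proof (rule lborel_pair.Fubini_integrable)
    show "(\<lambda>(y, x). K (x - y) * f y) \<in> borel_measurable (lborel \<Otimes>\<^sub>M lborel)" by measurable
    have "(\<integral>x. \<bar>K (x - y)\<bar> \<partial>lborel) = (\<integral>x. \<bar>K x\<bar> \<partial>lborel)" for y
      using lborel_integral_translate[of "\<lambda>x. \<bar>K x\<bar>" "- y"] by simp
    then show "integrable lborel (\<lambda>y. \<integral>x. norm (case (y, x) of (y, x) \<Rightarrow> K (x - y) * f y) \<partial>lborel)"
      using f by (simp add: abs_mult)
    show "AE y in lborel. integrable lborel (\<lambda>x. case (y, x) of (y, x) \<Rightarrow> K (x - y) * f y)"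
      using J by simp
  qed
  show "integrable lborel (conv K f)"
    unfolding conv_def[abs_def] by (rule lborel_pair.integrable_snd[OF I])
  have I': "integrable (lborel \<Otimes>\<^sub>M lborel) (\<lambda>(y, x). cis (- (x \<bullet> \<xi>)) * of_real (K (x - y) * f y))"
    by (rule Bochner_Integration.integrable_bound[OF I]) (auto simp: norm_mult abs_mult)
  have "fourier (conv K f) \<xi> = (\<integral>x. (\<integral>y. cis (- (x \<bullet> \<xi>)) * of_real (K (x - y) * f y) \<partial>lborel) \<partial>lborel)"
    unfolding fourier_def conv_def by (simp only: integral_mult_right_zero integral_complex_of_real)
  also have "\<dots> = (\<integral>y. (\<integral>x. cis (- (x \<bullet> \<xi>)) * of_real (K (x - y) * f y) \<partial>lborel) \<partial>lborel)"
    by (rule lborel_pair.Fubini_integral[OF I'])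
  also have "\<dots> = (\<integral>y. fourier K \<xi> * (cis (- (y \<bullet> \<xi>)) * of_real (f y)) \<partial>lborel)"
  proof (rule Bochner_Integration.integral_cong[OF refl])
    fix y :: 'a
    have "(\<integral>x. cis (- (x \<bullet> \<xi>)) * of_real (K (x - y) * f y) \<partial>lborel)
       = (\<integral>x. cis (- ((y + x) \<bullet> \<xi>)) * of_real (K ((y + x) - y) * f y) \<partial>lborel)"
      by (rule lborel_integral_translate[symmetric])
    also have "\<dots> = (\<integral>x. (cis (- (y \<bullet> \<xi>)) * of_real (f y)) * (cis (- (x \<bullet> \<xi>)) * of_real (K x)) \<partial>lborel)"
    proof (rule Bochner_Integration.integral_cong[OF refl])
      fix x :: 'a
      have "cis (- ((y + x) \<bullet> \<xi>)) = cis (- (y \<bullet> \<xi>)) * cis (- (x \<bullet> \<xi>))"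
        by (simp add: cis_mult inner_add_left)
      then show "cis (- ((y + x) \<bullet> \<xi>)) * of_real (K ((y + x) - y) * f y)
        = (cis (- (y \<bullet> \<xi>)) * of_real (f y)) * (cis (- (x \<bullet> \<xi>)) * of_real (K x))"
        by simp
    qed
    also have "\<dots> = fourier K \<xi> * (cis (- (y \<bullet> \<xi>)) * of_real (f y))"
      unfolding fourier_def by (subst integral_mult_right_zero) (rule mult.commute)
    finally show "(\<integral>x. cis (- (x \<bullet> \<xi>)) * of_real (K (x - y) * f y) \<partial>lborel) = fourier K \<xi> * (cis (- (y \<bullet> \<xi>)) * of_real (f y))" .
  qed
  also have "\<dots> = fourier K \<xi> * fourier f \<xi>"
    unfolding fourier_def by (simp only: integral_mult_right_zero)
  finally show "fourier (conv K f) \<xi> = fourier K \<xi> * fourier f \<xi>" .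
qed

lemma fourier_diff:
  fixes f g :: "'a::euclidean_space \<Rightarrow> real"
  assumes "integrable lborel f" "integrable lborel g"
  shows "fourier (\<lambda>x. f x - g x) \<xi> = fourier f \<xi> - fourier g \<xi>"
  unfolding fourier_def using assms by (simp add: right_diff_distrib integrable_cis_mult)

text \<open>The cutoff converges to \<open>bump 0 1 = exp (- 1)\<close> rather than to 1. The
  constant multiplies every surviving term of the limit equation and is divided out at the end of
  \<open>equilibrium_radial_equation\<close>.\<close>

lemma window_tendsto:
  "(\<lambda>n. bump 0 (window (real (Suc n)) x)) \<longlonglongrightarrow> bump 0 1"
  "(\<lambda>n. 2 * (x \<bullet> x) / (real (Suc n))\<^sup>2 * bump 2 (window (real (Suc n)) x)) \<longlonglongrightarrow> 0"
proof -
  have inv: "(\<lambda>n. (x \<bullet> x) / (real (Suc n))\<^sup>2) \<longlonglongrightarrow> 0"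
    using tendsto_mult[OF tendsto_const[of "x \<bullet> x"] tendsto_power[OF LIMSEQ_inverse_real_of_nat, of 2]]
    by (simp add: divide_inverse power_inverse)
  have w: "(\<lambda>n. window (real (Suc n)) x) \<longlonglongrightarrow> 1"
    unfolding window_def using tendsto_diff[OF tendsto_const[of 1] inv] by simp
  have c: "isCont (bump j) t" for j t using bump_deriv DERIV_isCont by blast
  show "(\<lambda>n. bump 0 (window (real (Suc n)) x)) \<longlonglongrightarrow> bump 0 1"
    by (rule isCont_tendsto_compose[OF c w])
  have "(\<lambda>n. 2 * ((x \<bullet> x) / (real (Suc n))\<^sup>2) * bump 2 (window (real (Suc n)) x)) \<longlonglongrightarrow> 2 * 0 * bump 2 1"
    by (intro tendsto_mult tendsto_const inv isCont_tendsto_compose[OF c w])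
  then show "(\<lambda>n. 2 * (x \<bullet> x) / (real (Suc n))\<^sup>2 * bump 2 (window (real (Suc n)) x)) \<longlonglongrightarrow> 0"
    by simp
qed

text \<open>The drift term is \<open>t\<close> times the derivative along the ray \<open>t \<xi>\<close>, so integrating in \<open>t\<close>
  before removing the cutoff avoids any moment assumption on \<open>F\<close>.\<close>

lemma equilibrium_radial_equation:
  fixes J :: "real \<Rightarrow> 'a::euclidean_space \<Rightarrow> real" and F :: "'a \<Rightarrow> real"
  assumes eq: "equilibrium J s \<epsilon> F" and K: "integrable lborel (J s)" and \<epsilon>: "\<epsilon> > 0" and ab: "0 < a" "a \<le> b"
  shows "((\<lambda>t. complex_of_real (\<epsilon> powr (- 2 * s) / t) * ((fourier (J s) ((\<epsilon> * t) *\<^sub>R \<xi>) - 1) * fourier F (t *\<^sub>R \<xi>)))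
     has_integral (fourier F (b *\<^sub>R \<xi>) - fourier F (a *\<^sub>R \<xi>))) {a..b}"
proof -
  let ?N = "\<epsilon> powr (- 2 * s)"
  have F: "integrable lborel F" using eq by (auto simp: equilibrium_def prob_density_def)
  define V where "V x = conv (rescale \<epsilon> (J s)) F x - F x" for x
  have V: "integrable lborel V" unfolding V_def using conv_integrable[OF rescale_integrable[OF K \<epsilon>] F] F by simp
  have fV: "fourier V (t *\<^sub>R \<xi>) = (fourier (J s) ((\<epsilon> * t) *\<^sub>R \<xi>) - 1) * fourier F (t *\<^sub>R \<xi>)" for t
    unfolding V_def[abs_def] using conv_integrable[OF rescale_integrable[OF K \<epsilon>] F] F
    by (simp add: fourier_diff fourier_conv[OF rescale_integrable[OF K \<epsilon>] F] fourier_rescale[OF K \<epsilon>] algebra_simps)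
  have [measurable]: "F \<in> borel_measurable borel" "V \<in> borel_measurable borel"
    using borel_measurable_integrable[OF F] borel_measurable_integrable[OF V] by auto
  define r where "r n = real (Suc n)" for n
  have r: "r n > 0" for n by (simp add: r_def)
  define A where "A n x = complex_of_real (F x * bump 0 (window (r n) x))" for n x
  define k where "k n t = (\<integral>x. A n x * cis (- (x \<bullet> (t *\<^sub>R \<xi>))) \<partial>lborel)" for n t
  define P1 where "P1 n t = (\<integral>x. complex_of_real (V x * bump 0 (window (r n) x)) * cis (- (x \<bullet> (t *\<^sub>R \<xi>))) \<partial>lborel)" for n t
  define P2 where "P2 n t = (\<integral>x. complex_of_real (F x * (2 * (x \<bullet> x) / (r n)\<^sup>2 * bump 2 (window (r n) x))) * cis (- (x \<bullet> (t *\<^sub>R \<xi>))) \<partial>lborel)" for n t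
  define P where "P n t = complex_of_real ?N * P1 n t + P2 n t" for n t
  have P2b: "norm (complex_of_real (F x * (2 * (x \<bullet> x) / (r n)\<^sup>2 * bump 2 (window (r n) x))) * cis (- (x \<bullet> (t *\<^sub>R \<xi>)))) \<le> 8 * \<bar>F x\<bar>" for n t x
  proof -
    have "\<bar>F x\<bar> * (2 * (x \<bullet> x) / (r n)\<^sup>2 * bump 2 (window (r n) x)) \<le> \<bar>F x\<bar> * 8"
      by (intro mult_left_mono window_bump_le(2) r) auto
    then show ?thesis
      using bump_nonneg[of 2] by (simp add: norm_mult abs_mult norm_divide norm_power)
  qed
  have AI: "integrable lborel (A n)" for n
    by (rule Bochner_Integration.integrable_bound[OF F])
      (use bump_le[of 0] bump_nonneg[of 0] in \<open>auto simp: A_def[abs_def] norm_mult intro!: AE_I2 mult_left_le\<close>)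
  have AI1: "integrable lborel (\<lambda>x. norm x * norm (A n x))" for n
  proof (rule Bochner_Integration.integrable_bound[OF integrable_mult_right[OF F, of "r n"]])
    show "AE x in lborel. norm (norm x * norm (A n x)) \<le> norm (r n * F x)"
    proof (rule AE_I2)
      fix x :: 'a
      have "(norm x * bump 0 (window (r n) x)) * \<bar>F x\<bar> \<le> r n * \<bar>F x\<bar>"
        by (intro mult_right_mono window_bump_le(1) r) auto
      then show "norm (norm x * norm (A n x)) \<le> norm (r n * F x)"
        using r[of n] bump_nonneg[of 0] by (simp add: A_def norm_mult abs_mult mult_ac)
    qed
  qed (simp add: A_def[abs_def])
  \<comment> \<open>The cutoff supplies the first moment \<open>AI1\<close> of the truncated
    density, so differentiation along the ray is legitimate for each \<open>n\<close>, and the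
    tested equation identifies the derivative.\<close>
  have kd: "(k n has_vector_derivative P n t / complex_of_real t) (at t)" if "t > 0" for n t
  proof -
    have "((\<lambda>t. \<integral>x. A n x * cis ((0 + t *\<^sub>R (- \<xi>)) \<bullet> x) \<partial>lborel) has_vector_derivative
       (\<integral>x. (\<i> * of_real ((- \<xi>) \<bullet> x) * A n x) * cis ((0 + t *\<^sub>R (- \<xi>)) \<bullet> x) \<partial>lborel)) (at t)"
      by (rule has_vector_derivative_line[OF has_derivative_cis_integral[OF AI AI1]])
    moreover have "(\<lambda>t. \<integral>x. A n x * cis ((0 + t *\<^sub>R (- \<xi>)) \<bullet> x) \<partial>lborel) = k n"
      by (simp add: k_def[abs_def] inner_commute)
    moreover have "(\<integral>x. (\<i> * of_real ((- \<xi>) \<bullet> x) * A n x) * cis ((0 + t *\<^sub>R (- \<xi>)) \<bullet> x) \<partial>lborel) = P n t / complex_of_real t"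
    proof -
      have "P n t = (\<integral>x. (- \<i> * of_real (x \<bullet> (t *\<^sub>R \<xi>))) * of_real (F x * bump 0 (window (r n) x)) * cis (- (x \<bullet> (t *\<^sub>R \<xi>))) \<partial>lborel)"
        unfolding P_def P1_def P2_def
        by (rule equilibrium_tested_cis[OF eq r V, symmetric]) (simp add: V_def)
      also have "\<dots> = (\<integral>x. complex_of_real t * ((\<i> * of_real ((- \<xi>) \<bullet> x) * A n x) * cis ((0 + t *\<^sub>R (- \<xi>)) \<bullet> x)) \<partial>lborel)"
        by (intro Bochner_Integration.integral_cong) (simp_all add: A_def inner_commute)
      finally show ?thesis using that by simp
    qed
    ultimately show ?thesis by simp
  qed
  have fin: "((\<lambda>t. P n t / complex_of_real t) has_integral k n b - k n a) {a..b}" for n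
    by (rule fundamental_theorem_of_calculus[OF ab(2)]) (use ab in \<open>auto intro: has_vector_derivative_at_within[OF kd]\<close>)
  \<comment> \<open>Independent of \<open>n\<close> and \<open>t\<close>. On \<open>{a..b}\<close>
    the quotient is then bounded by \<open>B / a\<close>, which permits the limit under the integral
    and is where \<open>a > 0\<close> matters.\<close>
  define B where "B = ?N * (\<integral>x. \<bar>V x\<bar> \<partial>lborel) + 8 * (\<integral>x. \<bar>F x\<bar> \<partial>lborel)"
  have "B \<ge> 0" by (simp add: B_def)
  have PB: "norm (P n t) \<le> B" for n t
  proof -
    have "norm (P1 n t) \<le> (\<integral>x. \<bar>V x\<bar> \<partial>lborel)"
      unfolding P1_def using V bump_le[of 0] bump_nonneg[of 0]
      by (intro order_trans[OF integral_norm_bound integral_mono_AE'] AE_I2) (auto simp: norm_mult abs_mult mult_left_le)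
    moreover have "norm (P2 n t) \<le> (\<integral>x. 8 * \<bar>F x\<bar> \<partial>lborel)"
      unfolding P2_def
      by (intro order_trans[OF integral_norm_bound integral_mono_AE'] AE_I2 P2b) (use F in auto)
    ultimately show ?thesis
      unfolding P_def B_def
      by (intro order_trans[OF norm_triangle_ineq] add_mono) (auto simp: norm_mult mult_left_mono)
  qed
  have Plim: "(\<lambda>n. P n t) \<longlonglongrightarrow> complex_of_real (?N * bump 0 1) * fourier V (t *\<^sub>R \<xi>)" for t
  proof -
    have "(\<lambda>n. P1 n t) \<longlonglongrightarrow> (\<integral>x. complex_of_real (V x * bump 0 1) * cis (- (x \<bullet> (t *\<^sub>R \<xi>))) \<partial>lborel)"
      unfolding P1_def
    proof (rule integral_dominated_convergence[where w="\<lambda>x. \<bar>V x\<bar>"])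
      show "AE x in lborel. (\<lambda>n. complex_of_real (V x * bump 0 (window (r n) x)) * cis (- (x \<bullet> (t *\<^sub>R \<xi>)))) \<longlonglongrightarrow> complex_of_real (V x * bump 0 1) * cis (- (x \<bullet> (t *\<^sub>R \<xi>)))"
        unfolding r_def by (intro AE_I2 tendsto_intros window_tendsto)
      show "AE x in lborel. norm (complex_of_real (V x * bump 0 (window (r n) x)) * cis (- (x \<bullet> (t *\<^sub>R \<xi>)))) \<le> \<bar>V x\<bar>" for n
        using bump_le[of 0] bump_nonneg[of 0] by (intro AE_I2) (auto simp: norm_mult abs_mult mult_left_le)
    qed (use V in auto)
    also have "(\<integral>x. complex_of_real (V x * bump 0 1) * cis (- (x \<bullet> (t *\<^sub>R \<xi>))) \<partial>lborel) = complex_of_real (bump 0 1) * fourier V (t *\<^sub>R \<xi>)"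
      unfolding fourier_def by (subst integral_mult_right_zero[symmetric]) (simp add: mult_ac)
    finally have 1: "(\<lambda>n. P1 n t) \<longlonglongrightarrow> complex_of_real (bump 0 1) * fourier V (t *\<^sub>R \<xi>)" .
    have "(\<lambda>n. P2 n t) \<longlonglongrightarrow> (\<integral>x. 0 \<partial>(lborel :: 'a measure))"
      unfolding P2_def
    proof (rule integral_dominated_convergence[where w="\<lambda>x. 8 * \<bar>F x\<bar>"])
      show "AE x in lborel. (\<lambda>n. complex_of_real (F x * (2 * (x \<bullet> x) / (r n)\<^sup>2 * bump 2 (window (r n) x))) * cis (- (x \<bullet> (t *\<^sub>R \<xi>)))) \<longlonglongrightarrow> 0"
      proof (rule AE_I2)
        fix x :: 'a
        have "(\<lambda>n. complex_of_real (F x * (2 * (x \<bullet> x) / (r n)\<^sup>2 * bump 2 (window (r n) x))) * cis (- (x \<bullet> (t *\<^sub>R \<xi>)))) \<longlonglongrightarrow> complex_of_real (F x * 0) * cis (- (x \<bullet> (t *\<^sub>R \<xi>)))"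
          unfolding r_def by (intro tendsto_mult tendsto_of_real tendsto_const window_tendsto)
        then show "(\<lambda>n. complex_of_real (F x * (2 * (x \<bullet> x) / (r n)\<^sup>2 * bump 2 (window (r n) x))) * cis (- (x \<bullet> (t *\<^sub>R \<xi>)))) \<longlonglongrightarrow> 0" by simp
      qed
      show "AE x in lborel. norm (complex_of_real (F x * (2 * (x \<bullet> x) / (r n)\<^sup>2 * bump 2 (window (r n) x))) * cis (- (x \<bullet> (t *\<^sub>R \<xi>)))) \<le> 8 * \<bar>F x\<bar>" for n
        by (intro AE_I2 P2b)
    qed (use F in auto)
    then have 2: "(\<lambda>n. P2 n t) \<longlonglongrightarrow> 0" by simp
    show ?thesis
      using tendsto_add[OF tendsto_mult[OF tendsto_const[of "complex_of_real ?N"] 1] 2]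
      by (simp add: P_def mult.assoc)
  qed
  have klim: "(\<lambda>n. k n t) \<longlonglongrightarrow> complex_of_real (bump 0 1) * fourier F (t *\<^sub>R \<xi>)" for t
  proof -
    have "(\<lambda>n. k n t) \<longlonglongrightarrow> (\<integral>x. complex_of_real (F x * bump 0 1) * cis (- (x \<bullet> (t *\<^sub>R \<xi>))) \<partial>lborel)"
      unfolding k_def A_def
    proof (rule integral_dominated_convergence[where w="\<lambda>x. \<bar>F x\<bar>"])
      show "AE x in lborel. (\<lambda>n. complex_of_real (F x * bump 0 (window (r n) x)) * cis (- (x \<bullet> (t *\<^sub>R \<xi>)))) \<longlonglongrightarrow> complex_of_real (F x * bump 0 1) * cis (- (x \<bullet> (t *\<^sub>R \<xi>)))"
        unfolding r_def by (intro AE_I2 tendsto_intros window_tendsto)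
      show "AE x in lborel. norm (complex_of_real (F x * bump 0 (window (r n) x)) * cis (- (x \<bullet> (t *\<^sub>R \<xi>)))) \<le> \<bar>F x\<bar>" for n
        using bump_le[of 0] bump_nonneg[of 0] by (intro AE_I2) (auto simp: norm_mult abs_mult mult_left_le)
    qed (use F in auto)
    also have "(\<integral>x. complex_of_real (F x * bump 0 1) * cis (- (x \<bullet> (t *\<^sub>R \<xi>))) \<partial>lborel) = complex_of_real (bump 0 1) * fourier F (t *\<^sub>R \<xi>)"
      unfolding fourier_def by (subst integral_mult_right_zero[symmetric]) (simp add: mult_ac)
    finally show ?thesis .
  qed
  have "((\<lambda>t. complex_of_real (?N * bump 0 1) * fourier V (t *\<^sub>R \<xi>) / complex_of_real t) has_integral
     complex_of_real (bump 0 1) * fourier F (b *\<^sub>R \<xi>) - complex_of_real (bump 0 1) * fourier F (a *\<^sub>R \<xi>)) {a..b}"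
  proof (rule has_integral_dominated_convergence[OF fin])
    show "(\<lambda>t. B / a) integrable_on {a..b}" by (intro integrable_continuous_interval continuous_intros)
    show "\<forall>t\<in>{a..b}. norm (P n t / complex_of_real t) \<le> B / a" for n
      using PB \<open>B \<ge> 0\<close> ab by (auto simp: norm_divide intro!: frac_le)
    show "\<forall>t\<in>{a..b}. (\<lambda>n. P n t / complex_of_real t) \<longlonglongrightarrow> complex_of_real (?N * bump 0 1) * fourier V (t *\<^sub>R \<xi>) / complex_of_real t"
      using ab by (intro ballI tendsto_divide Plim tendsto_const) auto
    show "(\<lambda>n. k n b - k n a) \<longlonglongrightarrow> complex_of_real (bump 0 1) * fourier F (b *\<^sub>R \<xi>) - complex_of_real (bump 0 1) * fourier F (a *\<^sub>R \<xi>)"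
      by (intro tendsto_diff klim)
  qed
  from has_integral_mult_right[OF this, of "1 / complex_of_real (bump 0 1)"] show ?thesis
    unfolding fV by (simp add: bump_def diff_divide_distrib)
qed

section \<open>The Fourier transform of the equilibrium\<close>

lemma fourier_lipschitz:
  fixes K :: "'a::euclidean_space \<Rightarrow> real"
  assumes K: "integrable lborel K" and K1: "integrable lborel (\<lambda>x. norm x * \<bar>K x\<bar>)"
  shows "norm (fourier K \<xi> - fourier K \<eta>) \<le> (\<integral>x. norm x * \<bar>K x\<bar> \<partial>lborel) * norm (\<xi> - \<eta>)"
proof -
  have "fourier K \<xi> - fourier K \<eta> = (\<integral>x. (cis (- (x \<bullet> \<xi>)) - cis (- (x \<bullet> \<eta>))) * of_real (K x) \<partial>lborel)"
    unfolding fourier_def using K by (simp add: left_diff_distrib integrable_cis_mult)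
  also have "norm \<dots> \<le> (\<integral>x. norm (\<xi> - \<eta>) * (norm x * \<bar>K x\<bar>) \<partial>lborel)"
  proof (intro order_trans[OF integral_norm_bound integral_mono_AE'] AE_I2)
    fix x :: 'a
    have "norm (cis (- (x \<bullet> \<xi>)) - cis (- (x \<bullet> \<eta>))) \<le> \<bar>x \<bullet> (\<xi> - \<eta>)\<bar>"
      using norm_cis_diff_le_dist[of "- (x \<bullet> \<xi>)" "- (x \<bullet> \<eta>)"] by (simp add: inner_diff_right abs_minus_commute)
    also have "\<dots> \<le> norm x * norm (\<xi> - \<eta>)" by (rule Cauchy_Schwarz_ineq2)
    finally show "norm ((cis (- (x \<bullet> \<xi>)) - cis (- (x \<bullet> \<eta>))) * of_real (K x)) \<le> norm (\<xi> - \<eta>) * (norm x * \<bar>K x\<bar>)"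
      unfolding norm_mult norm_of_real mult.assoc[symmetric]
      by (intro mult_right_mono) (simp_all add: mult.commute)
  qed (use K1 in auto)
  finally show ?thesis by (simp add: mult.commute)
qed

text \<open>At \<open>t = 0\<close> the integrand has the junk value \<open>0\<close>, on a null set.\<close>

definition decay_exponent :: "('a::euclidean_space \<Rightarrow> real) \<Rightarrow> real \<Rightarrow> 'a \<Rightarrow> complex" where
  "decay_exponent K \<epsilon> \<xi> = integral {0..1} (\<lambda>t. (1 - fourier K ((\<epsilon> * t) *\<^sub>R \<xi>)) / complex_of_real t)"

text \<open>Collects what the study of the exponent uses of the kernel: unit mass fixes its
  transform at 0, and the first moment makes that transform Lipschitz.\<close>

locale finite_moment_density =
  fixes K :: "'a::euclidean_space \<Rightarrow> real" and \<epsilon> :: real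
  assumes density: "prob_density K" and moment: "integrable lborel (\<lambda>x. norm x * \<bar>K x\<bar>)" and eps: "\<epsilon> > 0"
begin

definition "M1 = (\<integral>x. norm x * \<bar>K x\<bar> \<partial>lborel)"

abbreviation "rate \<xi> t \<equiv> (1 - fourier K ((\<epsilon> * t) *\<^sub>R \<xi>)) / complex_of_real t"

lemma K_integrable: "integrable lborel K" using density by (simp add: prob_density_def)

lemma M1_nonneg: "0 \<le> M1" by (simp add: M1_def)

lemma lipschitz: "norm (fourier K \<xi> - fourier K \<eta>) \<le> M1 * norm (\<xi> - \<eta>)"
  unfolding M1_def by (rule fourier_lipschitz[OF K_integrable moment])

lemma fourier_zero: "fourier K 0 = 1"
  using density K_integrable by (simp add: fourier_def prob_density_def)

text \<open>The Lipschitz bound brings a factor \<open>t\<close> that cancels the denominator, so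
  the estimate is uniform in \<open>t\<close>. Taking \<open>\<eta> = 0\<close> shows that the
  singularity at \<open>t = 0\<close> is only apparent; integrating over \<open>t\<close> gives the
  Lipschitz constant of the exponent.\<close>

lemma norm_rate_diff_le:
  assumes "0 \<le> t"
  shows "norm (rate \<xi> t - rate \<eta> t) \<le> \<epsilon> * M1 * norm (\<xi> - \<eta>)"
proof (cases "t = 0")
  case False
  then have t: "t > 0" using assms by simp
  have "rate \<xi> t - rate \<eta> t = (fourier K ((\<epsilon> * t) *\<^sub>R \<eta>) - fourier K ((\<epsilon> * t) *\<^sub>R \<xi>)) / complex_of_real t"
    by (simp add: diff_divide_distrib)
  then have "norm (rate \<xi> t - rate \<eta> t) = norm (fourier K ((\<epsilon> * t) *\<^sub>R \<eta>) - fourier K ((\<epsilon> * t) *\<^sub>R \<xi>)) / t"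
    using t by (simp add: norm_divide)
  also have "\<dots> \<le> (M1 * norm ((\<epsilon> * t) *\<^sub>R \<eta> - (\<epsilon> * t) *\<^sub>R \<xi>)) / t"
    using t by (intro divide_right_mono lipschitz) auto
  also have "\<dots> = \<epsilon> * M1 * norm (\<xi> - \<eta>)"
    using t eps by (simp add: scaleR_diff_right[symmetric] norm_minus_commute del: scaleR_diff_right)
  finally show ?thesis .
qed (use M1_nonneg eps in simp)

lemma norm_rate_le: "0 \<le> t \<Longrightarrow> norm (rate \<xi> t) \<le> \<epsilon> * M1 * norm \<xi>"
  using norm_rate_diff_le[of t \<xi> 0] fourier_zero by simp

lemma rate_integrable: "rate \<xi> integrable_on {0..1}"
proof -
  note [measurable] = fourier_measurable[OF K_integrable]
  have "set_integrable lborel {0..1} (rate \<xi>)"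
    unfolding set_integrable_def
  proof (rule Bochner_Integration.integrable_bound[where f="\<lambda>t. indicator {0..1::real} t * (\<epsilon> * M1 * norm \<xi>)"])
    show "integrable lborel (\<lambda>t. indicator {0..1::real} t * (\<epsilon> * M1 * norm \<xi>))"
      by (simp add: integrable_indicator_iff)
    show "AE t in lborel. norm (indicator {0..1} t *\<^sub>R rate \<xi> t) \<le> norm (indicator {0..1::real} t * (\<epsilon> * M1 * norm \<xi>))"
      using norm_rate_le eps M1_nonneg by (intro AE_I2) (auto simp: indicator_def)
  qed measurable
  then show ?thesis by (rule set_borel_integral_eq_integral(1))
qed

lemma decay_exponent_lipschitz:
  "norm (decay_exponent K \<epsilon> \<xi> - decay_exponent K \<epsilon> \<eta>) \<le> \<epsilon> * M1 * norm (\<xi> - \<eta>)"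
proof -
  have "decay_exponent K \<epsilon> \<xi> - decay_exponent K \<epsilon> \<eta> = integral {0..1} (\<lambda>t. rate \<xi> t - rate \<eta> t)"
    unfolding decay_exponent_def by (rule Henstock_Kurzweil_Integration.integral_diff[symmetric]) (rule rate_integrable)+
  also have "norm \<dots> \<le> integral {0..1} (\<lambda>t::real. \<epsilon> * M1 * norm (\<xi> - \<eta>))"
  proof (rule integral_norm_bound_integral)
    show "(\<lambda>t. rate \<xi> t - rate \<eta> t) integrable_on {0..1}"
      by (rule Henstock_Kurzweil_Integration.integrable_diff) (rule rate_integrable)+
    show "norm (rate \<xi> t - rate \<eta> t) \<le> \<epsilon> * M1 * norm (\<xi> - \<eta>)" if "t \<in> {0..1}" for t
      using that by (intro norm_rate_diff_le) auto
  qed auto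
  finally show ?thesis by simp
qed

text \<open>The integral is split at \<open>c = R0 / (\<epsilon> * norm \<xi>)\<close>, where the
  argument of the kernel transform reaches norm \<open>R0\<close>. Below \<open>c\<close> the
  uniform bound on the rate contributes at most \<open>M1 * R0\<close>. Above \<open>c\<close> the
  rate is \<open>1 / t\<close> up to \<open>\<eta> / t\<close>, and \<open>1 / t\<close> integrates
  to the logarithm.\<close>

lemma Re_decay_exponent:
  assumes R0: "R0 > 0" and small: "\<And>\<zeta>. norm \<zeta> \<ge> R0 \<Longrightarrow> norm (fourier K \<zeta>) \<le> \<eta>"
    and \<xi>: "\<epsilon> * norm \<xi> \<ge> R0"
  shows "\<bar>Re (decay_exponent K \<epsilon> \<xi>) - ln (\<epsilon> * norm \<xi> / R0)\<bar> \<le> M1 * R0 + \<eta> * ln (\<epsilon> * norm \<xi> / R0)"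
proof -
  define c where "c = R0 / (\<epsilon> * norm \<xi>)"
  have n\<xi>: "norm \<xi> > 0" "\<epsilon> * norm \<xi> > 0" using \<xi> R0 eps by (auto simp: zero_less_mult_iff intro: ccontr)
  have c: "0 < c" "c \<le> 1" using n\<xi> \<xi> R0 by (simp_all add: c_def)
  have lnc: "ln (\<epsilon> * norm \<xi> / R0) = - ln c"
    using n\<xi> R0 by (simp add: c_def ln_div)
  have int: "rate \<xi> integrable_on {0..c}" "rate \<xi> integrable_on {c..1}"
    using c by (auto intro: integrable_on_subinterval[OF rate_integrable])
  have split: "decay_exponent K \<epsilon> \<xi> = integral {0..c} (rate \<xi>) + integral {c..1} (rate \<xi>)"
    unfolding decay_exponent_def
    by (rule Henstock_Kurzweil_Integration.integral_combine[symmetric]) (use c rate_integrable in auto)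
  have 1: "norm (integral {0..c} (rate \<xi>)) \<le> M1 * R0"
  proof -
    have "norm (integral {0..c} (rate \<xi>)) \<le> integral {0..c} (\<lambda>t::real. \<epsilon> * M1 * norm \<xi>)"
      by (rule integral_norm_bound_integral) (use int norm_rate_le in auto)
    also have "\<dots> = M1 * R0" using c n\<xi> eps by (simp add: c_def)
    finally show ?thesis .
  qed
  have inv: "((\<lambda>t. 1 / t) has_integral - ln c) {c..1}"
  proof -
    have "((\<lambda>t. 1 / t) has_integral ln 1 - ln c) {c..1}"
      by (rule fundamental_theorem_of_calculus)
        (use c in \<open>auto intro!: derivative_eq_intros simp: has_real_derivative_iff_has_vector_derivative[symmetric] divide_inverse\<close>)
    then show ?thesis by simp
  qed
  have inv': "((\<lambda>t. complex_of_real (1 / t)) has_integral complex_of_real (- ln c)) {c..1}"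
    using has_integral_of_real[OF inv] by (simp only: o_def)
  have 2: "norm (integral {c..1} (rate \<xi>) - complex_of_real (- ln c)) \<le> \<eta> * (- ln c)"
  proof -
    have "integral {c..1} (rate \<xi>) - complex_of_real (- ln c) = integral {c..1} (\<lambda>t. rate \<xi> t - complex_of_real (1 / t))"
      using Henstock_Kurzweil_Integration.integral_diff[OF int(2) has_integral_integrable[OF inv']] inv'
      by (simp only: integral_unique)
    also have "norm \<dots> \<le> integral {c..1} (\<lambda>t. \<eta> * (1 / t))"
    proof (rule integral_norm_bound_integral)
      show "(\<lambda>t. rate \<xi> t - complex_of_real (1 / t)) integrable_on {c..1}"
        by (intro Henstock_Kurzweil_Integration.integrable_diff int has_integral_integrable[OF inv'])
      show "(\<lambda>t. \<eta> * (1 / t)) integrable_on {c..1}"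
        by (rule has_integral_integrable[OF has_integral_mult_right[OF inv]])
      fix t assume t: "t \<in> {c..1}"
      then have "t > 0" using c by auto
      with t have "R0 \<le> norm ((\<epsilon> * t) *\<^sub>R \<xi>)"
        using c n\<xi> eps by (simp add: c_def abs_mult field_simps)
      then have "norm (fourier K ((\<epsilon> * t) *\<^sub>R \<xi>)) / t \<le> \<eta> / t"
        using t c by (intro divide_right_mono small) auto
      moreover have "rate \<xi> t - complex_of_real (1 / t) = - (fourier K ((\<epsilon> * t) *\<^sub>R \<xi>) / complex_of_real t)"
        by (simp add: diff_divide_distrib)
      ultimately show "norm (rate \<xi> t - complex_of_real (1 / t)) \<le> \<eta> * (1 / t)"
        using t c by (simp add: norm_divide)
    qed
    also have "\<dots> = \<eta> * (- ln c)"
      by (rule integral_unique[OF has_integral_mult_right[OF inv]])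
    finally show ?thesis .
  qed
  have "\<bar>Re (decay_exponent K \<epsilon> \<xi>) - (- ln c)\<bar> = \<bar>Re (integral {0..c} (rate \<xi>)) + Re (integral {c..1} (rate \<xi>) - complex_of_real (- ln c))\<bar>"
    by (simp add: split)
  also have "\<dots> \<le> norm (integral {0..c} (rate \<xi>)) + norm (integral {c..1} (rate \<xi>) - complex_of_real (- ln c))"
    by (intro order_trans[OF abs_triangle_ineq] add_mono abs_Re_le_cmod)
  also have "\<dots> \<le> M1 * R0 + \<eta> * (- ln c)" using 1 2 by simp
  finally show ?thesis by (simp only: lnc)
qed

end

text \<open>An integrating factor solves the equation along the ray. Its coefficient has a
  denominator \<open>t\<close>, so this is done on \<open>{a..1}\<close>; as \<open>a\<close> tends
  to 0 the exponent converges and the total mass of \<open>F\<close> fixes the constant.\<close>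

theorem equilibrium_fourier:
  fixes J :: "real \<Rightarrow> 'a::euclidean_space \<Rightarrow> real" and F :: "'a \<Rightarrow> real"
  assumes eq: "equilibrium J s \<epsilon> F" and J: "finite_moment_density (J s) \<epsilon>"
  shows "fourier F \<xi> = exp (- (complex_of_real (\<epsilon> powr (- 2 * s)) * decay_exponent (J s) \<epsilon> \<xi>))"
proof -
  interpret finite_moment_density "J s" \<epsilon> by (rule J)
  let ?N = "complex_of_real (\<epsilon> powr (- 2 * s))"
  have F: "integrable lborel F" and F1: "(\<integral>x. F x \<partial>lborel) = 1"
    using eq by (auto simp: equilibrium_def prob_density_def)
  define H where "H t = fourier F (t *\<^sub>R \<xi>)" for t
  have Hc: "continuous_on S H" for S
    unfolding H_def by (intro continuous_on_compose2[OF continuous_on_fourier[OF F]] continuous_intros) auto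
  have H0: "H 0 = 1" using F F1 by (simp add: H_def fourier_def)
  have rc: "continuous_on {a..1} (rate \<xi>)" if "a > 0" for a
    using that by (intro continuous_intros continuous_on_compose2[OF continuous_on_fourier[OF K_integrable]]) auto
  have ha: "H a = H 1 * exp (?N * integral {a..1} (rate \<xi>))" if a: "0 < a" "a \<le> 1" for a
  proof -
    define g where "g t = - (?N * rate \<xi> t * H t)" for t
    have hi: "(g has_integral (H t - H a)) {a..t}" if "a \<le> t" for t
    proof -
      have "complex_of_real (\<epsilon> powr (- 2 * s) / t) * ((fourier (J s) ((\<epsilon> * t) *\<^sub>R \<xi>) - 1) * fourier F (t *\<^sub>R \<xi>)) = g t" for t
        by (cases "t = 0") (simp_all add: g_def H_def field_simps)
      then show ?thesis
        using equilibrium_radial_equation[OF eq K_integrable eps a(1) that, of \<xi>] by (simp add: H_def)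
    qed
    have gc: "continuous_on {a..1} g" unfolding g_def by (intro continuous_intros rc a Hc)
    \<comment> \<open>The radial equation holds in integrated form only; its integrand is
      continuous, which gives the derivative back.\<close>
    have Hd: "(H has_vector_derivative g t) (at t within {a..1})" if t: "t \<in> {a..1}" for t
    proof -
      have d: "((\<lambda>u. H a + integral {a..u} g) has_vector_derivative g t) (at t within {a..1})"
        using has_vector_derivative_add[OF has_vector_derivative_const integral_has_vector_derivative[OF gc t]] by simp
      have e: "H u = H a + integral {a..u} g" if "u \<in> {a..1}" for u
        using integral_unique[OF hi[of u]] that by simp
      show ?thesis by (rule has_vector_derivative_transform[OF t e d])
    qed
    define Q where "Q t = integral {a..t} (rate \<xi>)" for t
    have Qd: "(Q has_vector_derivative rate \<xi> t) (at t within {a..1})" if "t \<in> {a..1}" for t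
      unfolding Q_def by (rule integral_has_vector_derivative[OF rc[OF a(1)] that])
    have Ed: "((\<lambda>t. exp (?N * Q t)) has_vector_derivative (?N * rate \<xi> t) * exp (?N * Q t)) (at t within {a..1})" if "t \<in> {a..1}" for t
    proof -
      have "((\<lambda>t. ?N * Q t) has_vector_derivative ?N * rate \<xi> t) (at t within {a..1})"
        by (rule has_vector_derivative_mult_right[OF Qd[OF that]])
      from field_vector_diff_chain_within[OF this, of exp "exp (?N * Q t)"] show ?thesis
        by (simp add: o_def DERIV_exp has_field_derivative_at_within)
    qed
    \<comment> \<open>The product with the integrating factor is constant; since
      \<open>Q a = 0\<close>, comparing \<open>t = a\<close> with \<open>t = 1\<close> gives
      \<open>ha\<close>.\<close>
    have "((\<lambda>t. H t * exp (?N * Q t)) has_vector_derivative 0) (at t within {a..1})" if t: "t \<in> {a..1}" for t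
      using has_vector_derivative_mult[OF Hd[OF t] Ed[OF t]] by (simp add: g_def algebra_simps)
    from has_vector_derivative_zero_constant[OF convex_real_interval(5) this] obtain z
      where "\<And>t. t \<in> {a..1} \<Longrightarrow> H t * exp (?N * Q t) = z" by blast
    from this[of a] this[of 1] a show ?thesis by (simp add: Q_def)
  qed
  define a where "a n = inverse (real (Suc n))" for n
  have a: "0 < a n" "a n \<le> 1" for n by (auto simp: a_def field_simps)
  have a0: "a \<longlonglongrightarrow> 0" unfolding a_def by (rule LIMSEQ_inverse_real_of_nat)
  have "(\<lambda>n. H (a n)) \<longlonglongrightarrow> H 0"
    using Hc[of UNIV] a0 by (auto simp: continuous_on_eq_continuous_at intro: isCont_tendsto_compose)
  moreover have "(\<lambda>n. H 1 * exp (?N * integral {a n..1} (rate \<xi>))) \<longlonglongrightarrow> H 1 * exp (?N * integral {0..1} (rate \<xi>))"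
  proof (intro tendsto_mult tendsto_exp tendsto_const)
    show "(\<lambda>n. integral {a n..1} (rate \<xi>)) \<longlonglongrightarrow> integral {0..1} (rate \<xi>)"
      by (rule continuous_on_tendsto_compose[OF indefinite_integral_continuous_1'[OF rate_integrable] a0])
        (use a in \<open>auto intro!: always_eventually less_imp_le\<close>)
  qed
  ultimately have "H 0 = H 1 * exp (?N * decay_exponent (J s) \<epsilon> \<xi>)"
    unfolding ha[OF a] decay_exponent_def by (rule LIMSEQ_unique)
  then have "exp (?N * decay_exponent (J s) \<epsilon> \<xi>) * fourier F \<xi> = 1"
    using H0 by (simp add: H_def mult.commute)
  then show ?thesis by (metis exp_minus inverse_unique)
qed

section \<open>Regularity of the equilibrium\<close>

lemma powr_square:
  fixes x :: real
  assumes "x > 0"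
  shows "(x\<^sup>2) powr m = x powr (2 * m)"
proof -
  have "x\<^sup>2 = x powr 2" using assms by simp
  then show ?thesis by (simp only: powr_powr)
qed

text \<open>Inside the ball of radius \<open>R\<close> the weight is at most \<open>R\<close>.
  Outside, the power tail loses one order and stays integrable because \<open>2 * s > 1\<close>, and
  \<open>norm x\<close> is absorbed by the second moment of \<open>\<Psi>\<close>. The tail
  hypothesis bounds \<open>J s\<close> from above only, so nonnegativity is what controls the
  absolute value.\<close>

lemma H1_finite_moment:
  fixes J :: "real \<Rightarrow> 'a::euclidean_space \<Rightarrow> real"
  assumes H: "H1 J" and s: "1/2 < s" "s < 1" and \<epsilon>: "0 < \<epsilon>"
  shows "finite_moment_density (J s) \<epsilon>"
proof
  have sS: "s \<in> {1/2<..<1}" using s by auto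
  show pd: "prob_density (J s)" using H sS by (auto simp: H1_def)
  then have I: "integrable lborel (J s)" and nn: "AE x in lborel. 0 \<le> J s x" by (auto simp: prob_density_def)
  have [measurable]: "J s \<in> borel_measurable borel" using borel_measurable_integrable[OF I] by simp
  obtain C R and \<Psi> :: "'a \<Rightarrow> real" where C: "C > 0" and R: "R > 0"
    and \<Psi>: "\<Psi> \<in> borel_measurable lborel" "integrable lborel (\<lambda>x. (1 + norm x ^ 2) * \<bar>\<Psi> x\<bar>)"
    and le: "\<And>x. norm x \<ge> R \<Longrightarrow> J s x \<le> C * (1 - s) * norm x powr (- real DIM('a) - 2 * s) + \<Psi> x"
    using H sS unfolding H1_def by blast
  \<comment> \<open>The tail exponent after multiplication by \<open>norm x\<close>.\<close>
  define q where "q = real DIM('a) + 2 * s - 1"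
  have q: "q > real DIM('a)" "q \<ge> 0" using s by (auto simp: q_def)
  \<comment> \<open>For \<open>norm x \<ge> R\<close> one has
    \<open>1 + norm x \<le> (1 + 1 / R) * norm x\<close>; the power of \<open>1 + 1 / R\<close> pays
    for replacing \<open>norm x\<close> by \<open>1 + norm x\<close>.\<close>
  define k where "k = C * (1 - s) * ((1 + 1 / R) powr q)"
  have "integrable lborel (\<lambda>x::'a. R * \<bar>J s x\<bar> + k * (1 + norm x) powr (- q) + (1 + norm x ^ 2) * \<bar>\<Psi> x\<bar>)"
    using I \<Psi>(2) integrable_one_plus_norm_powr[OF q(1)] by auto
  then show "integrable lborel (\<lambda>x. norm x * \<bar>J s x\<bar>)"
  proof (rule Bochner_Integration.integrable_bound)
    show "AE x in lborel. norm (norm x * \<bar>J s x\<bar>) \<le> norm (R * \<bar>J s x\<bar> + k * (1 + norm x) powr (- q) + (1 + norm x ^ 2) * \<bar>\<Psi> x\<bar>)"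
      using nn
    proof eventually_elim
      case (elim x)
      have k0: "0 \<le> k * (1 + norm x) powr (- q)" using C s by (simp add: k_def)
      have \<Psi>0: "0 \<le> (1 + norm x ^ 2) * \<bar>\<Psi> x\<bar>" by simp
      have J0: "0 \<le> R * J s x" using R elim by simp
      have "norm x * J s x \<le> R * J s x + k * (1 + norm x) powr (- q) + (1 + norm x ^ 2) * \<bar>\<Psi> x\<bar>"
      proof (cases "norm x \<ge> R")
        case False
        then have "norm x * J s x \<le> R * J s x" using elim by (intro mult_right_mono) auto
        then show ?thesis using k0 \<Psi>0 by linarith
      next
        case True
        then have x0: "norm x > 0" using R by linarith
        have "norm x * J s x \<le> norm x * (C * (1 - s) * norm x powr (- real DIM('a) - 2 * s) + \<Psi> x)"
          by (intro mult_left_mono le True) auto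
        also have "\<dots> = C * (1 - s) * (norm x * norm x powr (- real DIM('a) - 2 * s)) + norm x * \<Psi> x"
          by (simp add: algebra_simps)
        also have "norm x * norm x powr (- real DIM('a) - 2 * s) = norm x powr (- q)"
          using x0 by (simp add: powr_mult_base q_def algebra_simps)
        also have "C * (1 - s) * norm x powr (- q) \<le> k * (1 + norm x) powr (- q)"
        proof -
          have "norm x * (1 / R) \<ge> 1" using True R by simp
          then have "1 + norm x \<le> (1 + 1 / R) * norm x" by (simp add: algebra_simps)
          then have "((1 + 1 / R) * norm x) powr (- q) \<le> (1 + norm x) powr (- q)"
            using q by (intro powr_mono2') (auto simp: add_pos_nonneg)
          then have "(1 + 1 / R) powr q * ((1 + 1 / R) powr (- q) * norm x powr (- q)) \<le> (1 + 1 / R) powr q * (1 + norm x) powr (- q)"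
            using R by (intro mult_left_mono) (auto simp: powr_mult)
          moreover have "(1 + 1 / R) powr q * ((1 + 1 / R) powr (- q) * norm x powr (- q)) = norm x powr (- q)"
          proof -
            have "1 + 1 / R \<noteq> 0" using R by (smt (verit) divide_pos_pos)
            then show ?thesis by (simp add: mult.assoc[symmetric] powr_add[symmetric])
          qed
          ultimately have "norm x powr (- q) \<le> (1 + 1 / R) powr q * (1 + norm x) powr (- q)" by simp
          then have "C * (1 - s) * norm x powr (- q) \<le> C * (1 - s) * ((1 + 1 / R) powr q * (1 + norm x) powr (- q))"
            using C s by (intro mult_left_mono) auto
          then show ?thesis by (simp add: k_def mult.assoc)
        qed
        also have "norm x * \<Psi> x \<le> (1 + norm x ^ 2) * \<bar>\<Psi> x\<bar>"
        proof -
          have "0 \<le> (norm x - 1)\<^sup>2 + norm x ^ 2 + 1" by simp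
          then have "norm x \<le> 1 + norm x ^ 2" by (simp add: power2_eq_square algebra_simps)
          then have "norm x * \<bar>\<Psi> x\<bar> \<le> (1 + norm x ^ 2) * \<bar>\<Psi> x\<bar>" by (rule mult_right_mono) auto
          moreover have "norm x * \<Psi> x \<le> norm x * \<bar>\<Psi> x\<bar>" by (rule mult_left_mono) auto
          ultimately show ?thesis by linarith
        qed
        finally show ?thesis using J0 by linarith
      qed
      moreover have "\<bar>J s x\<bar> = J s x" using elim by simp
      ultimately show ?case using k0 \<Psi>0 J0 by simp
    qed
  qed (use \<Psi>(1) in measurable)
qed (rule \<epsilon>)

locale equilibrium_density = finite_moment_density "J s" \<epsilon>
  for J :: "real \<Rightarrow> 'a::euclidean_space \<Rightarrow> real" and s \<epsilon> :: real +
  fixes F :: "'a \<Rightarrow> real"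
  assumes equilibrium: "equilibrium J s \<epsilon> F"
begin

definition "N = \<epsilon> powr (- 2 * s)"

lemma N_pos: "N > 0" using eps by (simp add: N_def)

lemma F_integrable: "integrable lborel F"
  using equilibrium by (simp add: equilibrium_def prob_density_def)

lemma fourier_formula: "fourier F \<xi> = exp (- (complex_of_real N * decay_exponent (J s) \<epsilon> \<xi>))"
  unfolding N_def by (rule equilibrium_fourier[OF equilibrium]) unfold_locales

lemma norm_fourier: "norm (fourier F \<xi>) = exp (- N * Re (decay_exponent (J s) \<epsilon> \<xi>))"
  by (simp add: fourier_formula)

lemma norm_fourier_le_1: "norm (fourier F \<xi>) \<le> 1"
proof -
  have "(\<integral>x. \<bar>F x\<bar> \<partial>lborel) = (\<integral>x. F x \<partial>lborel)"
    using equilibrium borel_measurable_integrable[OF F_integrable]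
    by (intro integral_cong_AE) (auto simp: equilibrium_def prob_density_def)
  then show ?thesis
    using norm_fourier_le[of F \<xi>] equilibrium by (simp add: equilibrium_def prob_density_def)
qed

text \<open>With \<open>\<eta>\<close> bounding the kernel transform outside a ball, the modulus is squeezed between
  powers of exponent \<open>- N * (1 \<plusminus> \<eta>)\<close>; taking \<open>\<eta>\<close> small suffices since all exponents in the
  theorem are strict.\<close>

lemma fourier_two_sided:
  assumes "\<eta> > 0"
  obtains R D where "R > 0" "D > 0"
    "\<And>\<xi>. norm \<xi> \<ge> R \<Longrightarrow> norm (fourier F \<xi>) \<le> D * norm \<xi> powr (- N * (1 - \<eta>))"
    "\<And>\<xi>. norm \<xi> \<ge> R \<Longrightarrow> norm \<xi> powr (- N * (1 + \<eta>)) \<le> D * norm (fourier F \<xi>)"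
proof -
  obtain R0 where R0: "R0 > 0" and small: "\<And>\<zeta>. norm \<zeta> \<ge> R0 \<Longrightarrow> norm (fourier (J s) \<zeta>) \<le> \<eta>"
    using riemann_lebesgue[OF K_integrable assms] by blast
  define E where "E = exp (N * (M1 * R0))"
  define k where "k = \<epsilon> / R0"
  have k: "k > 0" using eps R0 by (simp add: k_def)
  \<comment> \<open>One constant for both bounds: \<open>E\<close> comes from the bounded part of
    the exponent, and the powers of \<open>k\<close> from pulling \<open>\<epsilon> / R0\<close> out
    of the logarithm.\<close>
  define D where "D = max (E * k powr (- N * (1 - \<eta>))) (E / k powr (- N * (1 + \<eta>)))"
  have D: "D > 0" using k by (simp add: D_def E_def less_max_iff_disj)
  have key: "norm (fourier F \<xi>) \<le> E * (k * norm \<xi>) powr (- N * (1 - \<eta>))"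
      "(k * norm \<xi>) powr (- N * (1 + \<eta>)) \<le> E * norm (fourier F \<xi>)" if \<xi>: "norm \<xi> \<ge> R0 / \<epsilon>" for \<xi>
  proof -
    have \<xi>': "\<epsilon> * norm \<xi> \<ge> R0" using \<xi> eps by (simp add: field_simps)
    have pos: "k * norm \<xi> > 0" using \<xi> R0 eps k by (smt (verit) divide_pos_pos mult_pos_pos)
    define L where "L = ln (k * norm \<xi>)"
    define \<Phi> where "\<Phi> = Re (decay_exponent (J s) \<epsilon> \<xi>)"
    have b: "\<bar>\<Phi> - L\<bar> \<le> M1 * R0 + \<eta> * L"
      using Re_decay_exponent[OF R0 small \<xi>'] by (simp add: L_def \<Phi>_def k_def)
    have pw: "(k * norm \<xi>) powr y = exp (y * L)" for y using pos by (auto simp: powr_def L_def)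
    have "N * (L - M1 * R0 - \<eta> * L) \<le> N * \<Phi>" "N * \<Phi> \<le> N * (L + M1 * R0 + \<eta> * L)"
      using b N_pos by (auto intro!: mult_left_mono simp: abs_le_iff)
    then show "norm (fourier F \<xi>) \<le> E * (k * norm \<xi>) powr (- N * (1 - \<eta>))"
      "(k * norm \<xi>) powr (- N * (1 + \<eta>)) \<le> E * norm (fourier F \<xi>)"
      unfolding norm_fourier E_def pw \<Phi>_def[symmetric] exp_add[symmetric]
      by (auto simp: algebra_simps)
  qed
  show ?thesis
  proof (rule that[of "R0 / \<epsilon>" D])
    show "R0 / \<epsilon> > 0" using R0 eps by simp
    fix \<xi> :: 'a assume \<xi>: "norm \<xi> \<ge> R0 / \<epsilon>"
    have "norm (fourier F \<xi>) \<le> (E * k powr (- N * (1 - \<eta>))) * norm \<xi> powr (- N * (1 - \<eta>))"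
      using key(1)[OF \<xi>] k by (simp add: powr_mult)
    also have "\<dots> \<le> D * norm \<xi> powr (- N * (1 - \<eta>))" by (intro mult_right_mono) (auto simp: D_def)
    finally show "norm (fourier F \<xi>) \<le> D * norm \<xi> powr (- N * (1 - \<eta>))" .
    have "norm \<xi> powr (- N * (1 + \<eta>)) = (k * norm \<xi>) powr (- N * (1 + \<eta>)) / k powr (- N * (1 + \<eta>))"
      using k by (simp add: powr_mult)
    also have "\<dots> \<le> E * norm (fourier F \<xi>) / k powr (- N * (1 + \<eta>))"
      using key(2)[OF \<xi>] by (rule divide_right_mono) simp
    also have "\<dots> = (E / k powr (- N * (1 + \<eta>))) * norm (fourier F \<xi>)" by simp
    also have "\<dots> \<le> D * norm (fourier F \<xi>)" by (intro mult_right_mono) (auto simp: D_def)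
    finally show "norm \<xi> powr (- N * (1 + \<eta>)) \<le> D * norm (fourier F \<xi>)" .
  qed (rule D)
qed

text \<open>\<open>\<eta>\<close> is chosen to turn the exponent \<open>N * (1 - \<eta>)\<close>
  into \<open>p\<close>. Replacing \<open>norm \<xi>\<close> by \<open>1 + norm \<xi>\<close> costs
  \<open>2 powr p\<close> where the norm is at least 1, and on the remaining ball the bound 1 on the
  transform is used.\<close>

lemma fourier_upper:
  assumes p: "0 < p" "p < N"
  obtains C where "C > 0" "\<And>\<xi>. norm (fourier F \<xi>) \<le> C * (1 + norm \<xi>) powr (- p)"
proof -
  define \<eta> where "\<eta> = (N - p) / N"
  have "\<eta> > 0" and e: "- N * (1 - \<eta>) = - p" using p N_pos by (auto simp: \<eta>_def field_simps)
  obtain R D where R: "R > 0" "D > 0"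
    and up: "\<And>\<xi>. norm \<xi> \<ge> R \<Longrightarrow> norm (fourier F \<xi>) \<le> D * norm \<xi> powr (- N * (1 - \<eta>))"
    by (rule fourier_two_sided[OF \<open>\<eta> > 0\<close>]) blast
  define R' where "R' = max R 1"
  define C where "C = max (D * 2 powr p) ((1 + R') powr p)"
  have "norm (fourier F \<xi>) \<le> C * (1 + norm \<xi>) powr (- p)" for \<xi>
  proof (cases "norm \<xi> \<ge> R'")
    case True
    then have n: "norm \<xi> \<ge> R" "norm \<xi> \<ge> 1" by (auto simp: R'_def)
    have "norm (fourier F \<xi>) \<le> D * norm \<xi> powr (- p)" using up[OF n(1)] by (simp only: e)
    also have "\<dots> \<le> D * ((1 + norm \<xi>) / 2) powr (- p)"
      using n p R by (intro mult_left_mono powr_mono2') auto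
    also have "\<dots> = (D * 2 powr p) * (1 + norm \<xi>) powr (- p)"
    proof -
      have "((1 + norm \<xi>) / 2) powr (- p) = (1 + norm \<xi>) powr (- p) / 2 powr (- p)"
        by (rule powr_divide)
      also have "\<dots> = 2 powr p * (1 + norm \<xi>) powr (- p)"
        by (simp add: powr_minus divide_inverse mult.commute)
      finally show ?thesis by simp
    qed
    also have "\<dots> \<le> C * (1 + norm \<xi>) powr (- p)" by (intro mult_right_mono) (auto simp: C_def)
    finally show ?thesis .
  next
    case False
    have "norm (fourier F \<xi>) \<le> 1" by (rule norm_fourier_le_1)
    also have "1 \<le> (1 + R') powr p * (1 + norm \<xi>) powr (- p)"
    proof -
      have "(1 + norm \<xi>) powr p \<le> (1 + R') powr p" using False p by (intro powr_mono2) auto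
      moreover have "(1 + norm \<xi>) powr p > 0" by (simp add: add_nonneg_eq_0_iff)
      ultimately show ?thesis by (simp add: powr_minus divide_inverse[symmetric])
    qed
    also have "\<dots> \<le> C * (1 + norm \<xi>) powr (- p)" by (intro mult_right_mono) (auto simp: C_def)
    finally show ?thesis .
  qed
  moreover have "C > 0" using R by (simp add: C_def less_max_iff_disj)
  ultimately show ?thesis using that by blast
qed

lemma fourier_lower:
  assumes p: "p > N"
  obtains R D where "R > 0" "D > 0" "\<And>\<xi>. norm \<xi> \<ge> R \<Longrightarrow> norm \<xi> powr (- p) \<le> D * norm (fourier F \<xi>)"
proof -
  define \<eta> where "\<eta> = (p - N) / N"
  have "\<eta> > 0" and e: "- N * (1 + \<eta>) = - p" using p N_pos by (auto simp: \<eta>_def field_simps)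
  show ?thesis
    by (rule fourier_two_sided[OF \<open>\<eta> > 0\<close>]) (use that in \<open>simp only: e\<close>)
qed

section \<open>The Sobolev threshold\<close>

lemma sobolev_pos:
  assumes m: "0 < m" "m < N - real DIM('a) / 2"
  shows "sobolev_H m F"
proof -
  \<comment> \<open>The midpoint of \<open>N\<close> and \<open>m + DIM('a) / 2\<close>: it lies
    below \<open>N\<close>, and the squared bound still beats the weight by more than the
    dimension.\<close>
  define p where "p = (N + m + real DIM('a) / 2) / 2"
  have p: "0 < p" "p < N" "2 * p - 2 * m > real DIM('a)" using m N_pos by (auto simp: p_def field_simps)
  obtain C where C: "C > 0" "\<And>\<xi>. norm (fourier F \<xi>) \<le> C * (1 + norm \<xi>) powr (- p)"
    using fourier_upper[OF p(1,2)] by blast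
  note [measurable] = fourier_measurable[OF F_integrable]
  show ?thesis
    unfolding sobolev_H_def
  proof (rule Bochner_Integration.integrable_bound[OF integrable_mult_right[OF integrable_one_plus_norm_powr[OF p(3)], of "C\<^sup>2"]])
    show "AE \<xi> in lborel. norm ((1 + norm \<xi> ^ 2) powr m * (cmod (fourier F \<xi>))\<^sup>2) \<le> norm (C\<^sup>2 * (1 + norm \<xi>) powr (- (2 * p - 2 * m)))"
    proof (rule AE_I2)
      fix \<xi> :: 'a
      have pos: "1 + norm \<xi> > 0" by (simp add: add_pos_nonneg)
      have "(1 + norm \<xi> ^ 2) powr m \<le> ((1 + norm \<xi>) ^ 2) powr m"
        using m by (intro powr_mono2) (auto simp: power2_eq_square algebra_simps)
      also have "\<dots> = (1 + norm \<xi>) powr (2 * m)"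
        by (rule powr_square[OF pos])
      finally have "(1 + norm \<xi> ^ 2) powr m * (cmod (fourier F \<xi>))\<^sup>2 \<le> (1 + norm \<xi>) powr (2 * m) * (C * (1 + norm \<xi>) powr (- p))\<^sup>2"
        using C(2)[of \<xi>] by (intro mult_mono power_mono) auto
      also have "\<dots> = C\<^sup>2 * (1 + norm \<xi>) powr (- (2 * p - 2 * m))"
        using pos by (simp add: power2_eq_square powr_add[symmetric] powr_diff powr_minus field_simps)
      finally show "norm ((1 + norm \<xi> ^ 2) powr m * (cmod (fourier F \<xi>))\<^sup>2) \<le> norm (C\<^sup>2 * (1 + norm \<xi>) powr (- (2 * p - 2 * m)))"
        by simp
    qed
  qed measurable
qed

lemma sobolev_neg:
  assumes m: "m > N - real DIM('a) / 2"
  shows "\<not> sobolev_H m F"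
proof
  assume S: "sobolev_H m F"
  define p where "p = (N + m + real DIM('a) / 2) / 2"
  have p: "p > N" "2 * p - 2 * m < real DIM('a)" using m by (auto simp: p_def field_simps)
  obtain R D where R: "R > 0" "D > 0" and lo: "\<And>\<xi>. norm \<xi> \<ge> R \<Longrightarrow> norm \<xi> powr (- p) \<le> D * norm (fourier F \<xi>)"
    using fourier_lower[OF p(1)] by blast
  \<comment> \<open>\<open>m\<close> may be negative here. The weight then decreases, and
    \<open>1 + norm \<xi> ^ 2 \<le> 2 * norm \<xi> ^ 2\<close> costs the factor
    \<open>2 powr m\<close>.\<close>
  define k where "k = min 1 (2 powr m)"
  show False
  proof (rule not_integrable_powr_tail[OF S[unfolded sobolev_H_def] _ _ p(2)])
    show "k / D\<^sup>2 > 0" using R by (simp add: k_def)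
    fix \<xi> :: 'a assume n: "norm \<xi> \<ge> max R 1"
    then have n1: "norm \<xi> \<ge> R" "norm \<xi> \<ge> 1" by auto
    have sq: "(norm \<xi> ^ 2) powr m = norm \<xi> powr (2 * m)"
      by (rule powr_square) (use n1 in linarith)
    have "k * norm \<xi> powr (2 * m) \<le> (1 + norm \<xi> ^ 2) powr m"
    proof (cases "m \<ge> 0")
      case True
      have "k * norm \<xi> powr (2 * m) \<le> 1 * norm \<xi> powr (2 * m)" by (intro mult_right_mono) (auto simp: k_def)
      also have "\<dots> = (norm \<xi> ^ 2) powr m" by (simp only: sq mult_1)
      also have "\<dots> \<le> (1 + norm \<xi> ^ 2) powr m" using True by (intro powr_mono2) auto
      finally show ?thesis .
    next
      case False
      have "k * norm \<xi> powr (2 * m) \<le> 2 powr m * norm \<xi> powr (2 * m)" by (intro mult_right_mono) (auto simp: k_def)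
      also have "norm \<xi> powr (2 * m) = (norm \<xi> ^ 2) powr m" by (rule sq[symmetric])
      also have "2 powr m * (norm \<xi> ^ 2) powr m = (2 * norm \<xi> ^ 2) powr m" by (simp add: powr_mult)
      also have "\<dots> \<le> (1 + norm \<xi> ^ 2) powr m"
        using False one_le_power[OF n1(2), of 2] by (intro powr_mono2') (auto simp: add_pos_nonneg)
      finally show ?thesis by (simp only: sq)
    qed
    moreover have "(norm \<xi> powr (- p) / D)\<^sup>2 \<le> (cmod (fourier F \<xi>))\<^sup>2"
      using lo[OF n1(1)] R by (intro power_mono) (auto simp: field_simps)
    ultimately have "(k * norm \<xi> powr (2 * m)) * (norm \<xi> powr (- p) / D)\<^sup>2 \<le> (1 + norm \<xi> ^ 2) powr m * (cmod (fourier F \<xi>))\<^sup>2"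
      by (intro mult_mono) auto
    moreover have "(k * norm \<xi> powr (2 * m)) * (norm \<xi> powr (- p) / D)\<^sup>2 = k / D\<^sup>2 * norm \<xi> powr (- (2 * p - 2 * m))"
      using n1 R by (simp add: power2_eq_square powr_diff powr_minus powr_add[symmetric] field_simps)
    ultimately show "k / D\<^sup>2 * norm \<xi> powr (- (2 * p - 2 * m)) \<le> (1 + norm \<xi> ^ 2) powr m * (cmod (fourier F \<xi>))\<^sup>2"
      by simp
  qed auto
qed

section \<open>The Hoelder thresholds\<close>

lemma holder_pos:
  assumes m: "0 < m" "m < N - real DIM('a)"
  shows "in_holder (nat \<lfloor>m\<rfloor>) (m - of_int \<lfloor>m\<rfloor>) F"
proof (rule in_holder_if_fourier_decay[OF F_integrable m(1)])
  \<comment> \<open>The midpoint of \<open>N\<close> and \<open>m + DIM('a)\<close>. The full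
    dimension enters because the transform itself, not its square, has to be integrated.\<close>
  define p where "p = (N + m + real DIM('a)) / 2"
  have p: "0 < p" "p < N" "p - m > real DIM('a)" using m N_pos by (auto simp: p_def field_simps)
  obtain C where C: "C > 0" "\<And>\<xi>. norm (fourier F \<xi>) \<le> C * (1 + norm \<xi>) powr (- p)"
    using fourier_upper[OF p(1,2)] by blast
  note [measurable] = fourier_measurable[OF F_integrable]
  show "integrable lborel (\<lambda>\<xi>. (1 + norm \<xi>) powr m * norm (fourier F \<xi>))"
  proof (rule Bochner_Integration.integrable_bound[OF integrable_mult_right[OF integrable_one_plus_norm_powr[OF p(3)], of C]])
    show "AE \<xi> in lborel. norm ((1 + norm \<xi>) powr m * norm (fourier F \<xi>)) \<le> norm (C * (1 + norm \<xi>) powr (- (p - m)))"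
    proof (rule AE_I2)
      fix \<xi> :: 'a
      have "(1 + norm \<xi>) powr m * norm (fourier F \<xi>) \<le> (1 + norm \<xi>) powr m * (C * (1 + norm \<xi>) powr (- p))"
        by (intro mult_left_mono C) auto
      also have "\<dots> = C * (1 + norm \<xi>) powr (- (p - m))"
        by (simp add: powr_diff powr_minus field_simps)
      finally show "norm ((1 + norm \<xi>) powr m * norm (fourier F \<xi>)) \<le> norm (C * (1 + norm \<xi>) powr (- (p - m)))"
        using C(1) by simp
    qed
  qed measurable
qed

text \<open>A shift by \<open>\<rho> *\<^sub>R z\<close> multiplies the transform by
  \<open>exp v\<close> with \<open>norm v \<le> \<rho> * (L * norm z)\<close>. The average therefore
  differs from the value at \<open>\<zeta>\<close> by at most \<open>\<rho> * W\<close> times that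
  value, with one \<open>\<rho>\<close> for all \<open>\<zeta>\<close>.\<close>

lemma windowed_fourier_lower:
  obtains \<rho> where "\<rho> > 0"
    "\<And>\<zeta>. norm (fourier F \<zeta>) \<le> 2 * norm (\<integral>z. complex_of_real (gauss z) * fourier F (\<zeta> - \<rho> *\<^sub>R z) \<partial>lborel)"
proof -
  define L where "L = N * (\<epsilon> * M1)"
  have L0: "L \<ge> 0" using N_pos eps M1_nonneg by (simp add: L_def)
  define w where "w z = gauss z * (exp (L * norm z) * (L * norm z))" for z :: 'a
  define G where "G = exp (L\<^sup>2) * L / sqrt (2 * pi) ^ DIM('a)"
  have wI: "integrable lborel w"
  proof (rule Bochner_Integration.integrable_bound[OF integrable_mult_right[OF integrable_norm_power_gaussian[of "1/4" 1], of G]])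
    show "AE z in lborel. norm (w z) \<le> norm (G * (norm z ^ 1 * exp (- (1/4) * (norm z)\<^sup>2)))"
    proof (rule AE_I2)
      fix z :: 'a
      \<comment> \<open>Half of the Gaussian exponent absorbs the exponential growth
        \<open>exp (L * norm z)\<close>; the other half keeps \<open>w\<close> integrable.\<close>
      have "0 \<le> (norm z / 2 - L)\<^sup>2" by simp
      then have "- (norm z)\<^sup>2 / 2 + L * norm z \<le> L\<^sup>2 + - (1/4) * (norm z)\<^sup>2"
        by (simp add: power2_eq_square algebra_simps)
      then have "exp (- (norm z)\<^sup>2 / 2) * exp (L * norm z) \<le> exp (L\<^sup>2) * exp (- (1/4) * (norm z)\<^sup>2)"
        by (simp only: exp_add[symmetric] exp_le_cancel_iff)
      then have "(exp (- (norm z)\<^sup>2 / 2) * exp (L * norm z)) * (L * norm z / sqrt (2 * pi) ^ DIM('a))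
          \<le> (exp (L\<^sup>2) * exp (- (1/4) * (norm z)\<^sup>2)) * (L * norm z / sqrt (2 * pi) ^ DIM('a))"
        using L0 by (intro mult_right_mono) auto
      then have "w z \<le> G * (norm z ^ 1 * exp (- (1/4) * (norm z)\<^sup>2))"
        by (simp add: w_def G_def gauss_def mult_ac)
      moreover have "0 \<le> w z" using L0 by (simp add: w_def)
      ultimately show "norm (w z) \<le> norm (G * (norm z ^ 1 * exp (- (1/4) * (norm z)\<^sup>2)))" by simp
    qed
  qed (simp_all add: w_def[abs_def])
  define W where "W = (\<integral>z. w z \<partial>lborel)"
  have W0: "W \<ge> 0" using L0 by (simp add: W_def w_def)
  \<comment> \<open>\<open>\<rho> \<le> 1\<close> lets the weight \<open>w\<close> be chosen
    independently of \<open>\<rho>\<close>; the other entry makes the relative error at most one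
    half.\<close>
  define \<rho> where "\<rho> = min 1 (1 / (2 * (W + 1)))"
  have \<rho>: "\<rho> > 0" "\<rho> \<le> 1" using W0 by (auto simp: \<rho>_def)
  have \<rho>W: "\<rho> * W \<le> 1 / 2"
  proof -
    have "\<rho> * W \<le> (1 / (2 * (W + 1))) * W" using W0 by (intro mult_right_mono) (auto simp: \<rho>_def)
    also have "\<dots> \<le> 1 / 2" using W0 by (simp add: field_simps)
    finally show ?thesis .
  qed
  note [measurable] = fourier_measurable[OF F_integrable]
  have "norm (fourier F \<zeta>) \<le> 2 * norm (\<integral>z. complex_of_real (gauss z) * fourier F (\<zeta> - \<rho> *\<^sub>R z) \<partial>lborel)" for \<zeta>
  proof -
    let ?I = "\<integral>z. complex_of_real (gauss z) * fourier F (\<zeta> - \<rho> *\<^sub>R z) \<partial>lborel"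
    have i1: "integrable lborel (\<lambda>z. complex_of_real (gauss z) * fourier F (\<zeta> - \<rho> *\<^sub>R z))"
      by (rule Bochner_Integration.integrable_bound[OF gauss_integrable])
        (use norm_fourier_le_1 in \<open>auto simp: norm_mult intro!: AE_I2 mult_left_le\<close>)
    have i2: "integrable lborel (\<lambda>z::'a. complex_of_real (gauss z) * fourier F \<zeta>)" by simp
    have "?I - fourier F \<zeta> = ?I - (\<integral>z. complex_of_real (gauss z) * fourier F \<zeta> \<partial>(lborel :: 'a measure))"
      by (simp add: integral_complex_of_real)
    also have "\<dots> = (\<integral>z. complex_of_real (gauss z) * fourier F (\<zeta> - \<rho> *\<^sub>R z) - complex_of_real (gauss z) * fourier F \<zeta> \<partial>lborel)"
      using i1 i2 by simp
    also have "norm \<dots> \<le> (\<integral>z. \<rho> * norm (fourier F \<zeta>) * w z \<partial>lborel)"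
    proof (intro order_trans[OF integral_norm_bound integral_mono_AE'] AE_I2)
      fix z :: 'a
      define v where "v = - (complex_of_real N * (decay_exponent (J s) \<epsilon> (\<zeta> - \<rho> *\<^sub>R z) - decay_exponent (J s) \<epsilon> \<zeta>))"
      have "fourier F (\<zeta> - \<rho> *\<^sub>R z) = fourier F \<zeta> * exp v"
        unfolding fourier_formula v_def exp_add[symmetric] by (simp add: algebra_simps)
      then have eq: "complex_of_real (gauss z) * fourier F (\<zeta> - \<rho> *\<^sub>R z) - complex_of_real (gauss z) * fourier F \<zeta>
          = complex_of_real (gauss z) * (fourier F \<zeta> * (exp v - 1))"
        by (simp add: algebra_simps)
      have "norm v = N * norm (decay_exponent (J s) \<epsilon> (\<zeta> - \<rho> *\<^sub>R z) - decay_exponent (J s) \<epsilon> \<zeta>)"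
        using N_pos by (simp add: v_def norm_mult)
      also have "\<dots> \<le> N * (\<epsilon> * M1 * norm ((\<zeta> - \<rho> *\<^sub>R z) - \<zeta>))"
        using N_pos by (intro mult_left_mono decay_exponent_lipschitz) auto
      also have "\<dots> = \<rho> * (L * norm z)" using \<rho> by (simp add: L_def)
      finally have v: "norm v \<le> \<rho> * (L * norm z)" .
      then have v1: "norm v \<le> L * norm z"
        using \<rho> L0 by (meson mult_left_le_one_le mult_nonneg_nonneg norm_ge_zero order_trans less_imp_le)
      have "norm (exp v - 1) \<le> exp (norm v) * norm v"
        using Taylor_exp_field[of v 0] by simp
      also have "\<dots> \<le> exp (L * norm z) * (\<rho> * (L * norm z))"
        using v v1 by (intro mult_mono) auto
      finally have "norm (complex_of_real (gauss z) * (fourier F \<zeta> * (exp v - 1))) \<le> gauss z * (norm (fourier F \<zeta>) * (exp (L * norm z) * (\<rho> * (L * norm z))))"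
        unfolding norm_mult by (intro mult_mono) auto
      also have "\<dots> = \<rho> * norm (fourier F \<zeta>) * w z" by (simp add: w_def)
      finally show "norm (complex_of_real (gauss z) * fourier F (\<zeta> - \<rho> *\<^sub>R z) - complex_of_real (gauss z) * fourier F \<zeta>) \<le> \<rho> * norm (fourier F \<zeta>) * w z"
        unfolding eq .
      show "0 \<le> \<rho> * norm (fourier F \<zeta>) * w z" using \<rho> L0 by (simp add: w_def)
    qed (use wI in simp)
    also have "\<dots> = norm (fourier F \<zeta>) * (\<rho> * W)" by (simp add: W_def)
    also have "\<dots> \<le> norm (fourier F \<zeta>) * (1 / 2)" by (intro mult_left_mono \<rho>W) auto
    finally have "norm (?I - fourier F \<zeta>) \<le> norm (fourier F \<zeta>) / 2" by simp
    moreover have "norm (fourier F \<zeta>) \<le> norm ?I + norm (?I - fourier F \<zeta>)"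
      using norm_triangle_ineq4[of ?I "?I - fourier F \<zeta>"] by simp
    ultimately show ?thesis by linarith
  qed
  with \<rho>(1) that show ?thesis by blast
qed

text \<open>One coordinate direction suffices, since the lower bound on the transform holds in all
  directions. Along it the windowed transform decays like \<open>\<Lambda> powr (- m)\<close> and
  dominates the transform itself, which decays no faster than any power beyond
  \<open>N\<close>.\<close>

lemma holder_neg:
  assumes m: "m > N"
  shows "\<not> in_holder (nat \<lfloor>m\<rfloor>) (m - of_int \<lfloor>m\<rfloor>) F"
proof
  define k where "k = nat \<lfloor>m\<rfloor>"
  define \<alpha> where "\<alpha> = m - of_int \<lfloor>m\<rfloor>"
  have "m > 0" using m N_pos by simp
  then have k\<alpha>: "real k + \<alpha> = m" "0 \<le> \<alpha>" "\<alpha> \<le> 1"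
    using floor_correct[of m] unfolding k_def \<alpha>_def by (simp_all add: of_nat_nat) linarith
  assume "in_holder (nat \<lfloor>m\<rfloor>) (m - of_int \<lfloor>m\<rfloor>) F"
  then obtain g where g: "holder_space k \<alpha> g" and Fg: "AE x in lborel. F x = g x"
    unfolding in_holder_def k_def \<alpha>_def by blast
  obtain e :: 'a where e: "e \<in> Basis" using nonempty_Basis by blast
  obtain \<rho> where \<rho>: "\<rho> > 0"
    and half: "\<And>\<zeta>. norm (fourier F \<zeta>) \<le> 2 * norm (\<integral>z. complex_of_real (gauss z) * fourier F (\<zeta> - \<rho> *\<^sub>R z) \<partial>lborel)"
    using windowed_fourier_lower by blast
  \<comment> \<open>The Gaussian window of this parameter is exactly the one whose frequency average
    has width \<open>\<rho>\<close>.\<close>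
  have c: "\<rho>\<^sup>2 / 2 > 0" using \<rho> by simp
  obtain C where C: "\<And>\<Lambda>. \<Lambda> \<ge> 1 \<Longrightarrow>
    norm (\<integral>x. cis (- (x \<bullet> (\<Lambda> *\<^sub>R e))) * of_real (g x * exp (- (\<rho>\<^sup>2 / 2) * (norm x)\<^sup>2)) \<partial>lborel) \<le> C * \<Lambda> powr (- (real k + \<alpha>))"
    using holder_windowed_fourier_decay[OF g k\<alpha>(2,3) c e] by blast
  have gc: "continuous_on UNIV g"
    using g by (auto simp: holder_space_def Ck_bdd_def dest!: spec[of _ "[]"])
  have [measurable]: "g \<in> borel_measurable borel" by (rule borel_measurable_continuous_onI[OF gc])
  have [measurable]: "F \<in> borel_measurable borel" using borel_measurable_integrable[OF F_integrable] by simp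
  have up: "norm (fourier F (\<Lambda> *\<^sub>R e)) \<le> 2 * C * \<Lambda> powr (- m)" if "\<Lambda> \<ge> 1" for \<Lambda>
  proof -
    have "(\<integral>z. complex_of_real (gauss z) * fourier F (\<Lambda> *\<^sub>R e - \<rho> *\<^sub>R z) \<partial>lborel)
        = (\<integral>x. cis (- (x \<bullet> (\<Lambda> *\<^sub>R e))) * of_real (F x * exp (- \<rho>\<^sup>2 * (norm x)\<^sup>2 / 2)) \<partial>lborel)"
      by (rule fourier_mult_gaussian[OF F_integrable, symmetric])
    also have "\<dots> = (\<integral>x. cis (- (x \<bullet> (\<Lambda> *\<^sub>R e))) * of_real (g x * exp (- (\<rho>\<^sup>2 / 2) * (norm x)\<^sup>2)) \<partial>lborel)"
      using Fg by (intro integral_cong_AE) auto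
    finally show ?thesis
      using half[of "\<Lambda> *\<^sub>R e"] C[OF that] by (simp add: k\<alpha>(1))
  qed
  \<comment> \<open>Strictly between \<open>N\<close> and \<open>m\<close>, so that
    \<open>\<Lambda> powr (m - p)\<close> is unbounded while \<open>bd\<close> bounds it.\<close>
  define p where "p = (N + m) / 2"
  have p: "p > N" "p < m" using m by (auto simp: p_def field_simps)
  obtain R D where R: "R > 0" "D > 0" and lo: "\<And>\<xi>. norm \<xi> \<ge> R \<Longrightarrow> norm \<xi> powr (- p) \<le> D * norm (fourier F \<xi>)"
    using fourier_lower[OF p(1)] by blast
  have bd: "\<Lambda> powr (m - p) \<le> D * (2 * C)" if \<Lambda>: "\<Lambda> \<ge> max R 1" for \<Lambda>
  proof -
    have "\<Lambda> powr (- p) \<le> D * norm (fourier F (\<Lambda> *\<^sub>R e))"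
      using lo[of "\<Lambda> *\<^sub>R e"] e \<Lambda> by simp
    also have "\<dots> \<le> D * (2 * C * \<Lambda> powr (- m))"
      using R \<Lambda> by (intro mult_left_mono up) auto
    finally have "\<Lambda> powr (- p) * \<Lambda> powr m \<le> (D * (2 * C * \<Lambda> powr (- m))) * \<Lambda> powr m"
      by (rule mult_right_mono) simp
    also have "\<dots> = D * (2 * C)"
      using \<Lambda> by (simp add: powr_minus field_simps)
    finally show ?thesis by (simp add: powr_add[symmetric] diff_conv_add_uminus add.commute del: add_uminus_conv_diff)
  qed
  define B where "B = \<bar>D * (2 * C)\<bar> + 1"
  define \<Lambda> where "\<Lambda> = max (max R 1) (B powr (1 / (m - p)))"
  have "B = (B powr (1 / (m - p))) powr (m - p)" using p by (simp add: powr_powr B_def)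
  also have "\<dots> \<le> \<Lambda> powr (m - p)" using p by (intro powr_mono2) (auto simp: \<Lambda>_def)
  also have "\<dots> \<le> D * (2 * C)" by (rule bd) (simp add: \<Lambda>_def)
  finally show False by (simp add: B_def)
qed

end

theorem theorem3p10:
  fixes J :: "real \<Rightarrow> 'a::euclidean_space \<Rightarrow> real" and F :: "'a \<Rightarrow> real"
    and \<epsilon> s :: real
  assumes "H1 J" and "0 < \<epsilon>" and "\<epsilon> \<le> 1" and "1/2 < s" and "s < 1"
    and "equilibrium J s \<epsilon> F"
  shows "(\<forall>m. 0 < m \<and> m < 1 / \<epsilon> powr (2 * s) - real DIM('a) / 2 \<longrightarrow> sobolev_H m F)
       \<and> (\<forall>m. m > 1 / \<epsilon> powr (2 * s) - real DIM('a) / 2 \<longrightarrow> \<not> sobolev_H m F)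
       \<and> (\<forall>m. 0 < m \<and> m < 1 / \<epsilon> powr (2 * s) - real DIM('a) \<longrightarrow>
              in_holder (nat \<lfloor>m\<rfloor>) (m - of_int \<lfloor>m\<rfloor>) F)
       \<and> (\<forall>m. m > 1 / \<epsilon> powr (2 * s) \<longrightarrow>
              \<not> in_holder (nat \<lfloor>m\<rfloor>) (m - of_int \<lfloor>m\<rfloor>) F)"
proof -
  interpret finite_moment_density "J s" \<epsilon>
    by (rule H1_finite_moment) fact+
  interpret equilibrium_density J s \<epsilon> F
    by unfold_locales fact
  have "1 / \<epsilon> powr (2 * s) = N"
    by (simp add: N_def powr_minus divide_inverse)
  then show ?thesis
    using sobolev_pos sobolev_neg holder_pos holder_neg by simp
qed

end
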